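(* Let $C$ be a smooth projective curve of genus $g\geq 1$ over an algebraically closed field $k$, let $P$ be a point of $C$, and let $d\geq 1$ be an integer. Let $C\hookrightarrow \mathbb{P}(\mathbf{w})$, $\mathbf w=(w_0,\dots,w_n)$, be the minimal weighted embedding induced by $\mathcal{O}_C(dP)$. Then $\mathbb{P}(\mathbf{w})$ has dimension $\leq d\,q_d$ (i.e. $n\le d\,q_d$), and for every $0\leq i\leq \dim\mathbb{P}(\mathbf{w})=n$, \[ w_i\leq q_d+\left\lceil\frac{F(P)}{d}\right\rceil. \] Furthermore, when $d>F(P)$, $\mathbb{P}(\mathbf{w})$ has the form $\mathbb{P}(1^a,2^b)$ where $a=d+1-g$; that is, exactly $d+1-g$ of the weights equal $1$ and all remaining $b$ weights equal $2$.
   Context: The section ring is $R_d=\bigoplus_{m\geq 0}H^0(C,\mathcal{O}_C(mdP))$, graded by $m$. Choose homogeneous elements $f_0,\dots,f_n$ of positive degree in $R_d$ whose classes form a $k$-basis of $(R_d)_+/((R_d)_+)^2$ (a minimal homogeneous $k$-algebra generating set), and set $w_i=\deg f_i$; the multiset of the $w_i$ does not depend on the choice. The surjection $S_d=k[x_0,\dots,x_n]\to R_d$, $x_i\mapsto f_i$, with $\deg x_i=w_i$, realizes $C\cong \operatorname{Proj} R_d$ as a closed subvariety of the weighted projective space $\mathbb{P}(\mathbf w)=\operatorname{Proj}S_d$; this is the minimal weighted embedding induced by $\mathcal{O}_C(dP)$. The Weierstrass semigroup of $P$ is $H(P)=\{-\operatorname{ord}_P(f)\mid f\in k(C)^\times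 \text{ regular away from }P\}\subseteq\mathbb{Z}_{\ge 0}$. The Frobenius number $F(P)$ is the largest element of $\mathbb{Z}_{\geq 0}\setminus H(P)$ (a set of cardinality $g$). Finally $q_d=\min\{q\geq 1\mid qd\in H(P)\}$. *)

theory Defs
  imports
    "HOL-Library.Poly_Mapping"
    "HOL-Library.Function_Algebras"
    "HOL-Computational_Algebra.Computational_Algebra"
begin

section \<open>Linear algebra modulo a subspace\<close>

text \<open>
  For subspaces \<open>W \<subseteq> V\<close> of a vector space with scalar multiplication \<open>s\<close>: the classes of the
  \<open>b i\<close>, \<open>i \<in> I\<close>, form a finite basis of \<open>V / W\<close>.
\<close>

definition basis_mod ::
  "('k::field \<Rightarrow> 'v \<Rightarrow> 'v::ab_group_add) \<Rightarrow> 'v set \<Rightarrow> 'v set \<Rightarrow> 'i set \<Rightarrow> ('i \<Rightarrow> 'v) \<Rightarrow> bool" where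
  "basis_mod s V W I b \<longleftrightarrow> finite I \<and> (\<forall>i\<in>I. b i \<in> V) \<and>
     (\<forall>v\<in>V. \<exists>c. v - (\<Sum>i\<in>I. s (c i) (b i)) \<in> W) \<and>
     (\<forall>c. (\<Sum>i\<in>I. s (c i) (b i)) \<in> W \<longrightarrow> (\<forall>i\<in>I. c i = 0))"

definition has_dim_mod ::
  "('k::field \<Rightarrow> 'v \<Rightarrow> 'v::ab_group_add) \<Rightarrow> 'v set \<Rightarrow> 'v set \<Rightarrow> nat \<Rightarrow> bool" where
  "has_dim_mod s V W r \<longleftrightarrow> (\<exists>b. basis_mod s V W {..<r} b)"

text \<open>The additive span of all products, i.e. the product of two ideals.\<close>

definition product_span :: "'r::comm_ring_1 set \<Rightarrow> 'r set \<Rightarrow> 'r set" where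
  "product_span A B =
     {(\<Sum>i<l. a i * b i) | (l::nat) a b. \<forall>i<l. a i \<in> A \<and> b i \<in> B}"

section \<open>Polynomials in several variables\<close>

text \<open>
  A polynomial over \<open>'k\<close> in variables indexed by \<open>'i\<close> is a finitely supported map from exponent
  vectors to coefficients.  It is evaluated in a \<open>'k\<close>-algebra with structure map \<open>\<iota>\<close>.
\<close>

type_synonym ('i, 'k) mpolynomial = "('i \<Rightarrow>\<^sub>0 nat) \<Rightarrow>\<^sub>0 'k"

definition mp_eval ::
  "('k::zero \<Rightarrow> 'a::comm_ring_1) \<Rightarrow> ('i \<Rightarrow> 'a) \<Rightarrow> ('i, 'k) mpolynomial \<Rightarrow> 'a" where
  "mp_eval \<iota> x F = (\<Sum>m\<in>Poly_Mapping.keys F.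
     \<iota> (Poly_Mapping.lookup F m) * (\<Prod>i\<in>Poly_Mapping.keys m. x i ^ Poly_Mapping.lookup m i))"

definition mp_homogeneous :: "nat \<Rightarrow> ('i, 'k::zero) mpolynomial \<Rightarrow> bool" where
  "mp_homogeneous e F \<longleftrightarrow>
     (\<forall>m\<in>Poly_Mapping.keys F. (\<Sum>i\<in>Poly_Mapping.keys m. Poly_Mapping.lookup m i) = e)"

definition ring_map :: "('a::ring_1 \<Rightarrow> 'b::ring_1) \<Rightarrow> bool" where
  "ring_map \<iota> \<longleftrightarrow> \<iota> 1 = 1 \<and> (\<forall>a b. \<iota> (a + b) = \<iota> a + \<iota> b) \<and> (\<forall>a b. \<iota> (a * b) = \<iota> a * \<iota> b)"

text \<open>
  Algebraic independence over \<open>'k\<close> of the elements of a set \<open>S\<close>: the variables of the polynomials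
  are indexed by the field elements themselves, and the variable with index \<open>s\<close> is sent to \<open>s\<close>.
\<close>

definition algebraically_independent :: "('k::zero \<Rightarrow> 'a::comm_ring_1) \<Rightarrow> 'a set \<Rightarrow> bool" where
  "algebraically_independent \<iota> S \<longleftrightarrow>
     (\<forall>F :: ('a, 'k) mpolynomial. (\<forall>m\<in>Poly_Mapping.keys F. Poly_Mapping.keys m \<subseteq> S) \<longrightarrow>
        mp_eval \<iota> (\<lambda>s. s) F = 0 \<longrightarrow> F = 0)"

definition has_transcendence_degree ::
  "('k::zero \<Rightarrow> 'a::comm_ring_1) \<Rightarrow> 'a set \<Rightarrow> nat \<Rightarrow> bool" where
  "has_transcendence_degree \<iota> L r \<longleftrightarrow>
     (\<exists>S\<subseteq>L. finite S \<and> card S = r \<and> algebraically_independent \<iota> S) \<and>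
     (\<forall>S\<subseteq>L. finite S \<longrightarrow> algebraically_independent \<iota> S \<longrightarrow> card S \<le> r)"

section \<open>Projective varieties and their function fields\<close>

text \<open>
  Projective space with homogeneous coordinates indexed by the finite type \<open>'n\<close> (so of dimension
  \<open>CARD('n) - 1\<close>).  A point is the set of all its homogeneous coordinate vectors.
\<close>

type_synonym ('n, 'k) proj_point = "('n \<Rightarrow> 'k) set"

definition proj_space :: "('n::finite, 'k::field) proj_point set" where
  "proj_space = {{(\<lambda>i. c * x i) | c. c \<noteq> 0} | x. \<exists>i. x i \<noteq> 0}"

definition vanishes_at :: "('n, 'k::field) mpolynomial \<Rightarrow> ('n, 'k) proj_point \<Rightarrow> bool" where
  "vanishes_at F Q \<longleftrightarrow> (\<forall>x\<in>Q. mp_eval (\<lambda>c. c) x F = 0)"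

definition proj_closed :: "('n::finite, 'k::field) proj_point set \<Rightarrow> bool" where
  "proj_closed Z \<longleftrightarrow> (\<exists>T. (\<forall>F\<in>T. \<exists>e. mp_homogeneous e F) \<and>
     Z = {Q \<in> proj_space. \<forall>F\<in>T. vanishes_at F Q})"

definition projective_variety :: "('n::finite, 'k::field) proj_point set \<Rightarrow> bool" where
  "projective_variety X \<longleftrightarrow> proj_closed X \<and> X \<noteq> {} \<and>
     (\<forall>Y Z. proj_closed Y \<longrightarrow> proj_closed Z \<longrightarrow> X = Y \<union> Z \<longrightarrow> X = Y \<or> X = Z)"

text \<open>
  The function field \<open>k(X)\<close> is the field of quotients \<open>F / G\<close> of forms of equal degree, taken modulo
  the forms vanishing on \<open>X\<close>.  To have it inside a type of class \<open>field\<close>, we realise it in an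
  extension \<open>\<iota> : k \<rightarrow> 'K\<close> through a generic point \<open>\<xi>\<close> of \<open>X\<close>, that is, a vector over \<open>'K\<close> at which
  exactly those forms vanish that vanish on \<open>X\<close>; the class of \<open>F / G\<close> becomes \<open>F(\<xi>) / G(\<xi>)\<close>.
  Every projective variety has a generic point over a suitable extension, e.g. the residues of the
  coordinates in the fraction field of its homogeneous coordinate ring, and all choices give
  canonically isomorphic function fields.  The field \<open>'K\<close> itself may be larger than \<open>k(X)\<close>.
\<close>

definition generic_point ::
  "('k::field \<Rightarrow> 'K::field) \<Rightarrow> ('n \<Rightarrow> 'K) \<Rightarrow> ('n, 'k) proj_point set \<Rightarrow> bool" where
  "generic_point \<iota> \<xi> X \<longleftrightarrow> (\<forall>e F. mp_homogeneous e F \<longrightarrow>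
     (mp_eval \<iota> \<xi> F = 0 \<longleftrightarrow> (\<forall>Q\<in>X. vanishes_at F Q)))"

definition function_field :: "('k::field \<Rightarrow> 'K::field) \<Rightarrow> ('n \<Rightarrow> 'K) \<Rightarrow> 'K set" where
  "function_field \<iota> \<xi> = {mp_eval \<iota> \<xi> F / mp_eval \<iota> \<xi> G | F G.
     mp_eval \<iota> \<xi> G \<noteq> 0 \<and> (\<exists>e. mp_homogeneous e F \<and> mp_homogeneous e G)}"

definition local_ring ::
  "('k::field \<Rightarrow> 'K::field) \<Rightarrow> ('n \<Rightarrow> 'K) \<Rightarrow> ('n, 'k) proj_point \<Rightarrow> 'K set" where
  "local_ring \<iota> \<xi> Q = {mp_eval \<iota> \<xi> F / mp_eval \<iota> \<xi> G | F G.
     \<not> vanishes_at G Q \<and> (\<exists>e. mp_homogeneous e F \<and> mp_homogeneous e G)}"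

definition maximal_ideal_at ::
  "('k::field \<Rightarrow> 'K::field) \<Rightarrow> ('n \<Rightarrow> 'K) \<Rightarrow> ('n, 'k) proj_point \<Rightarrow> 'K set" where
  "maximal_ideal_at \<iota> \<xi> Q = {mp_eval \<iota> \<xi> F / mp_eval \<iota> \<xi> G | F G.
     vanishes_at F Q \<and> \<not> vanishes_at G Q \<and> (\<exists>e. mp_homogeneous e F \<and> mp_homogeneous e G)}"

section \<open>Smooth projective curves\<close>

text \<open>
  The dimension of a variety is the transcendence degree of its function field.  Over an
  algebraically closed field, smoothness at \<open>Q\<close> means that the local ring \<open>O\<^sub>Q\<close> is regular, i.e.
  that \<open>m\<^sub>Q / m\<^sub>Q\<^sup>2\<close> has the dimension of the variety.
\<close>

definition smooth_projective_curve ::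
  "('k::alg_closed_field \<Rightarrow> 'K::field) \<Rightarrow> ('n::finite \<Rightarrow> 'K) \<Rightarrow> ('n, 'k) proj_point set \<Rightarrow> bool" where
  "smooth_projective_curve \<iota> \<xi> C \<longleftrightarrow>
     projective_variety C \<and> ring_map \<iota> \<and> generic_point \<iota> \<xi> C \<and>
     has_transcendence_degree \<iota> (function_field \<iota> \<xi>) 1 \<and>
     (\<forall>Q\<in>C. has_dim_mod (\<lambda>c x. \<iota> c * x) (maximal_ideal_at \<iota> \<xi> Q)
        (product_span (maximal_ideal_at \<iota> \<xi> Q) (maximal_ideal_at \<iota> \<xi> Q)) 1)"

text \<open>
  The genus is \<open>dim H\<^sup>1(C, O\<^sub>C)\<close>.  With \<open>K = k(C)\<close>, the flasque resolution
  \<open>0 \<rightarrow> O\<^sub>C \<rightarrow> K \<rightarrow> \<Oplus>\<^sub>Q K / O\<^sub>Q \<rightarrow> 0\<close> gives \<open>H\<^sup>1(C, O\<^sub>C) = A / (A(0) + K)\<close>, where \<open>A\<close> consists of the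
  families \<open>(a\<^sub>Q)\<close> of elements of \<open>K\<close> with \<open>a\<^sub>Q \<in> O\<^sub>Q\<close> for almost all \<open>Q\<close>, and \<open>A(0)\<close> of those with
  \<open>a\<^sub>Q \<in> O\<^sub>Q\<close> for all \<open>Q\<close>.  Families are functions on all sets of vectors, with value \<open>0\<close> off \<open>C\<close>.
\<close>

definition adeles ::
  "('k::field \<Rightarrow> 'K::field) \<Rightarrow> ('n \<Rightarrow> 'K) \<Rightarrow> ('n, 'k) proj_point set \<Rightarrow> (('n, 'k) proj_point \<Rightarrow> 'K) set" where
  "adeles \<iota> \<xi> C = {a. (\<forall>Q\<in>C. a Q \<in> function_field \<iota> \<xi>) \<and> (\<forall>Q. Q \<notin> C \<longrightarrow> a Q = 0) \<and>
     finite {Q \<in> C. a Q \<notin> local_ring \<iota> \<xi> Q}}"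

definition integral_adeles ::
  "('k::field \<Rightarrow> 'K::field) \<Rightarrow> ('n \<Rightarrow> 'K) \<Rightarrow> ('n, 'k) proj_point set \<Rightarrow> (('n, 'k) proj_point \<Rightarrow> 'K) set" where
  "integral_adeles \<iota> \<xi> C = {a \<in> adeles \<iota> \<xi> C. \<forall>Q\<in>C. a Q \<in> local_ring \<iota> \<xi> Q}"

definition principal_adeles ::
  "('k::field \<Rightarrow> 'K::field) \<Rightarrow> ('n \<Rightarrow> 'K) \<Rightarrow> ('n, 'k) proj_point set \<Rightarrow> (('n, 'k) proj_point \<Rightarrow> 'K) set" where
  "principal_adeles \<iota> \<xi> C = {(\<lambda>Q. if Q \<in> C then f else 0) | f. f \<in> function_field \<iota> \<xi>}"

definition has_genus ::
  "('k::field \<Rightarrow> 'K::field) \<Rightarrow> ('n \<Rightarrow> 'K) \<Rightarrow> ('n, 'k) proj_point set \<Rightarrow> nat \<Rightarrow> bool" where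
  "has_genus \<iota> \<xi> C g \<longleftrightarrow> has_dim_mod (\<lambda>c a Q. \<iota> c * a Q) (adeles \<iota> \<xi> C)
     {a + p | a p. a \<in> integral_adeles \<iota> \<xi> C \<and> p \<in> principal_adeles \<iota> \<xi> C} g"

text \<open>
  The valuation at a smooth point: \<open>f = u t\<^sup>e\<close> with \<open>t\<close> a generator of \<open>m\<^sub>Q\<close> and \<open>u\<close> a unit of \<open>O\<^sub>Q\<close>.
  It is only meaningful for \<open>f \<noteq> 0\<close> in the function field.
\<close>

definition ord_at ::
  "('k::field \<Rightarrow> 'K::field) \<Rightarrow> ('n \<Rightarrow> 'K) \<Rightarrow> ('n, 'k) proj_point \<Rightarrow> 'K \<Rightarrow> int" where
  "ord_at \<iota> \<xi> Q f = (THE e. \<exists>t u. maximal_ideal_at \<iota> \<xi> Q = {t * x | x. x \<in> local_ring \<iota> \<xi> Q} \<and>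
     u \<in> local_ring \<iota> \<xi> Q \<and> inverse u \<in> local_ring \<iota> \<xi> Q \<and> u \<noteq> 0 \<and> f = u * t powi e)"

definition regular_away_from ::
  "('k::field \<Rightarrow> 'K::field) \<Rightarrow> ('n \<Rightarrow> 'K) \<Rightarrow> ('n, 'k) proj_point set \<Rightarrow> ('n, 'k) proj_point \<Rightarrow> 'K set" where
  "regular_away_from \<iota> \<xi> C P =
     {f \<in> function_field \<iota> \<xi>. \<forall>Q\<in>C - {P}. f \<in> local_ring \<iota> \<xi> Q}"

section \<open>Weierstrass semigroup, section ring and minimal weighted embedding\<close>

definition weierstrass_semigroup ::
  "('k::field \<Rightarrow> 'K::field) \<Rightarrow> ('n \<Rightarrow> 'K) \<Rightarrow> ('n, 'k) proj_point set \<Rightarrow> ('n, 'k) proj_point \<Rightarrow> nat set" where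
  "weierstrass_semigroup \<iota> \<xi> C P =
     {h. \<exists>f\<in>regular_away_from \<iota> \<xi> C P. f \<noteq> 0 \<and> int h = - ord_at \<iota> \<xi> P f}"

definition frobenius_number ::
  "('k::field \<Rightarrow> 'K::field) \<Rightarrow> ('n \<Rightarrow> 'K) \<Rightarrow> ('n, 'k) proj_point set \<Rightarrow> ('n, 'k) proj_point \<Rightarrow> nat" where
  "frobenius_number \<iota> \<xi> C P = Max (- weierstrass_semigroup \<iota> \<xi> C P)"

definition q_number ::
  "('k::field \<Rightarrow> 'K::field) \<Rightarrow> ('n \<Rightarrow> 'K) \<Rightarrow> ('n, 'k) proj_point set \<Rightarrow> ('n, 'k) proj_point \<Rightarrow> nat \<Rightarrow> nat" where
  "q_number \<iota> \<xi> C P d = (LEAST q. 1 \<le> q \<and> q * d \<in> weierstrass_semigroup \<iota> \<xi> C P)"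

text \<open>The space \<open>H\<^sup>0(C, O\<^sub>C(eP))\<close>.\<close>

definition global_sections ::
  "('k::field \<Rightarrow> 'K::field) \<Rightarrow> ('n \<Rightarrow> 'K) \<Rightarrow> ('n, 'k) proj_point set \<Rightarrow> ('n, 'k) proj_point \<Rightarrow> nat \<Rightarrow> 'K set" where
  "global_sections \<iota> \<xi> C P e =
     {f \<in> regular_away_from \<iota> \<xi> C P. f = 0 \<or> - int e \<le> ord_at \<iota> \<xi> P f}"

text \<open>
  The section ring \<open>R\<^sub>d\<close>, as a graded subring of the polynomial ring \<open>'K[T]\<close>: the homogeneous
  elements of degree \<open>m\<close> are the \<open>f T\<^sup>m\<close> with \<open>f\<close> in \<open>H\<^sup>0(C, O\<^sub>C(mdP))\<close>.
\<close>

definition section_ring ::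
  "('k::field \<Rightarrow> 'K::field) \<Rightarrow> ('n \<Rightarrow> 'K) \<Rightarrow> ('n, 'k) proj_point set \<Rightarrow> ('n, 'k) proj_point \<Rightarrow> nat \<Rightarrow> 'K poly set" where
  "section_ring \<iota> \<xi> C P d = {p. \<forall>m. coeff p m \<in> global_sections \<iota> \<xi> C P (m * d)}"

definition irrelevant_ideal ::
  "('k::field \<Rightarrow> 'K::field) \<Rightarrow> ('n \<Rightarrow> 'K) \<Rightarrow> ('n, 'k) proj_point set \<Rightarrow> ('n, 'k) proj_point \<Rightarrow> nat \<Rightarrow> 'K poly set" where
  "irrelevant_ideal \<iota> \<xi> C P d = {p \<in> section_ring \<iota> \<xi> C P d. coeff p 0 = 0}"

text \<open>
  The data of the minimal weighted embedding \<open>C \<hookrightarrow> \<bbbP>(w\<^sub>0,\<dots>,w\<^sub>n)\<close> induced by \<open>O\<^sub>C(dP)\<close>: sections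
  \<open>f\<^sub>i \<in> H\<^sup>0(C, O\<^sub>C(w\<^sub>i d P))\<close>, \<open>0 \<le> i \<le> n\<close>, of degrees \<open>w\<^sub>i \<ge> 1\<close>, whose classes form a \<open>k\<close>-basis of
  \<open>R\<^sub>+ / R\<^sub>+\<^sup>2\<close> for \<open>R = R\<^sub>d\<close>.  The embedding is \<open>Proj\<close> of \<open>k[x\<^sub>0,\<dots>,x\<^sub>n] \<rightarrow> R\<^sub>d\<close>, \<open>x\<^sub>i \<mapsto> f\<^sub>i T\<^bsup>w\<^sub>i\<^esup>\<close>, with
  \<open>deg x\<^sub>i = w\<^sub>i\<close>.
\<close>

definition minimal_weighted_embedding ::
  "('k::field \<Rightarrow> 'K::field) \<Rightarrow> ('n \<Rightarrow> 'K) \<Rightarrow> ('n, 'k) proj_point set \<Rightarrow> ('n, 'k) proj_point \<Rightarrow> nat \<Rightarrow>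
   nat \<Rightarrow> (nat \<Rightarrow> 'K) \<Rightarrow> (nat \<Rightarrow> nat) \<Rightarrow> bool" where
  "minimal_weighted_embedding \<iota> \<xi> C P d n f w \<longleftrightarrow>
     (\<forall>i\<le>n. 1 \<le> w i \<and> f i \<in> global_sections \<iota> \<xi> C P (w i * d)) \<and>
     basis_mod (\<lambda>c p. smult (\<iota> c) p) (irrelevant_ideal \<iota> \<xi> C P d)
       (product_span (irrelevant_ideal \<iota> \<xi> C P d) (irrelevant_ideal \<iota> \<xi> C P d))
       {..n} (\<lambda>i. monom (f i) (w i))"

end

theory Submission
  imports Defs
begin

text \<open>
  Smoothness at \<open>P\<close> makes the local ring there a discrete valuation ring with residue field \<open>k\<close>, and
  projectivity makes everywhere regular functions constant, so \<open>H\<^sup>0(eP)\<close> has a basis \<open>\<phi>\<^sub>h\<close> of functions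
  with pole order \<open>h\<close> at \<open>P\<close>, one for each \<open>h \<le> e\<close> in the Weierstrass semigroup \<open>H\<close>. The principal
  parts at \<open>P\<close> of pole orders outside \<open>H\<close> form a basis of the adelic \<open>H\<^sup>1(O)\<close>, so there are exactly \<open>g\<close>
  gaps; in particular \<open>H\<close> is cofinite.

  Comparing leading terms, \<open>R\<^sub>+\<close> modulo \<open>R\<^sub>+\<^sup>2\<close> is spanned by the \<open>\<phi>\<^sub>h\<close> in degree \<open>\<lceil>h / d\<rceil>\<close> (degree \<open>1\<close> for
  \<open>h = 0\<close>) with \<open>h \<le> q d\<close> or \<open>h - q d \<notin> H\<close>: in all other cases multiplication by \<open>1\<close> in degree \<open>1\<close> or by
  \<open>\<phi>\<^bsub>q d\<^esub>\<close> in degree \<open>q\<close> decomposes the leading term. Each residue class modulo \<open>q d\<close> contributes one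
  such \<open>h\<close>, except that \<open>0\<close> and \<open>q d\<close> both occur, and \<open>h \<le> q d + F\<close>.
\<close>

section \<open>Linear algebra modulo a subspace\<close>

text \<open>Transcendence degree one enters as the statement that two distinct functions satisfy a
  polynomial relation over k. Keeping the terms of lowest order in such a relation gives Krull's
  theorem at P, and shows that the valuation rings used for the constancy of regular functions have
  residue field k. The hard half of the gap count is that principal parts at P span the adelic
  quotient: an arbitrary adele has to be matched by a function at all points other than P. The easy
  half, independence, prepares it: it bounds the number of gaps by g, so H contains some h > 0, and
  the powers of a function with pole order h yield the linear relations from which strong
  approximation is drawn. In degree 1 the square of the irrelevant ideal vanishes, so the generators
  of weight 1 form a basis of H^0(dP), whose dimension is the number of elements of H up to d. For d
  > F all g gaps lie below d, which makes this d + 1 - g; moreover d is not a gap, so q = 1, and F /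
  d < 1 bounds the weights by 2.\<close>

lemma homogeneous_system_nontrivial:
  fixes a :: "'i \<Rightarrow> 'j \<Rightarrow> 'k::field"
  assumes "finite J" "finite I" "card J < card I"
  shows "\<exists>x. (\<exists>i\<in>I. x i \<noteq> 0) \<and> (\<forall>j\<in>J. (\<Sum>i\<in>I. x i * a i j) = 0)"
  using assms
proof (induction J arbitrary: I a rule: finite_induct)
  case empty
  then have "I \<noteq> {}" by auto
  then show ?case by (intro exI[of _ "\<lambda>_. 1"]) auto
next
  case (insert j0 J)
  show ?case
  proof (cases "\<forall>i\<in>I. a i j0 = 0")
    case True
    have "card J < card I" using insert.prems insert.hyps by simp
    from insert.IH[OF insert.prems(1) this, of a] obtain x where
      "\<exists>i\<in>I. x i \<noteq> 0" "\<forall>j\<in>J. (\<Sum>i\<in>I. x i * a i j) = 0" by blast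
    with True show ?thesis by (intro exI[of _ x]) auto
  next
    case False
    then obtain i0 where i0: "i0 \<in> I" "a i0 j0 \<noteq> 0" by auto
    define I' where "I' = I - {i0}"
    \<comment> \<open>One step of Gaussian elimination: the pivot \<open>a i0 j0\<close> clears the
      equation \<open>j0\<close>. Afterwards \<open>y i0\<close> is chosen so that \<open>j0\<close>
      holds for the lifted solution.\<close>
    define a' where "a' i j = a i j - a i j0 / a i0 j0 * a i0 j" for i j
    have fin: "finite I'" and I: "I = insert i0 I'" "i0 \<notin> I'"
      using insert.prems i0 by (auto simp: I'_def)
    have "card J < card I'"
      using insert.prems insert.hyps i0 by (simp add: I'_def)
    from insert.IH[OF fin this, of a'] obtain x where
      x: "\<exists>i\<in>I'. x i \<noteq> 0" "\<And>j. j \<in> J \<Longrightarrow> (\<Sum>i\<in>I'. x i * a' i j) = 0" by blast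
    define y where "y i = (if i = i0 then - (\<Sum>i\<in>I'. x i * (a i j0 / a i0 j0)) else x i)" for i
    have yx: "(\<Sum>i\<in>I'. y i * a i j) = (\<Sum>i\<in>I'. x i * a i j)" for j
      by (rule sum.cong) (use I in \<open>auto simp: y_def\<close>)
    have eq: "(\<Sum>i\<in>I. y i * a i j) = (\<Sum>i\<in>I'. x i * a' i j)" for j
    proof -
      have "(\<Sum>i\<in>I. y i * a i j) = y i0 * a i0 j + (\<Sum>i\<in>I'. x i * a i j)"
        using I fin by (simp add: yx)
      also have "y i0 * a i0 j = - (\<Sum>i\<in>I'. x i * (a i j0 / a i0 j0 * a i0 j))"
        by (simp add: y_def sum_distrib_right sum_distrib_left mult.assoc)
      finally show ?thesis
        by (simp add: a'_def algebra_simps sum_subtractf)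
    qed
    have "a' i j0 = 0" for i using i0 by (simp add: a'_def)
    then have "(\<Sum>i\<in>I. y i * a i j) = 0" if "j \<in> insert j0 J" for j
      using that x(2) by (auto simp: eq)
    moreover have "\<exists>i\<in>I. y i \<noteq> 0"
      using x(1) I by (auto simp: y_def)
    ultimately show ?thesis by blast
  qed
qed

locale subspace_quotient = vector_space scale
  for scale :: "'k::field \<Rightarrow> 'b::ab_group_add \<Rightarrow> 'b" +
  fixes W :: "'b set"
  assumes subspace_W: "subspace W"
begin

text \<open>Coefficients of the \<open>b i\<close> with respect to the \<open>e j\<close> turn the
  claim into a homogeneous system with one unknown for each \<open>i\<close> and one equation for
  each \<open>j\<close>.\<close>

lemma dependent_mod_if_card_less:
  assumes fin: "finite I" "finite J" and less: "card J < card I"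
    and span: "\<And>i. i \<in> I \<Longrightarrow> \<exists>c. b i - (\<Sum>j\<in>J. scale (c j) (e j)) \<in> W"
  shows "\<exists>x. (\<exists>i\<in>I. x i \<noteq> 0) \<and> (\<Sum>i\<in>I. scale (x i) (b i)) \<in> W"
proof -
  from span obtain a where a: "\<And>i. i \<in> I \<Longrightarrow> b i - (\<Sum>j\<in>J. scale (a i j) (e j)) \<in> W"
    by metis
  from homogeneous_system_nontrivial[OF fin(2,1) less, of a] obtain x where
    x: "\<exists>i\<in>I. x i \<noteq> 0" "\<And>j. j \<in> J \<Longrightarrow> (\<Sum>i\<in>I. x i * a i j) = 0" by blast
  have "(\<Sum>i\<in>I. scale (x i) (b i - (\<Sum>j\<in>J. scale (a i j) (e j)))) \<in> W"
    by (intro subspace_sum subspace_scale subspace_W a)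
  moreover have "(\<Sum>i\<in>I. scale (x i) (\<Sum>j\<in>J. scale (a i j) (e j))) = 0"
  proof -
    have "(\<Sum>i\<in>I. scale (x i) (\<Sum>j\<in>J. scale (a i j) (e j)))
        = (\<Sum>j\<in>J. \<Sum>i\<in>I. scale (x i * a i j) (e j))"
      by (simp add: scale_sum_right sum.swap[of _ J I])
    also have "\<dots> = 0"
      using x(2) by (simp flip: scale_sum_left)
    finally show ?thesis .
  qed
  ultimately have "(\<Sum>i\<in>I. scale (x i) (b i)) \<in> W"
    by (simp add: scale_right_diff_distrib sum_subtractf)
  with x(1) show ?thesis by blast
qed

lemma card_le_if_independent_mod:
  assumes "finite I" "finite J"
    and "\<And>i. i \<in> I \<Longrightarrow> \<exists>c. b i - (\<Sum>j\<in>J. scale (c j) (e j)) \<in> W"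
    and "\<And>c. (\<Sum>i\<in>I. scale (c i) (b i)) \<in> W \<Longrightarrow> \<forall>i\<in>I. c i = 0"
  shows "card I \<le> card J"
proof (rule ccontr)
  assume "\<not> card I \<le> card J"
  then have "card J < card I" by simp
  from dependent_mod_if_card_less[of I J b e, OF assms(1,2) this assms(3)] assms(4)
  show False by blast
qed

text \<open>The preimage of the span of the classes of the \<open>e j\<close> in the quotient by
  \<open>W\<close>. Explicit coefficients are used to match \<open>basis_mod\<close>.\<close>

definition span_mod :: "'i set \<Rightarrow> ('i \<Rightarrow> 'b) \<Rightarrow> 'b set" where
  "span_mod J e = {v. \<exists>c. v - (\<Sum>j\<in>J. scale (c j) (e j)) \<in> W}"

lemma subspace_span_mod:  "subspace (span_mod J e)"
proof (rule subspaceI)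
  show "0 \<in> span_mod J e"
    unfolding span_mod_def using subspace_W by (auto intro!: exI[of _ "\<lambda>_. 0"] simp: subspace_0)
next
  fix x y assume "x \<in> span_mod J e" "y \<in> span_mod J e"
  then obtain c c' where "x - (\<Sum>j\<in>J. scale (c j) (e j)) \<in> W" "y - (\<Sum>j\<in>J. scale (c' j) (e j)) \<in> W"
    unfolding span_mod_def by auto
  from subspace_add[OF subspace_W this] show "x + y \<in> span_mod J e"
    unfolding span_mod_def
    by (auto intro!: exI[of _ "\<lambda>j. c j + c' j"] simp: scale_left_distrib sum.distrib algebra_simps)
next
  fix r x assume "x \<in> span_mod J e"
  then obtain c where "x - (\<Sum>j\<in>J. scale (c j) (e j)) \<in> W"
    unfolding span_mod_def by auto
  from subspace_scale[OF subspace_W this, of r] show "scale r x \<in> span_mod J e"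
    unfolding span_mod_def
    by (auto intro!: exI[of _ "\<lambda>j. r * c j"] simp: scale_right_diff_distrib scale_sum_right)
qed

lemma span_mod_superset:
  assumes "v \<in> W"
  shows "v \<in> span_mod J e"
  unfolding span_mod_def using assms by (auto intro!: exI[of _ "\<lambda>_. 0"])

lemma span_mod_base:
  assumes "finite J" "j \<in> J"
  shows "e j \<in> span_mod J e"
proof -
  have "(\<Sum>i\<in>J. scale (if i = j then 1 else 0) (e i)) = (\<Sum>i\<in>J. if i = j then e i else 0)"
    by (rule sum.cong) auto
  also have "\<dots> = e j" using assms by simp
  finally show ?thesis
    unfolding span_mod_def using subspace_W
    by (auto intro!: exI[of _ "\<lambda>i. if i = j then 1 else 0"] simp: subspace_0)
qed

lemma span_mod_mono:
  assumes "finite J" "I \<subseteq> J"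
  shows "span_mod I e \<subseteq> span_mod J e"
proof
  fix v assume "v \<in> span_mod I e"
  then obtain c where c: "v - (\<Sum>j\<in>I. scale (c j) (e j)) \<in> W"
    unfolding span_mod_def by auto
  have "(\<Sum>j\<in>J. scale (if j \<in> I then c j else 0) (e j)) = (\<Sum>j\<in>J. if j \<in> I then scale (c j) (e j) else 0)"
    by (rule sum.cong) auto
  also have "\<dots> = (\<Sum>j\<in>I. scale (c j) (e j))"
    using assms by (simp add: sum.If_cases Int_absorb1)
  finally show "v \<in> span_mod J e"
    unfolding span_mod_def using c by (auto intro!: exI[of _ "\<lambda>j. if j \<in> I then c j else 0"])
qed

end

section \<open>Evaluation of polynomials\<close>

locale field_embedding =
  fixes \<iota> :: "'k::field \<Rightarrow> 'a::field"
  assumes ring_map: "ring_map \<iota>"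
begin

lemma hom_one [simp]: "\<iota> 1 = 1"
  and hom_add: "\<iota> (a + b) = \<iota> a + \<iota> b"
  and hom_mult: "\<iota> (a * b) = \<iota> a * \<iota> b"
  using ring_map by (auto simp: ring_map_def)

lemma hom_zero [simp]: "\<iota> 0 = 0"
  by (metis hom_add add.right_neutral add_left_cancel)

lemma hom_uminus: "\<iota> (- a) = - \<iota> a"
  using hom_add[of a "- a"] by (simp add: eq_neg_iff_add_eq_0 add.commute)

lemma hom_diff: "\<iota> (a - b) = \<iota> a - \<iota> b"
  using hom_add[of a "- b"] by (simp add: hom_uminus)

lemma hom_eq_0_iff: "\<iota> a = 0 \<longleftrightarrow> a = 0"
proof
  assume "\<iota> a = 0"
  then have "a \<noteq> 0 \<Longrightarrow> \<iota> (a * inverse a) = 0" unfolding hom_mult by simp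
  then show "a = 0" by auto
qed simp

lemma hom_inverse: "\<iota> (inverse a) = inverse (\<iota> a)"
proof (cases "a = 0")
  case False
  then have "\<iota> a * \<iota> (inverse a) = 1" by (simp flip: hom_mult)
  then show ?thesis by (metis inverse_unique)
qed simp

lemma hom_sum: "\<iota> (\<Sum>i\<in>A. h i) = (\<Sum>i\<in>A. \<iota> (h i))"
  by (induction A rule: infinite_finite_induct) (auto simp: hom_add)

lemma vector_space_mult: "vector_space (\<lambda>c x. \<iota> c * x)"
  by unfold_locales (auto simp: algebra_simps hom_add hom_mult)

lemma vector_space_smult: "vector_space (\<lambda>c p. smult (\<iota> c) p)"
  by unfold_locales (auto simp: algebra_simps hom_add hom_mult smult_add_left smult_add_right)

lemma vector_space_fun_mult: "vector_space (\<lambda>c a (Q::'p). \<iota> c * a Q)"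
  by unfold_locales (auto simp: algebra_simps hom_add hom_mult fun_eq_iff)

definition monomial_value :: "('i \<Rightarrow> 'a) \<Rightarrow> ('i \<Rightarrow>\<^sub>0 nat) \<Rightarrow> 'a" where
  "monomial_value x m = (\<Prod>i\<in>Poly_Mapping.keys m. x i ^ Poly_Mapping.lookup m i)"

lemma monomial_value_superset:
  assumes "finite S" "Poly_Mapping.keys m \<subseteq> S"
  shows "monomial_value x m = (\<Prod>i\<in>S. x i ^ Poly_Mapping.lookup m i)"
  unfolding monomial_value_def
  by (rule prod.mono_neutral_left) (use assms in \<open>auto simp: in_keys_iff\<close>)

lemma monomial_value_zero [simp]: "monomial_value x 0 = 1"
  by (simp add: monomial_value_def)

lemma monomial_value_add: "monomial_value x (m + n) = monomial_value x m * monomial_value x n"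
proof -
  define S where "S = Poly_Mapping.keys m \<union> Poly_Mapping.keys n"
  have S: "finite S" "Poly_Mapping.keys m \<subseteq> S" "Poly_Mapping.keys n \<subseteq> S" "Poly_Mapping.keys (m + n) \<subseteq> S"
    using keys_add[of m n] by (auto simp: S_def)
  show ?thesis
    using S by (simp add: monomial_value_superset[of S] lookup_add power_add prod.distrib)
qed

lemma mp_eval_superset:
  assumes "finite S" "Poly_Mapping.keys F \<subseteq> S"
  shows "mp_eval \<iota> x F = (\<Sum>m\<in>S. \<iota> (Poly_Mapping.lookup F m) * monomial_value x m)"
  unfolding mp_eval_def monomial_value_def[symmetric]
  by (rule sum.mono_neutral_left) (use assms in \<open>auto simp: in_keys_iff\<close>)

lemma mp_eval_add: "mp_eval \<iota> x (F + G) = mp_eval \<iota> x F + mp_eval \<iota> x G"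
proof -
  define S where "S = Poly_Mapping.keys F \<union> Poly_Mapping.keys G"
  have S: "finite S" "Poly_Mapping.keys F \<subseteq> S" "Poly_Mapping.keys G \<subseteq> S" "Poly_Mapping.keys (F + G) \<subseteq> S"
    using keys_add[of F G] by (auto simp: S_def)
  show ?thesis
    using S by (simp add: mp_eval_superset[of S] lookup_add hom_add algebra_simps sum.distrib)
qed

lemma mp_eval_zero [simp]: "mp_eval \<iota> x 0 = 0"
  by (simp add: mp_eval_def)

lemma mp_eval_single: "mp_eval \<iota> x (Poly_Mapping.single m c) = \<iota> c * monomial_value x m"
  by (subst mp_eval_superset[of "{m}"]) auto

end

lemma poly_mapping_sum_singles:
  fixes F :: "'b \<Rightarrow>\<^sub>0 'c::comm_monoid_add"
  shows "F = (\<Sum>m\<in>Poly_Mapping.keys F. Poly_Mapping.single m (Poly_Mapping.lookup F m))"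
proof (rule poly_mapping_eqI)
  fix k
  have "Poly_Mapping.lookup (Poly_Mapping.single m (Poly_Mapping.lookup F m)) k
      = (if m = k then Poly_Mapping.lookup F m else 0)" for m
    by (simp add: lookup_single when_def)
  then show "Poly_Mapping.lookup F k
      = Poly_Mapping.lookup (\<Sum>m\<in>Poly_Mapping.keys F. Poly_Mapping.single m (Poly_Mapping.lookup F m)) k"
    by (simp add: lookup_sum in_keys_iff)
qed

lemma poly_mapping_induct_singles [case_names single add]:
  fixes F :: "'b \<Rightarrow>\<^sub>0 'c::comm_monoid_add"
  assumes single: "\<And>m c. R (Poly_Mapping.single m c)"
    and add: "\<And>F G. R F \<Longrightarrow> R G \<Longrightarrow> R (F + G)"
  shows "R F"
proof -
  have "R (\<Sum>m\<in>S. Poly_Mapping.single m (Poly_Mapping.lookup F m))" if "finite S" for S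
    using that
  proof (induction S rule: finite_induct)
    case empty
    then show ?case using single[of _ 0] by simp
  qed (auto intro: single add)
  then show ?thesis
    using poly_mapping_sum_singles[of F] by (metis finite_keys)
qed

context field_embedding
begin

lemma mp_eval_mult: "mp_eval \<iota> x (F * G) = mp_eval \<iota> x F * mp_eval \<iota> x G"
proof (induction F rule: poly_mapping_induct_singles)
  case (single m c)
  show ?case
  proof (induction G rule: poly_mapping_induct_singles)
    case (single n b)
    show ?case by (simp add: mult_single mp_eval_single monomial_value_add hom_mult)
  qed (simp add: mp_eval_add ring_distribs)
qed (simp add: mp_eval_add ring_distribs)

end

definition mon_degree :: "('i \<Rightarrow>\<^sub>0 nat) \<Rightarrow> nat" where
  "mon_degree m = (\<Sum>i\<in>Poly_Mapping.keys m. Poly_Mapping.lookup m i)"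

lemma mon_degree_add: "mon_degree (m + n) = mon_degree m + mon_degree n"
  unfolding mon_degree_def using setsum_keys_plus_distrib[of "\<lambda>_ x. x" m n] by simp

lemma mp_homogeneous_alt: "mp_homogeneous e F \<longleftrightarrow> (\<forall>m\<in>Poly_Mapping.keys F. mon_degree m = e)"
  by (simp add: mp_homogeneous_def mon_degree_def)

lemma mp_homogeneous_add:
  assumes "mp_homogeneous e F" "mp_homogeneous e G"
  shows "mp_homogeneous e (F + G)"
  using assms keys_add[of F G] unfolding mp_homogeneous_alt by blast

lemma mp_homogeneous_mult:
  fixes F G :: "('i, 'k::semiring_0) mpolynomial"
  assumes "mp_homogeneous e F" "mp_homogeneous e' G"
  shows "mp_homogeneous (e + e') (F * G)"
  using assms keys_mult[of F G] unfolding mp_homogeneous_alt by (fastforce simp: mon_degree_add)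

definition mp_const :: "'k::zero \<Rightarrow> ('i, 'k) mpolynomial" where
  "mp_const c = Poly_Mapping.single 0 c"

definition mp_var :: "'i \<Rightarrow> ('i, 'k::zero_neq_one) mpolynomial" where
  "mp_var i = Poly_Mapping.single (Poly_Mapping.single i 1) 1"

lemma mp_homogeneous_const [simp]: "mp_homogeneous 0 (mp_const c)"
  by (simp add: mp_homogeneous_alt mp_const_def mon_degree_def)

lemma mp_homogeneous_var [simp]: "mp_homogeneous (Suc 0) (mp_var i)"
  by (simp add: mp_homogeneous_alt mp_var_def mon_degree_def)

lemma mp_homogeneous_power:
  fixes F :: "('i, 'k::semiring_1) mpolynomial"
  assumes "mp_homogeneous e F"
  shows "mp_homogeneous (n * e) (F ^ n)"
proof (induction n)
  case 0
  then show ?case by (simp add: mp_homogeneous_alt mon_degree_def)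
next
  case (Suc n)
  then show ?case using mp_homogeneous_mult[OF assms Suc] by simp
qed

context field_embedding
begin

lemma mp_eval_const [simp]: "mp_eval \<iota> x (mp_const c) = \<iota> c"
  by (simp add: mp_const_def mp_eval_single)

lemma mp_eval_var [simp]: "mp_eval \<iota> x (mp_var i) = x i"
  by (simp add: mp_var_def mp_eval_single monomial_value_def)

lemma mp_eval_one [simp]: "mp_eval \<iota> x 1 = 1"
  using mp_eval_single[of x 0 1] by simp

lemma mp_eval_power: "mp_eval \<iota> x (F ^ n) = mp_eval \<iota> x F ^ n"
  by (induction n) (auto simp: mp_eval_mult)

lemma mp_eval_scaled_point:
  assumes "mp_homogeneous e F"
  shows "mp_eval \<iota> (\<lambda>i. r * x i) F = r ^ e * mp_eval \<iota> x F"
proof -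
  have "monomial_value (\<lambda>i. r * x i) m = r ^ mon_degree m * monomial_value x m" for m
    by (simp add: monomial_value_def mon_degree_def power_mult_distrib prod.distrib power_sum)
  then show ?thesis
    using assms
    by (simp add: mp_eval_def monomial_value_def[symmetric] mp_homogeneous_alt sum_distrib_left mult_ac)
qed

end

text \<open>Evaluation at a point with coordinates in k is the case of the identity embedding, so
  the rules for the generic point carry over to closed points.\<close>

lemma field_embedding_id: "field_embedding (\<lambda>c. c)"
  by unfold_locales (simp add: ring_map_def)

lemmas mp_eval_id_add = field_embedding.mp_eval_add[OF field_embedding_id]
  and mp_eval_id_mult = field_embedding.mp_eval_mult[OF field_embedding_id]
  and mp_eval_id_scaled_point = field_embedding.mp_eval_scaled_point[OF field_embedding_id]
  and mp_eval_id_const [simp] = field_embedding.mp_eval_const[OF field_embedding_id]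
  and mp_eval_id_var [simp] = field_embedding.mp_eval_var[OF field_embedding_id]

section \<open>Subalgebras and residues\<close>

context field_embedding
begin

definition subalg :: "'a set \<Rightarrow> bool" where
  "subalg A \<longleftrightarrow> range \<iota> \<subseteq> A \<and> (\<forall>x\<in>A. \<forall>y\<in>A. x + y \<in> A) \<and> (\<forall>x\<in>A. \<forall>y\<in>A. x * y \<in> A)"

lemma subalg_const: "subalg A \<Longrightarrow> \<iota> c \<in> A"
  and subalg_add: "subalg A \<Longrightarrow> x \<in> A \<Longrightarrow> y \<in> A \<Longrightarrow> x + y \<in> A"
  and subalg_mult: "subalg A \<Longrightarrow> x \<in> A \<Longrightarrow> y \<in> A \<Longrightarrow> x * y \<in> A"
  unfolding subalg_def by blast+

lemma subalg_zero: "subalg A \<Longrightarrow> 0 \<in> A"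
  and subalg_one: "subalg A \<Longrightarrow> 1 \<in> A"
  by (metis subalg_const hom_zero) (metis subalg_const hom_one)

lemma subalg_uminus: "subalg A \<Longrightarrow> x \<in> A \<Longrightarrow> - x \<in> A"
  by (metis subalg_mult subalg_const hom_uminus hom_one mult_minus1)

lemma subalg_diff: "subalg A \<Longrightarrow> x \<in> A \<Longrightarrow> y \<in> A \<Longrightarrow> x - y \<in> A"
  by (metis subalg_add subalg_uminus uminus_add_conv_diff add.commute)

lemma subalg_sum: "subalg A \<Longrightarrow> (\<And>i. i \<in> I \<Longrightarrow> h i \<in> A) \<Longrightarrow> (\<Sum>i\<in>I. h i) \<in> A"
  by (induction I rule: infinite_finite_induct) (simp_all add: subalg_add subalg_zero)

lemma subalg_prod: "subalg A \<Longrightarrow> (\<And>i. i \<in> I \<Longrightarrow> h i \<in> A) \<Longrightarrow> (\<Prod>i\<in>I. h i) \<in> A"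
  by (induction I rule: infinite_finite_induct) (simp_all add: subalg_mult subalg_one)

lemma subalg_power: "subalg A \<Longrightarrow> x \<in> A \<Longrightarrow> x ^ n \<in> A"
  by (induction n) (simp_all add: subalg_mult subalg_one)

lemma subalg_mp_eval:
  assumes "subalg A" "\<And>i. y i \<in> A"
  shows "mp_eval \<iota> y F \<in> A"
  unfolding mp_eval_def
  by (intro subalg_sum subalg_mult subalg_prod subalg_power subalg_const assms)

definition ideal_of :: "'a set \<Rightarrow> 'a set \<Rightarrow> bool" where
  "ideal_of A M \<longleftrightarrow> M \<subseteq> A \<and> 0 \<in> M \<and> (\<forall>x\<in>M. \<forall>y\<in>M. x + y \<in> M) \<and> (\<forall>a\<in>A. \<forall>x\<in>M. a * x \<in> M)"

lemma ideal_of_zero: "ideal_of A M \<Longrightarrow> 0 \<in> M"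
  and ideal_of_add: "ideal_of A M \<Longrightarrow> x \<in> M \<Longrightarrow> y \<in> M \<Longrightarrow> x + y \<in> M"
  and ideal_of_mult: "ideal_of A M \<Longrightarrow> a \<in> A \<Longrightarrow> x \<in> M \<Longrightarrow> a * x \<in> M"
  unfolding ideal_of_def by blast+

lemma ideal_of_uminus: "subalg A \<Longrightarrow> ideal_of A M \<Longrightarrow> x \<in> M \<Longrightarrow> - x \<in> M"
  using ideal_of_mult[of A M "- 1" x] subalg_uminus[OF _ subalg_one] by auto

lemma ideal_of_diff: "subalg A \<Longrightarrow> ideal_of A M \<Longrightarrow> x \<in> M \<Longrightarrow> y \<in> M \<Longrightarrow> x - y \<in> M"
  using ideal_of_add[of A M x "- y"] ideal_of_uminus[of A M y] by auto

lemma ideal_of_sum: "ideal_of A M \<Longrightarrow> (\<And>i. i \<in> I \<Longrightarrow> h i \<in> M) \<Longrightarrow> (\<Sum>i\<in>I. h i) \<in> M"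
  by (induction I rule: infinite_finite_induct) (simp_all add: ideal_of_add ideal_of_zero)

lemma residue_mult:
  assumes A: "subalg A" and M: "ideal_of A M" and "a \<in> A"
    and "a - \<iota> b \<in> M" "a' - \<iota> b' \<in> M"
  shows "a * a' - \<iota> (b * b') \<in> M"
proof -
  have "a * a' - \<iota> (b * b') = a * (a' - \<iota> b') + \<iota> b' * (a - \<iota> b)"
    by (simp add: algebra_simps hom_mult)
  then show ?thesis
    using assms by (auto intro!: ideal_of_add[OF M] ideal_of_mult[OF M] subalg_const)
qed

lemma residue_power:
  assumes A: "subalg A" and M: "ideal_of A M" and "a \<in> A" "a - \<iota> b \<in> M"
  shows "a ^ n - \<iota> (b ^ n) \<in> M"
  by (induction n) (use assms in \<open>auto intro: residue_mult ideal_of_zero\<close>)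

lemma residue_prod:
  assumes A: "subalg A" and M: "ideal_of A M"
    and "\<And>i. i \<in> I \<Longrightarrow> a i \<in> A" "\<And>i. i \<in> I \<Longrightarrow> a i - \<iota> (b i) \<in> M"
  shows "(\<Prod>i\<in>I. a i) - \<iota> (\<Prod>i\<in>I. b i) \<in> M"
  using assms(3,4)
proof (induction I rule: infinite_finite_induct)
  case (insert i I)
  then show ?case by (auto intro!: residue_mult[OF A M])
qed (use M in \<open>auto intro: ideal_of_zero\<close>)

text \<open>Reduction modulo an ideal commutes with polynomial evaluation. It is applied to the
  ideal generated by the affine coordinates minus their values at a point, and to the maximal ideal
  of a valuation ring, whose residues give a point of C.\<close>

lemma residue_mp_eval:
  assumes A: "subalg A" and M: "ideal_of A M"
    and y: "\<And>i. y i \<in> A" and c: "\<And>i. y i - \<iota> (c i) \<in> M"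
  shows "mp_eval \<iota> y F - \<iota> (mp_eval (\<lambda>c. c) c F) \<in> M"
proof -
  have 1: "(\<Prod>i\<in>Poly_Mapping.keys m. y i ^ Poly_Mapping.lookup m i)
      - \<iota> (\<Prod>i\<in>Poly_Mapping.keys m. c i ^ Poly_Mapping.lookup m i) \<in> M" for m
    by (intro residue_prod[OF A M] residue_power[OF A M] subalg_power[OF A] y c)
  have "mp_eval \<iota> y F - \<iota> (mp_eval (\<lambda>c. c) c F) =
      (\<Sum>m\<in>Poly_Mapping.keys F. \<iota> (Poly_Mapping.lookup F m) *
        ((\<Prod>i\<in>Poly_Mapping.keys m. y i ^ Poly_Mapping.lookup m i)
        - \<iota> (\<Prod>i\<in>Poly_Mapping.keys m. c i ^ Poly_Mapping.lookup m i)))"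
    by (simp add: mp_eval_def hom_sum hom_mult algebra_simps sum_subtractf)
  also have "\<dots> \<in> M"
    by (intro ideal_of_sum[OF M] ideal_of_mult[OF M] subalg_const A 1)
  finally show ?thesis .
qed

end

text \<open>
  The relation splits into linear factors over the algebraically closed field \<open>k\<close>, and one of
  them lies in the prime ideal \<open>M\<close>.
\<close>

lemma (in field_embedding) residue_if_algebraic:
  fixes c :: "nat \<Rightarrow> 'k"
  assumes closed: "\<And>p::'k poly. degree p > 0 \<Longrightarrow> \<exists>z. poly p z = 0"
    and A: "subalg A" and M: "ideal_of A M" and one: "1 \<notin> M"
    and prime: "\<And>x y. x \<in> A \<Longrightarrow> y \<in> A \<Longrightarrow> x * y \<in> M \<Longrightarrow> x \<in> M \<or> y \<in> M"
    and a: "a \<in> A" and c: "j0 \<le> N" "c j0 \<noteq> 0" and rel: "(\<Sum>j\<le>N. \<iota> (c j) * a ^ j) \<in> M"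
  shows "\<exists>r. a - \<iota> r \<in> M"
proof -
  define ev where "ev p = poly (map_poly \<iota> p) a" for p
  have ev_A: "ev p \<in> A" for p
    by (induction p)
      (auto simp: ev_def map_poly_pCons a intro!: subalg_zero subalg_add subalg_mult subalg_const A)
  have ev_smult: "ev (smult b p) = \<iota> b * ev p" for b p
    by (simp add: ev_def map_poly_smult hom_mult)
  have ev_add: "ev (p + q) = ev p + ev q" for p q
  proof (induction p q rule: poly_induct2)
    case (pCons a p b q)
    then show ?case by (simp add: ev_def map_poly_pCons hom_add algebra_simps)
  qed (simp add: ev_def)
  have ev_linear: "ev ([:-r, 1:] * q) = (a - \<iota> r) * ev q" for r q
  proof -
    have "[:-r, 1:] * q = smult (- r) q + pCons 0 q" by simp
    also have "ev \<dots> = \<iota> (- r) * ev q + a * ev q"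
      by (simp only: ev_add ev_smult) (simp add: ev_def map_poly_pCons)
    finally show ?thesis by (simp add: hom_uminus algebra_simps)
  qed
  have main: "p \<noteq> 0 \<Longrightarrow> ev p \<in> M \<Longrightarrow> \<exists>r. a - \<iota> r \<in> M" for p
  proof (induction "degree p" arbitrary: p)
    case 0
    then obtain b where b: "p = [:b:]" by (metis degree_eq_zeroE)
    with 0 have "b \<noteq> 0" by auto
    have "\<iota> (inverse b) * ev p \<in> M"
      using 0 by (intro ideal_of_mult[OF M] subalg_const A) auto
    also have "\<iota> (inverse b) * ev p = 1"
      using \<open>b \<noteq> 0\<close> by (simp add: ev_def b map_poly_pCons hom_inverse hom_eq_0_iff)
    finally show ?case using one by simp
  next
    case (Suc n)
    then obtain r where "poly p r = 0" using closed[of p] by auto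
    then obtain q where q: "p = [:-r, 1:] * q" by (auto simp: poly_eq_0_iff_dvd dvd_def)
    with Suc have "q \<noteq> 0" by auto
    then have "degree p = Suc (degree q)" unfolding q by (subst degree_mult_eq) auto
    with Suc have IH: "ev q \<in> M \<Longrightarrow> \<exists>r. a - \<iota> r \<in> M" using \<open>q \<noteq> 0\<close> by auto
    have "(a - \<iota> r) * ev q \<in> M" using Suc by (simp add: q flip: ev_linear)
    from prime[OF _ ev_A this] show ?case
      using IH a A by (blast intro: subalg_diff subalg_const)
  qed
  define p where "p = (\<Sum>j\<le>N. monom (c j) j)"
  have "coeff p j0 = c j0" using c by (simp add: p_def coeff_sum)
  then have "p \<noteq> 0" using c by auto
  moreover have "ev p = (\<Sum>j\<le>N. \<iota> (c j) * a ^ j)"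
  proof -
    have "ev (\<Sum>j\<in>S. monom (c j) j) = (\<Sum>j\<in>S. \<iota> (c j) * a ^ j)" for S
      by (induction S rule: infinite_finite_induct)
        (simp_all add: ev_add, simp_all add: ev_def map_poly_monom poly_monom)
    then show ?thesis by (simp add: p_def)
  qed
  ultimately show ?thesis using main rel by simp
qed

section \<open>Function field and local rings\<close>

locale projective_curve = field_embedding \<iota> for \<iota> :: "'k::alg_closed_field \<Rightarrow> 'K::field" +
  fixes \<xi> :: "'n::finite \<Rightarrow> 'K" and C :: "('n, 'k) proj_point set"
  assumes variety: "projective_variety C"
    and generic: "generic_point \<iota> \<xi> C"
    and trdeg: "has_transcendence_degree \<iota> (function_field \<iota> \<xi>) 1"
begin

abbreviation "K \<equiv> function_field \<iota> \<xi>"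
abbreviation "Loc \<equiv> local_ring \<iota> \<xi>"
abbreviation "Max_id \<equiv> maximal_ideal_at \<iota> \<xi>"
abbreviation "E \<equiv> mp_eval \<iota> \<xi>"

lemma point_rep:
  assumes "Q \<in> C"
  obtains x i where "x \<in> Q" "x i \<noteq> 0" "Q = {(\<lambda>i. c * x i) | c. c \<noteq> 0}"
proof -
  from assms variety have "Q \<in> proj_space" by (auto simp: projective_variety_def proj_closed_def)
  then obtain x i where x: "x i \<noteq> 0" "Q = {(\<lambda>i. c * x i) | c. c \<noteq> 0}"
    by (auto simp: proj_space_def)
  then have "x \<in> Q" by (auto intro!: exI[of _ 1])
  with that x show ?thesis by blast
qed

lemma vanishes_at_multiples:
  assumes "Q = {(\<lambda>i. c * x i) | c. c \<noteq> 0}" "mp_homogeneous e F"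
  shows "vanishes_at F Q \<longleftrightarrow> mp_eval (\<lambda>c. c) x F = 0"
proof
  assume "vanishes_at F Q"
  moreover have "x \<in> Q" by (auto simp: assms intro!: exI[of _ 1])
  ultimately show "mp_eval (\<lambda>c. c) x F = 0" by (auto simp: vanishes_at_def)
next
  assume "mp_eval (\<lambda>c. c) x F = 0"
  then show "vanishes_at F Q"
    using assms by (auto simp: vanishes_at_def mp_eval_id_scaled_point)
qed

text \<open>One fixed coordinate vector for each point makes the value of a form a number in k.
  Another choice would scale it by a nonzero factor, so its vanishing and the quotients of forms of
  equal degree do not depend on the choice.\<close>

definition rep :: "('n, 'k) proj_point \<Rightarrow> 'n \<Rightarrow> 'k" where
  "rep Q = (SOME x. (\<exists>i. x i \<noteq> 0) \<and> Q = {(\<lambda>i. c * x i) | c. c \<noteq> 0})"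

abbreviation "ev Q \<equiv> mp_eval (\<lambda>c. c) (rep Q)"

lemma rep:
  assumes "Q \<in> C"
  shows "\<exists>i. rep Q i \<noteq> 0" "Q = {(\<lambda>i. c * rep Q i) | c. c \<noteq> 0}"
proof -
  have "\<exists>x. (\<exists>i. x i \<noteq> 0) \<and> Q = {(\<lambda>i. c * x i) | c. c \<noteq> 0}"
    by (rule point_rep[OF assms]) blast
  from someI_ex[OF this] have *: "(\<exists>i. rep Q i \<noteq> 0) \<and> Q = {(\<lambda>i. c * rep Q i) | c. c \<noteq> 0}"
    unfolding rep_def .
  show "\<exists>i. rep Q i \<noteq> 0" "Q = {(\<lambda>i. c * rep Q i) | c. c \<noteq> 0}"
    by (rule conjunct1[OF *]) (rule conjunct2[OF *])
qed

lemma vanishes_at_iff: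
  "Q \<in> C \<Longrightarrow> mp_homogeneous e F \<Longrightarrow> vanishes_at F Q \<longleftrightarrow> ev Q F = 0"
  using vanishes_at_multiples[OF rep(2)] by blast

lemma E_eq_0_iff: "mp_homogeneous e F \<Longrightarrow> E F = 0 \<longleftrightarrow> (\<forall>Q\<in>C. ev Q F = 0)"
proof -
  assume F: "mp_homogeneous e F"
  then have "E F = 0 \<longleftrightarrow> (\<forall>Q\<in>C. vanishes_at F Q)"
    using generic unfolding generic_point_def by simp
  then show ?thesis by (simp add: vanishes_at_iff[OF _ F])
qed

lemma E_neq_0: "mp_homogeneous e F \<Longrightarrow> Q \<in> C \<Longrightarrow> ev Q F \<noteq> 0 \<Longrightarrow> E F \<noteq> 0"
  using E_eq_0_iff by blast

lemma Loc_alt: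
  assumes "Q \<in> C"
  shows "Loc Q = {E F / E G | F G. ev Q G \<noteq> 0 \<and> (\<exists>e. mp_homogeneous e F \<and> mp_homogeneous e G)}"
  unfolding local_ring_def using vanishes_at_iff[OF assms] by blast

lemma Max_id_alt:
  assumes "Q \<in> C"
  shows "Max_id Q = {E F / E G | F G. ev Q F = 0 \<and> ev Q G \<noteq> 0 \<and>
    (\<exists>e. mp_homogeneous e F \<and> mp_homogeneous e G)}"
  unfolding maximal_ideal_at_def using vanishes_at_iff[OF assms] by blast

lemma LocE:
  assumes "x \<in> Loc Q" "Q \<in> C"
  obtains F G e where "x = E F / E G" "ev Q G \<noteq> 0" "E G \<noteq> 0" "mp_homogeneous e F" "mp_homogeneous e G"
  using assms E_neq_0 unfolding Loc_alt[OF assms(2)] by blast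

lemma LocI:
  assumes "Q \<in> C" "ev Q G \<noteq> 0" "mp_homogeneous e F" "mp_homogeneous e G"
  shows "E F / E G \<in> Loc Q"
  using assms unfolding Loc_alt[OF assms(1)] by blast

lemma Max_idE:
  assumes "x \<in> Max_id Q" "Q \<in> C"
  obtains F G e where "x = E F / E G" "ev Q F = 0" "ev Q G \<noteq> 0" "E G \<noteq> 0"
    "mp_homogeneous e F" "mp_homogeneous e G"
  using assms E_neq_0 unfolding Max_id_alt[OF assms(2)] by blast

lemma Max_idI:
  assumes "Q \<in> C" "ev Q F = 0" "ev Q G \<noteq> 0" "mp_homogeneous e F" "mp_homogeneous e G"
  shows "E F / E G \<in> Max_id Q"
  using assms unfolding Max_id_alt[OF assms(1)] by blast

lemma KE:
  assumes "x \<in> K"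
  obtains F G e where "x = E F / E G" "E G \<noteq> 0" "mp_homogeneous e F" "mp_homogeneous e G"
  using assms unfolding function_field_def by blast

lemma KI: "E G \<noteq> 0 \<Longrightarrow> mp_homogeneous e F \<Longrightarrow> mp_homogeneous e G \<Longrightarrow> E F / E G \<in> K"
  unfolding function_field_def by blast

lemma subalg_K: "subalg K"
  unfolding subalg_def
proof (intro conjI ballI subsetI)
  fix x assume "x \<in> range \<iota>"
  then obtain c where "x = \<iota> c" by blast
  then show "x \<in> K" using KI[of "mp_const 1" 0 "mp_const c"] by simp
next
  fix x y assume "x \<in> K" "y \<in> K"
  from KE[OF this(1)] obtain F G e where
    x: "x = E F / E G" "E G \<noteq> 0" "mp_homogeneous e F" "mp_homogeneous e G" by blast
  from KE[OF \<open>y \<in> K\<close>] obtain F' G' e' where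
    y: "y = E F' / E G'" "E G' \<noteq> 0" "mp_homogeneous e' F'" "mp_homogeneous e' G'" by blast
  have "x + y = E (F * G' + G * F') / E (G * G')"
    unfolding x(1) y(1) mp_eval_add mp_eval_mult
    using \<open>E G \<noteq> 0\<close> \<open>E G' \<noteq> 0\<close> by (simp add: field_simps)
  also have "\<dots> \<in> K"
    by (rule KI) (use x y in \<open>auto simp: mp_eval_mult intro!: mp_homogeneous_add mp_homogeneous_mult\<close>)
  finally show "x + y \<in> K" .
  have "x * y = E (F * F') / E (G * G')"
    using x y by (simp add: mp_eval_mult)
  also have "\<dots> \<in> K"
    by (rule KI) (use x y in \<open>auto simp: mp_eval_mult intro!: mp_homogeneous_mult\<close>)
  finally show "x * y \<in> K" .
qed

lemma K_inverse:
  assumes "x \<in> K"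
  shows "inverse x \<in> K"
proof (cases "x = 0")
  case False
  from KE[OF assms] obtain F G e where
    x: "x = E F / E G" "E G \<noteq> 0" "mp_homogeneous e F" "mp_homogeneous e G" by blast
  with False have "E F \<noteq> 0" by auto
  with x KI[of F e G] show ?thesis by (simp add: inverse_eq_divide)
qed (use assms in simp)

lemma K_divide: "x \<in> K \<Longrightarrow> y \<in> K \<Longrightarrow> x / y \<in> K"
  using subalg_mult[OF subalg_K _ K_inverse] by (simp add: field_class.field_divide_inverse)

lemma Loc_subset_K: "Q \<in> C \<Longrightarrow> x \<in> Loc Q \<Longrightarrow> x \<in> K"
  by (erule LocE) (auto intro: KI)

lemma subalg_Loc:
  assumes Q: "Q \<in> C"
  shows "subalg (Loc Q)"
  unfolding subalg_def
proof (intro conjI ballI subsetI)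
  fix x assume "x \<in> range \<iota>"
  then obtain c where "x = \<iota> c" by blast
  then show "x \<in> Loc Q" using LocI[of Q "mp_const 1" 0 "mp_const c"] Q by simp
next
  fix x y assume "x \<in> Loc Q" "y \<in> Loc Q"
  from LocE[OF this(1) Q] obtain F G e where
    x: "x = E F / E G" "ev Q G \<noteq> 0" "E G \<noteq> 0" "mp_homogeneous e F" "mp_homogeneous e G" by blast
  from LocE[OF \<open>y \<in> Loc Q\<close> Q] obtain F' G' e' where
    y: "y = E F' / E G'" "ev Q G' \<noteq> 0" "E G' \<noteq> 0" "mp_homogeneous e' F'" "mp_homogeneous e' G'" by blast
  have "x + y = E (F * G' + G * F') / E (G * G')"
    unfolding x(1) y(1) mp_eval_add mp_eval_mult
    using \<open>E G \<noteq> 0\<close> \<open>E G' \<noteq> 0\<close> by (simp add: field_simps)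
  also have "\<dots> \<in> Loc Q"
    by (rule LocI[OF Q])
      (use x y in \<open>auto simp: mp_eval_id_mult intro!: mp_homogeneous_add mp_homogeneous_mult\<close>)
  finally show "x + y \<in> Loc Q" .
  have "x * y = E (F * F') / E (G * G')"
    using x y by (simp add: mp_eval_mult)
  also have "\<dots> \<in> Loc Q"
    by (rule LocI[OF Q]) (use x y in \<open>auto simp: mp_eval_id_mult intro!: mp_homogeneous_mult\<close>)
  finally show "x * y \<in> Loc Q" .
qed

lemma Max_id_subset_Loc: "Q \<in> C \<Longrightarrow> x \<in> Max_id Q \<Longrightarrow> x \<in> Loc Q"
  by (erule Max_idE) (auto intro: LocI)

lemma ideal_of_Max_id:
  assumes Q: "Q \<in> C"
  shows "ideal_of (Loc Q) (Max_id Q)"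
  unfolding ideal_of_def
proof (intro conjI ballI subsetI)
  show "0 \<in> Max_id Q"
    using Max_idI[OF Q, of "mp_const 0" "mp_const 1" 0] by simp
next
  fix x y assume "x \<in> Max_id Q" "y \<in> Max_id Q"
  from Max_idE[OF this(1) Q] obtain F G e where
    x: "x = E F / E G" "ev Q F = 0" "ev Q G \<noteq> 0" "E G \<noteq> 0" "mp_homogeneous e F" "mp_homogeneous e G" by blast
  from Max_idE[OF \<open>y \<in> Max_id Q\<close> Q] obtain F' G' e' where
    y: "y = E F' / E G'" "ev Q F' = 0" "ev Q G' \<noteq> 0" "E G' \<noteq> 0" "mp_homogeneous e' F'" "mp_homogeneous e' G'" by blast
  have "x + y = E (F * G' + G * F') / E (G * G')"
    unfolding x(1) y(1) mp_eval_add mp_eval_mult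
    using \<open>E G \<noteq> 0\<close> \<open>E G' \<noteq> 0\<close> by (simp add: field_simps)
  also have "\<dots> \<in> Max_id Q"
    by (rule Max_idI[OF Q]) (use x y in \<open>auto simp: mp_eval_id_mult mp_eval_id_add
      intro!: mp_homogeneous_add mp_homogeneous_mult\<close>)
  finally show "x + y \<in> Max_id Q" .
next
  fix x y assume "x \<in> Loc Q" "y \<in> Max_id Q"
  from LocE[OF this(1) Q] obtain F G e where
    x: "x = E F / E G" "ev Q G \<noteq> 0" "E G \<noteq> 0" "mp_homogeneous e F" "mp_homogeneous e G" by blast
  from Max_idE[OF \<open>y \<in> Max_id Q\<close> Q] obtain F' G' e' where
    y: "y = E F' / E G'" "ev Q F' = 0" "ev Q G' \<noteq> 0" "E G' \<noteq> 0" "mp_homogeneous e' F'" "mp_homogeneous e' G'" by blast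
  have "x * y = E (F * F') / E (G * G')"
    using x y by (simp add: mp_eval_mult)
  also have "\<dots> \<in> Max_id Q"
    by (rule Max_idI[OF Q]) (use x y in \<open>auto simp: mp_eval_id_mult intro!: mp_homogeneous_mult\<close>)
  finally show "x * y \<in> Max_id Q" .
qed (use Q Max_id_subset_Loc in blast)

lemma homogeneous_lincomb:
  assumes "mp_homogeneous e F" "mp_homogeneous e G"
  shows "mp_homogeneous e (F + mp_const r * G)"
  using mp_homogeneous_mult[OF mp_homogeneous_const assms(2), of r]
  by (intro mp_homogeneous_add assms) simp

lemma one_notin_Max_id:
  assumes Q: "Q \<in> C"
  shows "1 \<notin> Max_id Q"
proof
  assume "1 \<in> Max_id Q"
  from Max_idE[OF this Q] obtain F G e where
    x: "1 = E F / E G" "ev Q F = 0" "ev Q G \<noteq> 0" "E G \<noteq> 0" "mp_homogeneous e F" "mp_homogeneous e G" by blast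
  have "E (F + mp_const (- 1) * G) = 0"
    using x by (simp add: mp_eval_add mp_eval_mult hom_uminus)
  with E_eq_0_iff[OF homogeneous_lincomb[OF x(5,6)]] Q have "ev Q (F + mp_const (- 1) * G) = 0" by blast
  with x show False by (simp add: mp_eval_id_add mp_eval_id_mult)
qed

lemma Loc_inverse:
  assumes Q: "Q \<in> C" and "x \<in> Loc Q" "x \<notin> Max_id Q"
  shows "inverse x \<in> Loc Q"
proof -
  from LocE[OF assms(2) Q] obtain F G e where
    x: "x = E F / E G" "ev Q G \<noteq> 0" "E G \<noteq> 0" "mp_homogeneous e F" "mp_homogeneous e G" by blast
  with assms(3) Max_idI[OF Q] have "ev Q F \<noteq> 0" by blast
  then show ?thesis using LocI[OF Q, of F e G] x by (simp add: inverse_eq_divide)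
qed

lemma Loc_residue:
  assumes Q: "Q \<in> C" and "x \<in> Loc Q"
  shows "\<exists>r. x - \<iota> r \<in> Max_id Q"
proof -
  from LocE[OF assms(2) Q] obtain F G e where
    x: "x = E F / E G" "ev Q G \<noteq> 0" "E G \<noteq> 0" "mp_homogeneous e F" "mp_homogeneous e G" by blast
  \<comment> \<open>The value of \<open>x\<close> at \<open>Q\<close>; subtracting it makes the
    numerator vanish at \<open>Q\<close>.\<close>
  define r where "r = ev Q F / ev Q G"
  have "x - \<iota> r = E (F + mp_const (- r) * G) / E G"
    using x by (simp add: mp_eval_add mp_eval_mult hom_uminus field_simps)
  also have "\<dots> \<in> Max_id Q"
    using x by (intro Max_idI[OF Q] homogeneous_lincomb)
      (auto simp: mp_eval_id_add mp_eval_id_mult r_def)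
  finally show ?thesis by blast
qed

lemma const_in_Max_id: "Q \<in> C \<Longrightarrow> \<iota> r \<in> Max_id Q \<longleftrightarrow> r = 0"
proof
  assume Q: "Q \<in> C" and r: "\<iota> r \<in> Max_id Q"
  show "r = 0"
  proof (rule ccontr)
    assume "r \<noteq> 0"
    with ideal_of_mult[OF ideal_of_Max_id subalg_const[OF subalg_Loc] r, OF Q Q, of "inverse r"]
    have "1 \<in> Max_id Q" by (simp flip: hom_mult)
    with one_notin_Max_id[OF Q] show False by simp
  qed
qed (use ideal_of_zero[OF ideal_of_Max_id] in auto)

section \<open>Affine coordinates and algebraic relations between functions\<close>

lemma E_dehomogenize:
  assumes "mp_homogeneous e F" "\<xi> i \<noteq> 0"
  shows "E F = \<xi> i ^ e * mp_eval \<iota> (\<lambda>j. \<xi> j / \<xi> i) F"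
  using mp_eval_scaled_point[OF assms(1), of "\<xi> i" "\<lambda>j. \<xi> j / \<xi> i"] assms(2) by simp

lemma coordinate_ratio_in_K: "\<xi> i \<noteq> 0 \<Longrightarrow> \<xi> j / \<xi> i \<in> K"
  using KI[of "mp_var i" "Suc 0" "mp_var j"] by simp

lemma some_coordinate_nonzero: "\<exists>i. \<xi> i \<noteq> 0"
proof -
  obtain Q where Q: "Q \<in> C" using variety by (auto simp: projective_variety_def)
  from rep[OF Q] obtain i where "rep Q i \<noteq> 0" by blast
  with E_neq_0[OF mp_homogeneous_var Q, of i] show ?thesis by auto
qed

text \<open>A two-element set exceeds the transcendence degree, so it is algebraically dependent.
  Independence is a property of sets and the variables are indexed by the field elements themselves,
  hence \<open>x \<noteq> y\<close>: it makes \<open>{x, y}\<close> have two elements and the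
  exponents \<open>i\<close> and \<open>j\<close> recoverable from the monomial.\<close>

lemma algebraic_relation:
  assumes x: "x \<in> K" and y: "y \<in> K" and "x \<noteq> y"
  shows "\<exists>N c. (\<exists>i\<le>N. \<exists>j\<le>N. c i j \<noteq> 0) \<and> (\<Sum>i\<le>N. \<Sum>j\<le>N. \<iota> (c i j) * (x ^ i * y ^ j)) = 0"
proof -
  have "\<forall>S\<subseteq>K. finite S \<longrightarrow> algebraically_independent \<iota> S \<longrightarrow> card S \<le> 1"
    using trdeg unfolding has_transcendence_degree_def by (rule conjunct2)
  from this[rule_format, of "{x, y}"] assms have "\<not> algebraically_independent \<iota> {x, y}"
    by auto
  then obtain F :: "('K, 'k) mpolynomial" where F:
    "\<forall>m\<in>Poly_Mapping.keys F. Poly_Mapping.keys m \<subseteq> {x, y}" "mp_eval \<iota> (\<lambda>s. s) F = 0" "F \<noteq> 0"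
    unfolding algebraically_independent_def by blast
  define mon where "mon = (\<lambda>(i, j). Poly_Mapping.single x i + Poly_Mapping.single y j :: 'K \<Rightarrow>\<^sub>0 nat)"
  have lookup_mon: "Poly_Mapping.lookup (mon (i, j)) s = (if s = x then i else if s = y then j else 0)" for i j s
    using \<open>x \<noteq> y\<close> by (auto simp: mon_def lookup_add lookup_single when_def)
  have inj: "inj mon"
  proof (rule injI, clarify)
    fix i j i' j' assume "mon (i, j) = mon (i', j')"
    then show "i = i' \<and> j = j'"
      using lookup_mon[of i j] lookup_mon[of i' j'] \<open>x \<noteq> y\<close> by metis
  qed
  have mon_eq: "m = mon (Poly_Mapping.lookup m x, Poly_Mapping.lookup m y)" if "m \<in> Poly_Mapping.keys F" for m
  proof (rule poly_mapping_eqI)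
    fix s
    show "Poly_Mapping.lookup m s = Poly_Mapping.lookup (mon (Poly_Mapping.lookup m x, Poly_Mapping.lookup m y)) s"
      using F(1) that by (auto simp: lookup_mon in_keys_iff subset_iff)
  qed
  define N where "N = Max ((\<lambda>m. max (Poly_Mapping.lookup m x) (Poly_Mapping.lookup m y)) ` Poly_Mapping.keys F)"
  have N: "Poly_Mapping.lookup m x \<le> N" "Poly_Mapping.lookup m y \<le> N" if "m \<in> Poly_Mapping.keys F" for m
  proof -
    have "max (Poly_Mapping.lookup m x) (Poly_Mapping.lookup m y) \<le> N"
      unfolding N_def using that by (intro Max_ge) auto
    then show "Poly_Mapping.lookup m x \<le> N" "Poly_Mapping.lookup m y \<le> N" by auto
  qed
  define S where "S = mon ` ({..N} \<times> {..N})"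
  have keys: "Poly_Mapping.keys F \<subseteq> S"
  proof
    fix m assume m: "m \<in> Poly_Mapping.keys F"
    show "m \<in> S"
      by (subst mon_eq[OF m]) (use N[OF m] in \<open>simp add: S_def\<close>)
  qed
  have mon_val: "monomial_value (\<lambda>s. s) (mon (i, j)) = x ^ i * y ^ j" for i j
    by (subst monomial_value_superset[of "{x, y}"])
      (use \<open>x \<noteq> y\<close> in \<open>auto simp: lookup_mon in_keys_iff split: if_splits\<close>)
  define c where "c i j = Poly_Mapping.lookup F (mon (i, j))" for i j
  have "0 = (\<Sum>m\<in>S. \<iota> (Poly_Mapping.lookup F m) * monomial_value (\<lambda>s. s) m)"
    using F(2) mp_eval_superset[OF _ keys] by (simp add: S_def)
  also have "\<dots> = (\<Sum>p\<in>{..N} \<times> {..N}. \<iota> (Poly_Mapping.lookup F (mon p)) * monomial_value (\<lambda>s. s) (mon p))"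
    unfolding S_def by (subst sum.reindex) (auto intro: inj_on_subset[OF inj])
  also have "\<dots> = (\<Sum>i\<le>N. \<Sum>j\<le>N. \<iota> (c i j) * (x ^ i * y ^ j))"
    unfolding sum.cartesian_product by (rule sum.cong) (auto simp: c_def mon_val)
  finally have "(\<Sum>i\<le>N. \<Sum>j\<le>N. \<iota> (c i j) * (x ^ i * y ^ j)) = 0" by simp
  moreover obtain m where m: "m \<in> Poly_Mapping.keys F" using F(3) by (metis keys_eq_empty equals0I)
  then have "c (Poly_Mapping.lookup m x) (Poly_Mapping.lookup m y) \<noteq> 0"
    using mon_eq[OF m, symmetric] by (simp add: c_def in_keys_iff)
  then have "\<exists>i\<le>N. \<exists>j\<le>N. c i j \<noteq> 0" using N[OF m] by blast
  ultimately show ?thesis by blast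
qed

end

section \<open>The local ring of a smooth point is a discrete valuation ring\<close>

context field_embedding
begin

text \<open>\<open>R j\<close> means that the coefficient of index \<open>j\<close> is formally
  nonzero. It is kept apart from \<open>c j \<noteq> 0\<close> because in the outer applications
  \<open>c j\<close> is itself the value of a polynomial in a second element, and that value is not
  yet known to be nonzero.\<close>

lemma lowest_term:
  assumes A: "subalg A" and x: "x \<in> A" and c: "\<And>j. c j \<in> A"
    and ex: "\<exists>j\<le>N. R j" and zero: "\<And>j. \<not> R j \<Longrightarrow> c j = 0"
  shows "\<exists>j0\<le>N. \<exists>r\<in>A. R j0 \<and> (\<Sum>j\<le>N. c j * x ^ j) = x ^ j0 * (c j0 + x * r)"
proof -
  define j0 where "j0 = (LEAST j. R j)"
  have j0: "R j0" "j0 \<le> N" and less: "\<And>j. j < j0 \<Longrightarrow> \<not> R j"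
    using ex LeastI Least_le not_less_Least unfolding j0_def by (metis order_trans)+
  define r where "r = (\<Sum>j\<in>{Suc j0..N}. c j * x ^ (j - Suc j0))"
  have "(\<Sum>j\<le>N. c j * x ^ j) = (\<Sum>j\<in>{j0..N}. c j * x ^ j)"
    by (rule sum.mono_neutral_right) (use less zero in \<open>auto simp: not_le\<close>)
  also have "\<dots> = c j0 * x ^ j0 + (\<Sum>j\<in>{Suc j0..N}. c j * x ^ j)"
    using j0(2) by (simp add: sum.atLeast_Suc_atMost)
  also have "(\<Sum>j\<in>{Suc j0..N}. c j * x ^ j) = x ^ j0 * (x * r)"
    unfolding r_def sum_distrib_left
  proof (rule sum.cong)
    fix j assume "j \<in> {Suc j0..N}"
    then have "j = j0 + Suc (j - Suc j0)" by auto
    then have "x ^ j = x ^ j0 * (x * x ^ (j - Suc j0))" by (metis power_add power_Suc)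
    then show "c j * x ^ j = x ^ j0 * (x * (c j * x ^ (j - Suc j0)))" by (simp add: mult_ac)
  qed simp
  finally have "(\<Sum>j\<le>N. c j * x ^ j) = x ^ j0 * (c j0 + x * r)" by (simp add: algebra_simps)
  moreover have "r \<in> A"
    unfolding r_def by (intro subalg_sum subalg_mult subalg_power A x c)
  ultimately show ?thesis using j0 by blast
qed

definition ideal_gen :: "'a set \<Rightarrow> 'a set \<Rightarrow> 'a set" where
  "ideal_gen A Z = {(\<Sum>z\<in>Z. h z * z) | h. \<forall>z. h z \<in> A}"

lemma ideal_of_ideal_gen:
  assumes A: "subalg A" and Z: "Z \<subseteq> A"
  shows "ideal_of A (ideal_gen A Z)"
  unfolding ideal_of_def
proof (intro conjI ballI subsetI)
  fix x assume "x \<in> ideal_gen A Z"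
  then show "x \<in> A"
    using Z by (auto simp: ideal_gen_def intro!: subalg_sum[OF A] subalg_mult[OF A])
next
  show "0 \<in> ideal_gen A Z"
    unfolding ideal_gen_def by (auto intro!: exI[of _ "\<lambda>_. 0"] subalg_zero[OF A])
next
  fix x y assume "x \<in> ideal_gen A Z" "y \<in> ideal_gen A Z"
  then obtain h h' where "x = (\<Sum>z\<in>Z. h z * z)" "\<forall>z. h z \<in> A" "y = (\<Sum>z\<in>Z. h' z * z)" "\<forall>z. h' z \<in> A"
    unfolding ideal_gen_def by blast
  then show "x + y \<in> ideal_gen A Z"
    unfolding ideal_gen_def
    by (auto intro!: exI[of _ "\<lambda>z. h z + h' z"] subalg_add[OF A] simp: sum.distrib algebra_simps)
next
  fix a x assume "a \<in> A" "x \<in> ideal_gen A Z"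
  then obtain h where "x = (\<Sum>z\<in>Z. h z * z)" "\<forall>z. h z \<in> A"
    unfolding ideal_gen_def by blast
  then show "a * x \<in> ideal_gen A Z"
    using \<open>a \<in> A\<close> unfolding ideal_gen_def
    by (auto intro!: exI[of _ "\<lambda>z. a * h z"] subalg_mult[OF A] simp: sum_distrib_left mult.assoc)
qed

lemma ideal_gen_base:
  assumes A: "subalg A" and "finite Z" "z \<in> Z"
  shows "z \<in> ideal_gen A Z"
proof -
  have "(\<Sum>i\<in>Z. (if i = z then 1 else 0) * i) = (\<Sum>i\<in>Z. if i = z then i else 0)"
    by (rule sum.cong) auto
  also have "\<dots> = z" using assms by simp
  finally show ?thesis
    unfolding ideal_gen_def using subalg_one[OF A] subalg_zero[OF A]
    by (auto intro!: exI[of _ "\<lambda>i. if i = z then 1 else 0"])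
qed

lemma ideal_gen_insertE:
  assumes A: "subalg A" and "finite Z" and "x \<in> ideal_gen A (insert z Z)"
  obtains a y where "a \<in> A" "y \<in> ideal_gen A Z" "x = a * z + y"
proof (cases "z \<in> Z")
  case True
  with assms that[of 0 x] subalg_zero[OF A] show ?thesis by (auto simp: insert_absorb)
next
  case False
  from assms(3) obtain h where h: "x = (\<Sum>z\<in>insert z Z. h z * z)" "\<forall>z. h z \<in> A"
    unfolding ideal_gen_def by blast
  with False assms(2) have "x = h z * z + (\<Sum>z\<in>Z. h z * z)" by simp
  moreover have "(\<Sum>z\<in>Z. h z * z) \<in> ideal_gen A Z" using h unfolding ideal_gen_def by blast
  ultimately show ?thesis using that h by blast
qed

end

context projective_curve
begin

text \<open>The generators are the affine coordinates minus their values at \<open>Q\<close>: modulo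
  these, a dehomogenized form is congruent to its own value at \<open>Q\<close>, which is zero for
  the numerator of an element of the maximal ideal.\<close>

lemma Max_id_finitely_generated:
  assumes Q: "Q \<in> C"
  shows "\<exists>Z. finite Z \<and> Z \<subseteq> Max_id Q \<and> Max_id Q \<subseteq> ideal_gen (Loc Q) Z"
proof -
  obtain i where i: "rep Q i \<noteq> 0" using rep(1)[OF Q] by blast
  have xi: "\<xi> i \<noteq> 0" using E_neq_0[OF mp_homogeneous_var Q, of i] i by simp
  define y where "y j = \<xi> j / \<xi> i" for j
  define c where "c j = rep Q j / rep Q i" for j
  define Z where "Z = range (\<lambda>j. y j - \<iota> (c j))"
  have y: "y j \<in> Loc Q" for j
    using LocI[OF Q, of "mp_var i" "Suc 0" "mp_var j"] i by (simp add: y_def)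
  have yc: "y j - \<iota> (c j) \<in> Max_id Q" for j
  proof -
    have "mp_homogeneous (Suc 0) (mp_var j + mp_const (- c j) * mp_var i)"
      by (rule homogeneous_lincomb) auto
    from Max_idI[OF Q _ _ this mp_homogeneous_var, of i] i
    have "(\<xi> j + \<iota> (- c j) * \<xi> i) / \<xi> i \<in> Max_id Q"
      by (simp add: mp_eval_id_add mp_eval_id_mult c_def mp_eval_add mp_eval_mult)
    also have "(\<xi> j + \<iota> (- c j) * \<xi> i) / \<xi> i = y j - \<iota> (c j)"
      using xi by (simp add: y_def hom_uminus field_simps)
    finally show ?thesis .
  qed
  have finZ: "finite Z" and ZM: "Z \<subseteq> Max_id Q" using yc by (auto simp: Z_def)
  then have ZA: "Z \<subseteq> Loc Q" using Max_id_subset_Loc[OF Q] by blast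
  note A = subalg_Loc[OF Q]
  note I = ideal_of_ideal_gen[OF A ZA]
  have res: "mp_eval \<iota> y F - \<iota> (mp_eval (\<lambda>c. c) c F) \<in> ideal_gen (Loc Q) Z" for F
    by (rule residue_mp_eval[OF A I y ideal_gen_base[OF A finZ]]) (auto simp: Z_def)
  have "x \<in> ideal_gen (Loc Q) Z" if "x \<in> Max_id Q" for x
  proof -
    from Max_idE[OF that Q] obtain F G e where
      x: "x = E F / E G" "ev Q F = 0" "ev Q G \<noteq> 0" "E G \<noteq> 0" "mp_homogeneous e F" "mp_homogeneous e G"
      by blast
    have "ev Q F = rep Q i ^ e * mp_eval (\<lambda>c. c) c F"
      using mp_eval_id_scaled_point[OF x(5), of "rep Q i" c] i by (simp add: c_def)
    with x(2) i have "mp_eval (\<lambda>c. c) c F = 0" by simp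
    with res[of F] have Fy: "mp_eval \<iota> y F \<in> ideal_gen (Loc Q) Z" by simp
    \<comment> \<open>This factor leads back from the dehomogenized numerator to the fraction
      \<open>E F / E G\<close>.\<close>
    have "E (mp_var i ^ e) / E G \<in> Loc Q"
      using x(3) x(6) mp_homogeneous_power[OF mp_homogeneous_var, of e i] by (intro LocI[OF Q]) auto
    then have "\<xi> i ^ e / E G \<in> Loc Q" by (simp add: mp_eval_power)
    from ideal_of_mult[OF I this Fy]
    have "\<xi> i ^ e * mp_eval \<iota> y F / E G \<in> ideal_gen (Loc Q) Z" by simp
    also have "\<xi> i ^ e * mp_eval \<iota> y F = E F"
      using E_dehomogenize[OF x(5) xi] by (simp add: y_def[abs_def])
    finally show ?thesis using x(1) by simp
  qed
  then show ?thesis using finZ ZM by blast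
qed

text \<open>Numerator and denominator are divided by the same power of a coordinate that does not
  vanish at \<open>Q\<close>.\<close>

lemma K_quotient_of_Loc:
  assumes Q: "Q \<in> C" and "f \<in> K"
  shows "\<exists>a\<in>Loc Q. \<exists>b\<in>Loc Q. b \<noteq> 0 \<and> f = a / b"
proof -
  obtain i where i: "rep Q i \<noteq> 0" using rep(1)[OF Q] by blast
  have xi: "\<xi> i \<noteq> 0" using E_neq_0[OF mp_homogeneous_var Q, of i] i by simp
  from KE[OF assms(2)] obtain F G e where
    f: "f = E F / E G" "E G \<noteq> 0" "mp_homogeneous e F" "mp_homogeneous e G" by blast
  have *: "E H / \<xi> i ^ e \<in> Loc Q" if "mp_homogeneous e H" for H
  proof -
    have "ev Q (mp_var i ^ e) = rep Q i ^ e"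
      by (simp add: field_embedding.mp_eval_power[OF field_embedding_id])
    then have "E H / E (mp_var i ^ e) \<in> Loc Q"
      using i that mp_homogeneous_power[OF mp_homogeneous_var, of e i] by (intro LocI[OF Q]) auto
    then show ?thesis by (simp add: mp_eval_power)
  qed
  have "f = (E F / \<xi> i ^ e) / (E G / \<xi> i ^ e)" "E G / \<xi> i ^ e \<noteq> 0"
    using f xi by auto
  with *[OF f(3)] *[OF f(4)] show ?thesis by blast
qed

end

locale smooth_point = projective_curve \<iota> \<xi> C
  for \<iota> :: "'k::alg_closed_field \<Rightarrow> 'K::field" and \<xi> :: "'n::finite \<Rightarrow> 'K" and C +
  fixes P
  assumes P: "P \<in> C"
    and smooth: "has_dim_mod (\<lambda>c x. \<iota> c * x) (maximal_ideal_at \<iota> \<xi> P)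
        (product_span (maximal_ideal_at \<iota> \<xi> P) (maximal_ideal_at \<iota> \<xi> P)) 1"
begin

abbreviation "OP \<equiv> local_ring \<iota> \<xi> P"
abbreviation "MP \<equiv> maximal_ideal_at \<iota> \<xi> P"

lemmas subalg_OP = subalg_Loc[OF P]
lemmas ideal_MP = ideal_of_Max_id[OF P]

lemma MP_mod_square:
  "\<exists>t\<in>MP. t \<noteq> 0 \<and> (\<forall>v\<in>MP. \<exists>c. v - \<iota> c * t \<in> product_span MP MP)"
proof -
  from smooth obtain b where
    "basis_mod (\<lambda>c x. \<iota> c * x) MP (product_span MP MP) {..<1::nat} b"
    unfolding has_dim_mod_def by blast
  then have b: "b 0 \<in> MP" "\<forall>v\<in>MP. \<exists>c::nat \<Rightarrow> 'k. v - \<iota> (c 0) * b 0 \<in> product_span MP MP"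
    "\<forall>c. \<iota> (c 0) * b 0 \<in> product_span MP MP \<longrightarrow> c (0::nat) = 0"
    by (simp_all add: basis_mod_def lessThan_Suc)
  have "0 \<in> product_span MP MP"
    unfolding product_span_def by (auto intro!: exI[of _ "0::nat"])
  with b(3)[rule_format, of "\<lambda>_. 1"] have "b 0 \<noteq> 0" by auto
  with b(1,2) show ?thesis by blast
qed

text \<open>Nakayama's lemma, eliminating one generator of the maximal ideal at a time.\<close>

lemma MP_generated_by_one:
  assumes t: "t \<in> MP" and cot: "\<And>v. v \<in> MP \<Longrightarrow> \<exists>c. v - \<iota> c * t \<in> product_span MP MP"
    and "finite Z" "Z \<subseteq> MP" "MP \<subseteq> ideal_gen OP (insert t Z)"
  shows "MP \<subseteq> ideal_gen OP {t}"
  using assms(3-5)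
proof (induction Z rule: finite_induct)
  case (insert z Z)
  define I where "I = ideal_gen OP (insert t Z)"
  have sub: "MP \<subseteq> OP" using Max_id_subset_Loc[OF P] by blast
  have idI: "ideal_of OP I"
    unfolding I_def using insert.prems t sub by (intro ideal_of_ideal_gen subalg_OP) auto
  have rep: "\<exists>a\<in>OP. \<exists>y\<in>I. x = a * z + y" if "x \<in> MP" for x
  proof -
    have "x \<in> ideal_gen OP (insert z (insert t Z))"
      using that insert.prems(2) by (auto simp: insert_commute)
    from ideal_gen_insertE[OF subalg_OP _ this] insert.hyps(1) show ?thesis
      unfolding I_def by blast
  qed
  have z: "z \<in> MP" using insert.prems by auto
  \<comment> \<open>Only the first factor of each product is expanded in \<open>z\<close>, so the
    coefficient of \<open>z\<close> retains the second factor and stays in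
    \<open>MP\<close>.\<close>
  have sq: "\<exists>b\<in>MP. \<exists>y\<in>I. x = b * z + y" if "x \<in> product_span MP MP" for x
  proof -
    from that obtain l :: nat and p q where
      x: "x = (\<Sum>i<l. p i * q i)" "\<And>i. i < l \<Longrightarrow> p i \<in> MP \<and> q i \<in> MP"
      unfolding product_span_def by blast
    have "\<forall>i. \<exists>a y. i < l \<longrightarrow> a \<in> OP \<and> y \<in> I \<and> p i = a * z + y"
      using rep x(2) by blast
    then obtain a y where ay: "\<And>i. i < l \<Longrightarrow> a i \<in> OP \<and> y i \<in> I \<and> p i = a i * z + y i"
      by metis
    have "x = (\<Sum>i<l. a i * q i) * z + (\<Sum>i<l. q i * y i)"
      unfolding x(1) sum_distrib_right sum.distrib[symmetric]
      by (rule sum.cong) (use ay in \<open>auto simp: algebra_simps\<close>)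
    moreover have "(\<Sum>i<l. a i * q i) \<in> MP"
      by (intro ideal_of_sum[OF ideal_MP] ideal_of_mult[OF ideal_MP]) (use ay x in auto)
    moreover have "(\<Sum>i<l. q i * y i) \<in> I"
      by (intro ideal_of_sum[OF idI] ideal_of_mult[OF idI]) (use ay x sub in auto)
    ultimately show ?thesis by blast
  qed
  have tI: "t \<in> I" unfolding I_def using insert.hyps by (intro ideal_gen_base subalg_OP) auto
  from cot[OF z] obtain c where "z - \<iota> c * t \<in> product_span MP MP" by blast
  from sq[OF this] obtain b y where b: "b \<in> MP" "y \<in> I" "z - \<iota> c * t = b * z + y" by blast
  \<comment> \<open>The coefficient \<open>1 - b\<close> is a unit of the local ring because
    \<open>b \<in> MP\<close>; hence \<open>z\<close> is redundant as a generator.\<close>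
  then have eq: "(1 - b) * z = \<iota> c * t + y" by (simp add: algebra_simps)
  also have "\<dots> \<in> I"
    using tI b by (intro ideal_of_add[OF idI] ideal_of_mult[OF idI] subalg_const subalg_OP)
  finally have bz: "(1 - b) * z \<in> I" .
  have u: "1 - b \<in> OP" "1 - b \<notin> MP"
  proof -
    show "1 - b \<in> OP" using b(1) sub by (intro subalg_diff subalg_OP subalg_one) auto
    show "1 - b \<notin> MP"
      using ideal_of_add[OF ideal_MP _ b(1), of "1 - b"] one_notin_Max_id[OF P] by auto
  qed
  have "inverse (1 - b) * ((1 - b) * z) \<in> I"
    by (rule ideal_of_mult[OF idI Loc_inverse[OF P u] bz])
  moreover have "1 - b \<noteq> 0" using u ideal_of_zero[OF ideal_MP] by metis
  ultimately have zI: "z \<in> I" by (simp flip: mult.assoc)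
  have "MP \<subseteq> I"
  proof
    fix x assume "x \<in> MP"
    from rep[OF this] zI show "x \<in> I"
      by (auto intro!: ideal_of_add[OF idI] ideal_of_mult[OF idI])
  qed
  then show ?case using insert.IH insert.prems by (auto simp: I_def)
qed auto

text \<open>A generator of the cotangent space is added to a finite generating set of
  \<open>MP\<close>, from which Nakayama's lemma then removes everything else.\<close>

lemma uniformizer_exists: "\<exists>t. t \<noteq> 0 \<and> MP = {t * x | x. x \<in> OP}"
proof -
  from MP_mod_square obtain t where t: "t \<in> MP" "t \<noteq> 0"
    and cot: "\<And>v. v \<in> MP \<Longrightarrow> \<exists>c. v - \<iota> c * t \<in> product_span MP MP" by blast
  from Max_id_finitely_generated[OF P] obtain Z where Z:
    "finite Z" "Z \<subseteq> MP" "MP \<subseteq> ideal_gen OP Z" by blast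
  have "MP \<subseteq> ideal_gen OP (insert t Z)"
  proof
    fix x assume "x \<in> MP"
    with Z obtain h where h: "x = (\<Sum>z\<in>Z. h z * z)" "\<forall>z. h z \<in> OP" unfolding ideal_gen_def by blast
    have id: "ideal_of OP (ideal_gen OP (insert t Z))"
      using Z t Max_id_subset_Loc[OF P] by (intro ideal_of_ideal_gen subalg_OP) auto
    show "x \<in> ideal_gen OP (insert t Z)"
      unfolding h(1) using h Z
      by (intro ideal_of_sum[OF id] ideal_of_mult[OF id] ideal_gen_base subalg_OP) auto
  qed
  from MP_generated_by_one[OF t(1) cot Z(1,2) this] have "MP \<subseteq> ideal_gen OP {t}" .
  moreover have "ideal_gen OP {t} \<subseteq> {t * x | x. x \<in> OP}"
    by (force simp: ideal_gen_def)
  ultimately have "MP \<subseteq> {t * x | x. x \<in> OP}" by blast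
  moreover have "{t * x | x. x \<in> OP} \<subseteq> MP"
    using ideal_of_mult[OF ideal_MP _ t(1)] by (auto simp: mult.commute)
  ultimately show ?thesis using t(2) by blast
qed

definition unif :: 'K where "unif = (SOME t. t \<noteq> 0 \<and> MP = {t * x | x. x \<in> OP})"

lemma unif_neq_0: "unif \<noteq> 0" and MP_eq: "MP = {unif * x | x. x \<in> OP}"
proof -
  have "unif \<noteq> 0 \<and> MP = {unif * x | x. x \<in> OP}"
    unfolding unif_def by (rule someI_ex[OF uniformizer_exists])
  then show "unif \<noteq> 0" "MP = {unif * x | x. x \<in> OP}" by (rule conjunct1, rule conjunct2)
qed

lemma unif_in_MP: "unif \<in> MP"
  unfolding MP_eq using subalg_one[OF subalg_OP] by (auto intro!: exI[of _ 1])

lemma unif_in_OP: "unif \<in> OP"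
  using unif_in_MP Max_id_subset_Loc[OF P] by blast

text \<open>
  Krull's intersection theorem. Transcendence degree one replaces the Noetherian property: in a
  relation between \<open>f\<close> and the uniformizer, the terms of lowest order cannot cancel.
\<close>

lemma Krull_intersection:
  assumes f: "f \<in> OP" "f \<noteq> 0"
  shows "\<exists>n. \<not> (\<exists>x\<in>OP. f = unif ^ n * x)"
proof (rule ccontr)
  assume "\<not> ?thesis"
  then have div: "\<And>n. \<exists>x\<in>OP. f = unif ^ n * x" by blast
  note A = subalg_OP
  have one: "unif * x \<noteq> 1" if "x \<in> OP" for x
    using that one_notin_Max_id[OF P] unfolding MP_eq by force
  \<comment> \<open>The relation below needs two distinct elements; divisibility of \<open>f\<close>
    by \<open>unif ^ 2\<close> separates them.\<close>
  have "f \<noteq> unif"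
  proof
    assume "f = unif"
    with div[of 2] obtain x where "x \<in> OP" "unif = unif ^ 2 * x" by auto
    then have "unif * x = 1" using unif_neq_0 by (simp add: power2_eq_square)
    with one \<open>x \<in> OP\<close> show False by blast
  qed
  from algebraic_relation[OF Loc_subset_K[OF P f(1)] Loc_subset_K[OF P unif_in_OP] this]
  obtain N c where c: "\<exists>j\<le>N. \<exists>i\<le>N. c j i \<noteq> 0"
    and rel: "(\<Sum>j\<le>N. \<Sum>i\<le>N. \<iota> (c j i) * (f ^ j * unif ^ i)) = 0" by blast
  define p where "p j = (\<Sum>i\<le>N. \<iota> (c j i) * unif ^ i)" for j
  have "(\<Sum>j\<le>N. p j * f ^ j) = 0"
    using rel by (simp add: p_def sum_distrib_left mult_ac)
  moreover have p: "p j \<in> OP" for j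
    unfolding p_def by (intro subalg_sum subalg_mult subalg_power subalg_const A unif_in_OP)
  \<comment> \<open>First the lowest power of \<open>f\<close> is split off and cancelled, then the
    lowest power of \<open>unif\<close> in its coefficient \<open>p j0\<close>.\<close>
  moreover have "\<exists>j0\<le>N. \<exists>r\<in>OP. (\<exists>i\<le>N. c j0 i \<noteq> 0) \<and> (\<Sum>j\<le>N. p j * f ^ j) = f ^ j0 * (p j0 + f * r)"
    by (rule lowest_term[OF A f(1) p c]) (auto simp: p_def)
  ultimately obtain j0 r where j0: "r \<in> OP" "\<exists>i\<le>N. c j0 i \<noteq> 0" "p j0 + f * r = 0"
    using f(2) by auto
  have "\<exists>i0\<le>N. \<exists>s\<in>OP. c j0 i0 \<noteq> 0 \<and> (\<Sum>i\<le>N. \<iota> (c j0 i) * unif ^ i) = unif ^ i0 * (\<iota> (c j0 i0) + unif * s)"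
    by (rule lowest_term[OF A unif_in_OP subalg_const[OF A] j0(2)]) auto
  then obtain i0 s where i0: "s \<in> OP" "c j0 i0 \<noteq> 0" "p j0 = unif ^ i0 * (\<iota> (c j0 i0) + unif * s)"
    unfolding p_def by blast
  \<comment> \<open>One power more than \<open>i0\<close> makes \<open>f\<close> contribute a
    multiple of \<open>unif\<close> even after division by \<open>unif ^ i0\<close>; so the nonzero
    constant \<open>\<iota> (c j0 i0)\<close> is forced into \<open>MP\<close>.\<close>
  from div[of "Suc i0"] obtain x where x: "x \<in> OP" "f = unif ^ Suc i0 * x" by blast
  have "unif ^ i0 * (\<iota> (c j0 i0) + unif * (s + x * r)) = 0"
    using j0(3) unfolding i0(3) x(2) by (simp add: algebra_simps)
  then have "\<iota> (c j0 i0) + unif * (s + x * r) = 0"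
    using unif_neq_0 by simp
  then have "\<iota> (c j0 i0) = unif * - (s + x * r)"
    unfolding mult_minus_right eq_neg_iff_add_eq_0 .
  moreover have "- (s + x * r) \<in> OP"
    using i0 x j0 by (intro subalg_uminus subalg_add subalg_mult A)
  ultimately have "\<iota> (c j0 i0) \<in> MP" unfolding MP_eq by blast
  with const_in_Max_id[OF P] i0(2) show False by blast
qed

text \<open>Zero is excluded by hand because \<open>inverse 0 = 0\<close> lies in
  \<open>OP\<close>.\<close>

definition OP_units :: "'K set" where
  "OP_units = {u \<in> OP. inverse u \<in> OP \<and> u \<noteq> 0}"

lemma OP_units_iff: "u \<in> OP_units \<longleftrightarrow> u \<in> OP \<and> u \<notin> MP"
proof
  assume u: "u \<in> OP_units"
  have "u \<notin> MP"
  proof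
    assume "u \<in> MP"
    with u have "inverse u * u \<in> MP" unfolding OP_units_def by (blast intro: ideal_of_mult[OF ideal_MP])
    moreover have "inverse u * u = 1" using u by (simp add: OP_units_def)
    ultimately show False using one_notin_Max_id[OF P] by simp
  qed
  with u show "u \<in> OP \<and> u \<notin> MP" by (simp add: OP_units_def)
next
  assume "u \<in> OP \<and> u \<notin> MP"
  then show "u \<in> OP_units"
    using Loc_inverse[OF P] ideal_of_zero[OF ideal_MP] by (auto simp: OP_units_def)
qed

lemma OP_units_mult: "u \<in> OP_units \<Longrightarrow> w \<in> OP_units \<Longrightarrow> u * w \<in> OP_units"
  by (auto simp: OP_units_def intro: subalg_mult[OF subalg_OP])

lemma OP_units_inverse: "u \<in> OP_units \<Longrightarrow> inverse u \<in> OP_units"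
  by (auto simp: OP_units_def)

lemma OP_units_one: "1 \<in> OP_units"
  by (auto simp: OP_units_def subalg_one[OF subalg_OP])

lemma OP_units_power: "u \<in> OP_units \<Longrightarrow> u ^ n \<in> OP_units"
  by (induction n) (auto intro: OP_units_mult OP_units_one)

lemma OP_units_powi: "u \<in> OP_units \<Longrightarrow> u powi e \<in> OP_units"
  unfolding power_int_def by (auto intro: OP_units_power OP_units_inverse)

lemma OP_factor:
  assumes f: "f \<in> OP" "f \<noteq> 0"
  shows "\<exists>u\<in>OP_units. \<exists>n. f = u * unif ^ n"
proof -
  \<comment> \<open>The first power of \<open>unif\<close> that does not divide \<open>f\<close>;
    the order of \<open>f\<close> will be \<open>n - 1\<close>, and the cofactor lies outside
    \<open>MP\<close> by this choice.\<close>
  define n where "n = (LEAST n. \<not> (\<exists>x\<in>OP. f = unif ^ n * x))"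
  have n: "\<not> (\<exists>x\<in>OP. f = unif ^ n * x)"
    unfolding n_def by (rule LeastI_ex[OF Krull_intersection[OF f]])
  then have "n \<noteq> 0" using f by (intro notI) auto
  then obtain m where m: "n = Suc m" by (cases n) auto
  have "\<exists>x\<in>OP. f = unif ^ m * x"
    using not_less_Least[of m "\<lambda>n. \<not> (\<exists>x\<in>OP. f = unif ^ n * x)"] m unfolding n_def by auto
  then obtain u where u: "u \<in> OP" "f = unif ^ m * u" by blast
  have "u \<notin> MP"
  proof
    assume "u \<in> MP"
    then obtain x where x: "x \<in> OP" "u = unif * x" unfolding MP_eq by blast
    have "f = unif ^ n * x" unfolding u(2) x(2) m by simp
    with n x show False by blast
  qed
  with u show ?thesis by (auto simp: OP_units_iff mult.commute)
qed

lemma K_factor: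
  assumes f: "f \<in> K" "f \<noteq> 0"
  shows "\<exists>u\<in>OP_units. \<exists>e. f = u * unif powi e"
proof -
  from K_quotient_of_Loc[OF P f(1)] obtain a b where
    ab: "a \<in> OP" "b \<in> OP" "b \<noteq> 0" "f = a / b" by blast
  with f have "a \<noteq> 0" by auto
  from OP_factor[OF ab(1) this] OP_factor[OF ab(2,3)] obtain u n w m where
    u: "u \<in> OP_units" "a = u * unif ^ n" "w \<in> OP_units" "b = w * unif ^ m" by blast
  have "f = (u * inverse w) * unif powi (int n - int m)"
    using unif_neq_0 by (simp add: ab(4) u power_int_diff field_simps)
  then show ?thesis using u by (blast intro: OP_units_mult OP_units_inverse)
qed

lemma unif_power_notin_units: "n > 0 \<Longrightarrow> unif ^ n \<notin> OP_units"
  using ideal_of_mult[OF ideal_MP subalg_power[OF subalg_OP unif_in_OP] unif_in_MP, of "n - 1"]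
  by (cases n) (auto simp: OP_units_iff mult.commute)

lemma factor_unique:
  assumes "u \<in> OP_units" "w \<in> OP_units" "u * unif powi e = w * unif powi e'"
  shows "e = e'"
proof -
  have *: "e' \<le> e" if "u \<in> OP_units" "w \<in> OP_units" "u * unif powi e = w * unif powi e'" for u w e e'
  proof (rule ccontr)
    assume "\<not> e' \<le> e"
    define n where "n = nat (e' - e)"
    with \<open>\<not> e' \<le> e\<close> have n: "e' = e + int n" "n > 0" by auto
    have "u = w * unif ^ n"
      using that(3) unif_neq_0 unfolding n by (simp add: power_int_add)
    then have "unif ^ n = u * inverse w"
      using that(2) by (auto simp: OP_units_def field_simps)
    with that unif_power_notin_units[OF n(2)] show False
      by (auto intro: OP_units_mult OP_units_inverse)
  qed
  from *[OF assms] *[OF assms(2,1) assms(3)[symmetric]] show ?thesis by simp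
qed

section \<open>The order function at P\<close>

abbreviation "v \<equiv> ord_at \<iota> \<xi> P"

text \<open>\<open>ord_at\<close> admits every generator of the maximal ideal. Any two of them
  differ by a unit, which is absorbed into the unit factor, so the exponent is the one found with
  \<open>unif\<close>.\<close>

lemma v_eqI:
  assumes u: "u \<in> OP_units" "f = u * unif powi e"
  shows "v f = e"
  unfolding ord_at_def
proof (rule the_equality)
  show "\<exists>t u. MP = {t * x |x. x \<in> OP} \<and> u \<in> OP \<and> inverse u \<in> OP \<and> u \<noteq> 0 \<and> f = u * t powi e"
    using u MP_eq unfolding OP_units_def by blast
next
  fix e' assume "\<exists>t u. MP = {t * x |x. x \<in> OP} \<and> u \<in> OP \<and> inverse u \<in> OP \<and> u \<noteq> 0 \<and> f = u * t powi e'"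
  then obtain t w where t: "MP = {t * x |x. x \<in> OP}" and w: "w \<in> OP_units" "f = w * t powi e'"
    unfolding OP_units_def by blast
  from t have "t \<in> MP" using subalg_one[OF subalg_OP] by (auto intro!: exI[of _ 1])
  then obtain a where a: "a \<in> OP" "t = unif * a" unfolding MP_eq by blast
  obtain b where b: "b \<in> OP" "unif = t * b" using t unif_in_MP by blast
  have "a * b = 1" using a b unif_neq_0 by (metis mult.assoc mult_cancel_left2)
  then have "inverse a = b" "a \<noteq> 0" by (auto intro: inverse_unique)
  with a b have "a \<in> OP_units" by (auto simp: OP_units_def)
  then have "w * a powi e' \<in> OP_units" using w by (intro OP_units_mult OP_units_powi)
  moreover have "f = (w * a powi e') * unif powi e'"
    unfolding w(2) a(2) by (simp add: power_int_mult_distrib mult_ac)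
  ultimately show "e' = e" using factor_unique u by metis
qed

lemma v_factor:
  assumes "f \<in> K" "f \<noteq> 0"
  obtains u where "u \<in> OP_units" "f = u * unif powi (v f)"
  using K_factor[OF assms] v_eqI by metis

lemma v_mult:
  assumes "f \<in> K" "f \<noteq> 0" "h \<in> K" "h \<noteq> 0"
  shows "v (f * h) = v f + v h"
proof -
  obtain u where u: "u \<in> OP_units" "f = u * unif powi (v f)" using v_factor assms by blast
  obtain w where w: "w \<in> OP_units" "h = w * unif powi (v h)" using v_factor assms by blast
  have "f * h = (u * w) * unif powi (v f + v h)"
    by (subst u(2), subst w(2)) (use unif_neq_0 in \<open>simp add: power_int_add mult_ac\<close>)
  from v_eqI[OF OP_units_mult[OF u(1) w(1)] this] show ?thesis .
qed

lemma v_unit: "u \<in> OP_units \<Longrightarrow> v u = 0"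
  by (rule v_eqI) auto

lemma v_const: "c \<noteq> 0 \<Longrightarrow> v (\<iota> c) = 0"
  using const_in_Max_id[OF P] subalg_const[OF subalg_OP] by (intro v_unit) (auto simp: OP_units_iff)

lemma v_one: "v 1 = 0"
  using v_unit OP_units_one by blast

lemma unif_in_K: "unif \<in> K"
  using Loc_subset_K[OF P unif_in_OP] .

lemma K_powi: "f \<in> K \<Longrightarrow> f powi e \<in> K"
  unfolding power_int_def by (auto intro: subalg_power[OF subalg_K] K_inverse)

lemma v_unif_powi: "v (unif powi e) = e"
  using OP_units_one by (intro v_eqI) auto

lemma OP_iff_v:
  assumes "f \<in> K" "f \<noteq> 0"
  shows "f \<in> OP \<longleftrightarrow> v f \<ge> 0"
proof
  assume "f \<in> OP"
  from OP_factor[OF this assms(2)] obtain u n where "u \<in> OP_units" "f = u * unif ^ n" by blast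
  then have "v f = int n" by (intro v_eqI) auto
  then show "v f \<ge> 0" by simp
next
  assume "v f \<ge> 0"
  moreover obtain u where u: "u \<in> OP_units" "f = u * unif powi (v f)" using v_factor assms by blast
  ultimately have "f = u * unif ^ nat (v f)" by (simp add: power_int_def)
  also have "\<dots> \<in> OP"
    using u by (intro subalg_mult subalg_power subalg_OP unif_in_OP) (auto simp: OP_units_def)
  finally show "f \<in> OP" .
qed

lemma MP_v_pos:
  assumes "f \<in> MP" "f \<noteq> 0"
  shows "v f > 0"
proof -
  from assms obtain x where x: "x \<in> OP" "f = unif * x" unfolding MP_eq by blast
  with assms have "x \<noteq> 0" "x \<in> K" using Loc_subset_K[OF P] by auto
  then have "v f = v unif + v x" unfolding x(2) using unif_in_K unif_neq_0 by (intro v_mult)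
  moreover have "v unif = 1" using v_unif_powi[of 1] by simp
  moreover have "v x \<ge> 0" using OP_iff_v x \<open>x \<noteq> 0\<close> \<open>x \<in> K\<close> by blast
  ultimately show ?thesis by simp
qed

lemma v_add:
  assumes "f \<in> K" "f \<noteq> 0" "h \<in> K" "h \<noteq> 0" "f + h \<noteq> 0"
  shows "v (f + h) \<ge> min (v f) (v h)"
proof -
  have *: "v (f + h) \<ge> v f" if fh: "f \<in> K" "f \<noteq> 0" "h \<in> K" "h \<noteq> 0" "f + h \<noteq> 0" "v f \<le> v h" for f h
  proof -
    define x where "x = h / f"
    have xK: "x \<in> K" "x \<noteq> 0" using fh by (auto simp: x_def intro: K_divide)
    have h: "h = f * x" using fh by (simp add: x_def)
    have "v h = v f + v x" unfolding h using fh xK by (intro v_mult)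
    with fh have "x \<in> OP" using OP_iff_v xK by simp
    then have y: "1 + x \<in> OP" by (intro subalg_add subalg_OP subalg_one)
    have eq: "f + h = f * (1 + x)" unfolding h by (simp add: algebra_simps)
    with fh have "1 + x \<noteq> 0" by auto
    with y have "v (f + h) = v f + v (1 + x)" "v (1 + x) \<ge> 0"
      unfolding eq using fh Loc_subset_K[OF P y] OP_iff_v by (auto intro: v_mult)
    then show ?thesis by simp
  qed
  show ?thesis
    using *[of f h] *[of h f] assms by (auto simp: add.commute min_def)
qed

text \<open>The quotient \<open>f / h\<close> has order zero, and subtracting its residue in k
  leaves an element of \<open>MP\<close>. The case of a zero difference is listed separately since
  \<open>v 0\<close> has no meaning.\<close>

lemma v_residue:
  assumes f: "f \<in> K" "f \<noteq> 0" and h: "h \<in> K" "h \<noteq> 0" and eq: "v f = v h"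
  shows "\<exists>c. f - \<iota> c * h = 0 \<or> v (f - \<iota> c * h) > v h"
proof -
  define x where "x = f / h"
  have xK: "x \<in> K" "x \<noteq> 0" using f h by (auto simp: x_def intro: K_divide)
  have fx: "f = x * h" using h by (simp add: x_def)
  have "v f = v x + v h" unfolding fx using h xK by (intro v_mult)
  with eq have "x \<in> OP" using OP_iff_v xK by simp
  from Loc_residue[OF P this] obtain c where c: "x - \<iota> c \<in> MP" by blast
  have e: "f - \<iota> c * h = (x - \<iota> c) * h" unfolding fx by (simp add: algebra_simps)
  show ?thesis
  proof (cases "x = \<iota> c")
    case False
    then have "v (x - \<iota> c) > 0" using MP_v_pos[OF c] by simp
    moreover have "v ((x - \<iota> c) * h) = v (x - \<iota> c) + v h"
      using False h xK by (intro v_mult subalg_diff subalg_K subalg_const) auto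
    ultimately have "v (f - \<iota> c * h) > v h" unfolding e by simp
    then show ?thesis by blast
  next
    case True
    then have "f - \<iota> c * h = 0" using e by simp
    then show ?thesis by blast
  qed
qed

end

section \<open>Everywhere regular functions are constant\<close>

context field_embedding
begin

text \<open>The degree bound is part of the notion because the argument in
  \<open>not_in_both_adjoin\<close> descends on it.\<close>

definition polys_upto :: "'a set \<Rightarrow> 'a \<Rightarrow> nat \<Rightarrow> 'a set" where
  "polys_upto A y n = {(\<Sum>i\<le>n. a i * y ^ i) | a. \<forall>i. a i \<in> A}"

lemma polys_upto_add:
  assumes "subalg A" "u \<in> polys_upto A y n" "w \<in> polys_upto A y n"
  shows "u + w \<in> polys_upto A y n"
proof -
  from assms obtain a b where "u = (\<Sum>i\<le>n. a i * y ^ i)" "\<forall>i. a i \<in> A"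
    "w = (\<Sum>i\<le>n. b i * y ^ i)" "\<forall>i. b i \<in> A" unfolding polys_upto_def by blast
  then show ?thesis
    unfolding polys_upto_def using subalg_add[OF assms(1)]
    by (auto intro!: exI[of _ "\<lambda>i. a i + b i"] simp: sum.distrib algebra_simps)
qed

lemma polys_upto_mult:
  assumes "subalg A" "c \<in> A" "u \<in> polys_upto A y n"
  shows "c * u \<in> polys_upto A y n"
proof -
  from assms obtain a where "u = (\<Sum>i\<le>n. a i * y ^ i)" "\<forall>i. a i \<in> A"
    unfolding polys_upto_def by blast
  then show ?thesis
    unfolding polys_upto_def using subalg_mult[OF assms(1,2)]
    by (auto intro!: exI[of _ "\<lambda>i. c * a i"] simp: sum_distrib_left mult.assoc)
qed

lemma polys_upto_power:
  assumes "subalg A" "k \<le> n"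
  shows "y ^ k \<in> polys_upto A y n"
proof -
  have "(\<Sum>i\<le>n. (if i = k then 1 else 0) * y ^ i) = (\<Sum>i\<le>n. if i = k then y ^ i else 0)"
    by (rule sum.cong) auto
  also have "\<dots> = y ^ k" using assms by simp
  finally show ?thesis
    unfolding polys_upto_def using subalg_one[OF assms(1)] subalg_zero[OF assms(1)]
    by (auto intro!: exI[of _ "\<lambda>i. if i = k then 1 else 0"])
qed

lemma polys_upto_zero:
  assumes "subalg A"
  shows "0 \<in> polys_upto A y n"
  using polys_upto_mult[OF assms subalg_zero polys_upto_power, OF assms assms le0] by simp

lemma polys_upto_const:
  assumes "subalg A" "c \<in> A"
  shows "c \<in> polys_upto A y n"
  using polys_upto_mult[OF assms polys_upto_power[OF assms(1) le0]] by simp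

lemma polys_upto_sum:
  assumes "subalg A" "\<And>i. i \<in> I \<Longrightarrow> h i \<in> polys_upto A y n"
  shows "(\<Sum>i\<in>I. h i) \<in> polys_upto A y n"
  using assms(2)
  by (induction I rule: infinite_finite_induct)
    (simp_all add: polys_upto_add[OF assms(1)] polys_upto_zero[OF assms(1)])

lemma polys_upto_subset:
  assumes "subalg A" "subalg B" "A \<subseteq> B" "y \<in> B"
  shows "polys_upto A y n \<subseteq> B"
  unfolding polys_upto_def using assms(3)
  by (auto intro!: subalg_sum[OF assms(2)] subalg_mult[OF assms(2)] subalg_power[OF assms(2)] assms(4))

definition adjoin :: "'a set \<Rightarrow> 'a \<Rightarrow> 'a set" where
  "adjoin A y = (\<Union>n. polys_upto A y n)"

lemma polys_upto_mono:
  assumes "subalg A" "n \<le> m"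
  shows "polys_upto A y n \<subseteq> polys_upto A y m"
proof
  fix u assume "u \<in> polys_upto A y n"
  then obtain a where "u = (\<Sum>i\<le>n. a i * y ^ i)" "\<forall>i. a i \<in> A"
    unfolding polys_upto_def by blast
  then show "u \<in> polys_upto A y m"
    using assms by (auto intro!: polys_upto_sum polys_upto_mult polys_upto_power)
qed

lemma subalg_adjoin:
  assumes A: "subalg A"
  shows "subalg (adjoin A y)"
  unfolding subalg_def
proof (intro conjI ballI subsetI)
  fix u assume "u \<in> range \<iota>"
  then show "u \<in> adjoin A y"
    using polys_upto_const[OF A subalg_const[OF A]] by (auto simp: adjoin_def)
next
  fix u w assume "u \<in> adjoin A y" "w \<in> adjoin A y"
  then obtain n m where nm: "u \<in> polys_upto A y n" "w \<in> polys_upto A y m"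
    by (auto simp: adjoin_def)
  then have "u + w \<in> polys_upto A y (max n m)"
    using polys_upto_mono[OF A, of n "max n m" y] polys_upto_mono[OF A, of m "max n m" y]
    by (intro polys_upto_add[OF A]) auto
  then show "u + w \<in> adjoin A y" by (auto simp: adjoin_def)
  from nm obtain a b where ab: "u = (\<Sum>i\<le>n. a i * y ^ i)" "\<forall>i. a i \<in> A"
    "w = (\<Sum>i\<le>m. b i * y ^ i)" "\<forall>i. b i \<in> A" unfolding polys_upto_def by blast
  have "u * w = (\<Sum>i\<le>n. \<Sum>j\<le>m. (a i * b j) * y ^ (i + j))"
    by (simp add: ab sum_product power_add mult_ac)
  also have "\<dots> \<in> polys_upto A y (n + m)"
  proof (intro polys_upto_sum[OF A])
    fix i j assume ij: "i \<in> {..n}" "j \<in> {..m}"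
    show "(a i * b j) * y ^ (i + j) \<in> polys_upto A y (n + m)"
      using ab ij by (intro polys_upto_mult[OF A subalg_mult[OF A]] polys_upto_power[OF A]) auto
  qed
  finally show "u * w \<in> adjoin A y" by (auto simp: adjoin_def)
qed

text \<open>
  The key step in the construction of valuation rings: \<open>f\<close> cannot become a polynomial over \<open>A\<close>
  both in \<open>y\<close> and in \<open>1 / y\<close>, because \<open>1 / f \<in> A\<close> allows one to lower the larger degree.
\<close>

lemma not_in_both_adjoin:
  assumes A: "subalg A" and x: "x \<in> A" "x * f = 1" and f: "f \<notin> A"
    and "y \<noteq> 0" "f \<in> polys_upto A y n" "f \<in> polys_upto A (inverse y) m"
  shows False
  using assms(5-)
proof (induction "n + m" arbitrary: y n m rule: less_induct)
  case less
  \<comment> \<open>Stated for arbitrary \<open>y\<close>, \<open>n\<close> and \<open>m\<close>, so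
    that exchanging \<open>y\<close> with its inverse also covers \<open>n < m\<close>.\<close>
  have step: False
    if y: "y \<noteq> 0" and n: "f \<in> polys_upto A y n" and m: "f \<in> polys_upto A (inverse y) m"
      and "m \<le> n" and IH: "\<And>n'. n' < n \<Longrightarrow> f \<notin> polys_upto A y n'" for y n m
  proof (cases n)
    case 0
    with n f show False by (auto simp: polys_upto_def)
  next
    case (Suc n')
    from n obtain a where a: "f = (\<Sum>i\<le>n. a i * y ^ i)" "\<And>i. a i \<in> A" unfolding polys_upto_def by blast
    from m obtain b where b: "f = (\<Sum>j\<le>m. b j * inverse y ^ j)" "\<And>j. b j \<in> A" unfolding polys_upto_def by blast
    define s where "s = (\<Sum>i\<le>n'. a i * y ^ i)"
    have fs: "f = s + a n * y ^ n" by (simp add: a(1) s_def Suc)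
    define r where "r = (\<Sum>j\<in>{1..m}. (x * a n * b j) * y ^ (n - j))"
    have "x * a n * y ^ n * f = (\<Sum>j\<le>m. (x * a n * b j) * y ^ (n - j))"
      unfolding b(1) sum_distrib_left
    proof (rule sum.cong)
      fix j assume "j \<in> {..m}"
      then have "y ^ (n - j) = y ^ n * inverse y ^ j"
        using y \<open>m \<le> n\<close> by (simp add: power_diff power_inverse field_simps)
      then show "x * a n * y ^ n * (b j * inverse y ^ j) = (x * a n * b j) * y ^ (n - j)" by simp
    qed simp
    also have "{..m} = insert 0 {1..m}" by auto
    also have "(\<Sum>j\<in>insert 0 {1..m}. (x * a n * b j) * y ^ (n - j)) = x * a n * b 0 * y ^ n + r"
      by (simp add: r_def)
    finally have "x * f * (a n * y ^ n) = x * a n * b 0 * y ^ n + r" by (simp add: mult_ac)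
    then have an: "a n * y ^ n = x * a n * b 0 * y ^ n + r" by (simp add: x(2))
    \<comment> \<open>Since \<open>x\<close> is the inverse of \<open>f\<close>, the difference
      \<open>f - b 0\<close> equals \<open>(1 - x * b 0) * f\<close>. By \<open>an\<close> this
      factor turns the leading term \<open>a n * y ^ n\<close> into \<open>r\<close>, where only
      powers of \<open>y\<close> below \<open>n\<close> occur; thus \<open>f\<close> has an
      expression of degree at most \<open>n'\<close>.\<close>
    have "f - b 0 = f - b 0 * (x * f)" by (simp add: x(2))
    also have "\<dots> = s + a n * y ^ n - x * b 0 * s - x * b 0 * (a n * y ^ n)"
      by (subst (1 2) fs) (simp add: algebra_simps)
    also have "\<dots> = s + (a n * y ^ n - x * b 0 * (a n * y ^ n)) - x * b 0 * s"
      by (simp add: algebra_simps)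
    also have "a n * y ^ n - x * b 0 * (a n * y ^ n) = r"
      by (subst (1) an) (simp add: algebra_simps)
    finally have "f = b 0 + (1 - x * b 0) * s + r" by (simp add: algebra_simps)
    also have "\<dots> \<in> polys_upto A y n'"
    proof (intro polys_upto_add[OF A])
      show "b 0 \<in> polys_upto A y n'" by (rule polys_upto_const[OF A b(2)])
      show "(1 - x * b 0) * s \<in> polys_upto A y n'"
        unfolding s_def using a(2)
        by (intro polys_upto_mult A subalg_diff subalg_one subalg_mult x b) (auto simp: polys_upto_def)
      show "r \<in> polys_upto A y n'"
        unfolding r_def
        by (intro polys_upto_sum polys_upto_mult A subalg_mult x a b polys_upto_power) (auto simp: Suc)
    qed
    finally show False using IH[of n'] Suc by simp
  qed
  show ?case
  proof (cases "m \<le> n")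
    case True
    have "f \<notin> polys_upto A y n'" if "n' < n" for n'
      using less.hyps[of n' m y] less.prems that by auto
    then show ?thesis by (rule step[OF less.prems True])
  next
    case False
    have "f \<notin> polys_upto A (inverse y) m'" if "m' < m" for m'
      using less.hyps[of n m' y] less.prems that by auto
    then show ?thesis
      by (rule step[of "inverse y" m n, rotated -1]) (use less.prems False in auto)
  qed
qed

text \<open>Zorn's lemma gives a subalgebra of \<open>L\<close> maximal among those that contain
  \<open>x\<close> but not \<open>f\<close>; the last hypothesis makes this family nonempty. If
  neither \<open>y\<close> nor its inverse belonged to it, adjoining either one would bring in
  \<open>f\<close>, against \<open>not_in_both_adjoin\<close>.\<close>

lemma valuation_ring_exists:
  assumes L: "subalg L" "\<And>y. y \<in> L \<Longrightarrow> inverse y \<in> L"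
    and x: "x \<in> L" "x * f = 1" and f: "f \<notin> adjoin (range \<iota>) x"
  shows "\<exists>A\<subseteq>L. subalg A \<and> x \<in> A \<and> f \<notin> A \<and> (\<forall>y\<in>L. y \<in> A \<or> inverse y \<in> A)"
proof -
  define \<A> where "\<A> = {A. subalg A \<and> A \<subseteq> L \<and> x \<in> A \<and> f \<notin> A}"
  have k: "subalg (range \<iota>)"
    unfolding subalg_def by (auto simp flip: hom_add hom_mult)
  have xin: "y \<in> adjoin A y" if "subalg A" for A y
    using polys_upto_power[OF that, of 1 1 y] by (auto simp: adjoin_def)
  have sub: "adjoin A y \<subseteq> L" if "subalg A" "A \<subseteq> L" "y \<in> L" for A y
    using polys_upto_subset[OF that(1) L(1) that(2,3)] by (auto simp: adjoin_def)
  have "adjoin (range \<iota>) x \<in> \<A>"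
    unfolding \<A>_def using f x(1) sub[OF k] xin[OF k] subalg_adjoin[OF k] subalg_const[OF L(1)] by auto
  then have "\<A> \<noteq> {}" by auto
  moreover have "\<Union>\<C> \<in> \<A>" if "\<C> \<noteq> {}" "subset.chain \<A> \<C>" for \<C>
  proof -
    have C: "\<And>A. A \<in> \<C> \<Longrightarrow> subalg A \<and> A \<subseteq> L \<and> x \<in> A \<and> f \<notin> A"
      and tot: "\<And>A B. A \<in> \<C> \<Longrightarrow> B \<in> \<C> \<Longrightarrow> A \<subseteq> B \<or> B \<subseteq> A"
      using that(2) by (auto simp: subset_chain_def \<A>_def)
    obtain A0 where "A0 \<in> \<C>" using \<open>\<C> \<noteq> {}\<close> by blast
    have "subalg (\<Union>\<C>)"
      unfolding subalg_def
    proof (intro conjI ballI subsetI)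
      fix u assume "u \<in> range \<iota>"
      then show "u \<in> \<Union>\<C>" using C[OF \<open>A0 \<in> \<C>\<close>] \<open>A0 \<in> \<C>\<close> by (auto intro: subalg_const)
    next
      fix u w assume "u \<in> \<Union>\<C>" "w \<in> \<Union>\<C>"
      then obtain B where B: "B \<in> \<C>" "u \<in> B" "w \<in> B" using tot by blast
      with C[OF B(1)] show "u + w \<in> \<Union>\<C>" "u * w \<in> \<Union>\<C>"
        using subalg_add subalg_mult by blast+
    qed
    then show ?thesis unfolding \<A>_def using C \<open>A0 \<in> \<C>\<close> by blast
  qed
  ultimately obtain A where A: "A \<in> \<A>" and max: "\<And>B. B \<in> \<A> \<Longrightarrow> A \<subseteq> B \<Longrightarrow> B = A"
    using subset_Zorn_nonempty[of \<A>] by blast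
  have sA: "subalg A" "A \<subseteq> L" "x \<in> A" "f \<notin> A" using A by (auto simp: \<A>_def)
  have AA: "A \<subseteq> adjoin A y" for y using polys_upto_const[OF sA(1)] by (auto simp: adjoin_def)
  have "y \<in> A \<or> inverse y \<in> A" if y: "y \<in> L" for y
  proof (rule ccontr)
    assume not: "\<not> (y \<in> A \<or> inverse y \<in> A)"
    have "f \<in> adjoin A z" if "z \<in> L" "z \<notin> A" for z
    proof (rule ccontr)
      assume "f \<notin> adjoin A z"
      then have "adjoin A z \<in> \<A>"
        unfolding \<A>_def using sub[OF sA(1,2) that(1)] subalg_adjoin[OF sA(1)] AA sA(3) by auto
      from max[OF this AA] xin[OF sA(1), of z] that(2) show False by blast
    qed
    then obtain n m where "f \<in> polys_upto A y n" "f \<in> polys_upto A (inverse y) m"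
      using not y L(2) unfolding adjoin_def by blast
    moreover have "y \<noteq> 0" using not subalg_zero[OF sA(1)] by auto
    ultimately show False using not_in_both_adjoin[OF sA(1,3) x(2) sA(4)] by blast
  qed
  with sA show ?thesis by blast
qed

text \<open>As \<open>inverse 0 = 0\<close>, zero has to be named as a nonunit explicitly.\<close>

definition nonunits :: "'a set \<Rightarrow> 'a set" where
  "nonunits A = {a \<in> A. a = 0 \<or> inverse a \<notin> A}"

text \<open>If \<open>b\<close> divides \<open>a\<close>, then \<open>a + b\<close> is a multiple of
  \<open>b\<close>, so an inverse of the sum would yield an inverse of \<open>b\<close>. The
  assumption \<open>val\<close> says that one of any two elements divides the other.\<close>

lemma ideal_of_nonunits:
  assumes A: "subalg A" and val: "\<And>a b. a \<in> A \<Longrightarrow> b \<in> A \<Longrightarrow> a / b \<in> A \<or> b / a \<in> A"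
  shows "ideal_of A (nonunits A)"
  unfolding ideal_of_def
proof (intro conjI ballI)
  have *: "a + b \<in> nonunits A" if ab: "a \<in> nonunits A" "b \<in> nonunits A" "a / b \<in> A" for a b
  proof (cases "b = 0 \<or> a + b = 0")
    case True
    with ab show ?thesis using subalg_zero[OF A] by (auto simp: nonunits_def)
  next
    case False
    have "inverse (a + b) \<notin> A"
    proof
      assume "inverse (a + b) \<in> A"
      then have "(1 + a / b) * inverse (a + b) \<in> A"
        using ab by (intro subalg_mult[OF A] subalg_add[OF A] subalg_one[OF A])
      also have "(1 + a / b) * inverse (a + b) = inverse b"
        using False by (simp add: field_simps)
      finally show False using ab False by (auto simp: nonunits_def)
    qed
    then show ?thesis using ab by (auto simp: nonunits_def intro: subalg_add[OF A])
  qed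
  fix a b assume ab: "a \<in> nonunits A" "b \<in> nonunits A"
  then have "a / b \<in> A \<or> b / a \<in> A" by (intro val) (auto simp: nonunits_def)
  then show "a + b \<in> nonunits A" using *[OF ab] *[OF ab(2,1)] by (auto simp: add.commute)
next
  fix a m assume a: "a \<in> A" and m: "m \<in> nonunits A"
  show "a * m \<in> nonunits A"
  proof (cases "a * m = 0")
    case True
    then show ?thesis using subalg_zero[OF A] by (auto simp: nonunits_def)
  next
    case False
    have "inverse (a * m) \<notin> A"
    proof
      assume "inverse (a * m) \<in> A"
      from subalg_mult[OF A a this] have "a * inverse (a * m) \<in> A" .
      also have "a * inverse (a * m) = inverse m" using False by (simp add: field_simps)
      finally have "inverse m \<in> A" .
      with m False show False by (auto simp: nonunits_def)
    qed
    with a m show ?thesis by (auto simp: nonunits_def intro: subalg_mult[OF A])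
  qed
qed (use subalg_zero[OF A] in \<open>auto simp: nonunits_def\<close>)

lemma const_in_nonunits: "subalg A \<Longrightarrow> \<iota> r \<in> nonunits A \<Longrightarrow> r = 0"
  using subalg_const[of A "inverse r"] by (auto simp: nonunits_def hom_inverse hom_eq_0_iff)

end

context projective_curve
begin

text \<open>This is \<open>residue_if_algebraic\<close> for the ring \<open>K\<close> and its zero
  ideal: k is algebraically closed in its function field.\<close>

lemma constant_if_algebraic:
  assumes "x \<in> K" "c (j0::nat) \<noteq> 0" "j0 \<le> N" "(\<Sum>j\<le>N. \<iota> (c j) * x ^ j) = 0"
  shows "x \<in> range \<iota>"
proof -
  have "\<exists>r. x - \<iota> r \<in> {0}"
    by (rule residue_if_algebraic[where A = K and c = c and N = N and ?j0.0 = j0])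
      (use assms subalg_zero[OF subalg_K] in
        \<open>auto simp: ideal_of_def subalg_K intro: alg_closed_imp_poly_has_root\<close>)
  then show ?thesis by auto
qed

text \<open>
  A function without poles which is not constant would be outside some valuation ring \<open>A\<close> of the
  function field.  As in the valuative criterion of properness, \<open>A\<close> has a center on \<open>C\<close>, i.e. it
  contains the local ring of some point.
\<close>

lemma regular_everywhere_constant:
  assumes f: "f \<in> K" "\<And>Q. Q \<in> C \<Longrightarrow> f \<in> Loc Q"
  shows "f \<in> range \<iota>"
proof (rule ccontr)
  assume notconst: "f \<notin> range \<iota>"
  then have f0: "f \<noteq> 0" by (metis hom_zero rangeI)
  define x where "x = inverse f"
  have x: "x \<in> K" "x * f = 1" "x \<noteq> 0" using f f0 by (auto simp: x_def K_inverse)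
  have "f \<notin> adjoin (range \<iota>) x"
  proof
    assume "f \<in> adjoin (range \<iota>) x"
    then obtain n a where a: "f = (\<Sum>i\<le>n. a i * x ^ i)" "\<forall>i. a i \<in> range \<iota>"
      unfolding adjoin_def polys_upto_def by blast
    from a(2) have "\<forall>i. \<exists>b. a i = \<iota> b" by blast
    then obtain b where b: "\<And>i. a i = \<iota> (b i)" by metis
    \<comment> \<open>The coefficients of \<open>x * f - 1\<close> after \<open>f\<close> has been
      written as a polynomial in \<open>x\<close>; the constant coefficient \<open>- 1\<close> makes
      the relation nontrivial.\<close>
    define c where "c j = (case j of 0 \<Rightarrow> - 1 | Suc i \<Rightarrow> b i)" for j
    have "(\<Sum>j\<le>Suc n. \<iota> (c j) * x ^ j) = - 1 + x * (\<Sum>i\<le>n. \<iota> (b i) * x ^ i)"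
      by (subst sum.atMost_Suc_shift) (simp add: c_def hom_uminus sum_distrib_left mult_ac)
    also have "(\<Sum>i\<le>n. \<iota> (b i) * x ^ i) = f" by (simp add: a(1) b)
    finally have "(\<Sum>j\<le>Suc n. \<iota> (c j) * x ^ j) = 0" using x by simp
    from constant_if_algebraic[OF x(1) _ _ this, of 0] have "x \<in> range \<iota>" by (simp add: c_def)
    then obtain r where "x = \<iota> r" by blast
    moreover have "f = inverse x" by (simp add: x_def)
    ultimately have "f = \<iota> (inverse r)" by (simp add: hom_inverse)
    with notconst show False by blast
  qed
  from valuation_ring_exists[OF subalg_K K_inverse x(1,2) this] obtain A where
    A: "A \<subseteq> K" "subalg A" "x \<in> A" "f \<notin> A" and val: "\<And>y. y \<in> K \<Longrightarrow> y \<in> A \<or> inverse y \<in> A"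
    by blast
  define M where "M = nonunits A"
  have M: "ideal_of A M"
    unfolding M_def
  proof (rule ideal_of_nonunits[OF A(2)])
    fix a b assume "a \<in> A" "b \<in> A"
    then show "a / b \<in> A \<or> b / a \<in> A" using val[of "a / b"] A(1) K_divide by auto
  qed
  have one: "1 \<notin> M" using subalg_one[OF A(2)] by (auto simp: M_def nonunits_def)
  have unit: "inverse a \<in> A" if "a \<in> A" "a \<notin> M" for a
    using that by (auto simp: M_def nonunits_def)
  have prime: "a \<in> M \<or> b \<in> M" if "a \<in> A" "b \<in> A" "a * b \<in> M" for a b
  proof (rule ccontr)
    assume n: "\<not> (a \<in> M \<or> b \<in> M)"
    then have "a \<noteq> 0" "b \<noteq> 0" using ideal_of_zero[OF M] by auto
    moreover from n have "inverse a * inverse b \<in> A" using unit that by (intro subalg_mult A) auto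
    ultimately show False using that(3) by (auto simp: M_def nonunits_def mult.commute)
  qed
  have xM: "x \<in> M" using A x f0 by (simp add: M_def nonunits_def x_def)
  \<comment> \<open>The residue field of \<open>A\<close> is k. In a relation between
    \<open>x\<close> and \<open>a\<close>, cancelling the lowest power of \<open>x\<close> leaves a
    nontrivial polynomial in \<open>a\<close> with value in \<open>M\<close>, because
    \<open>x \<in> M\<close>; such a polynomial splits over k.\<close>
  have res: "\<exists>r. a - \<iota> r \<in> M" if a: "a \<in> A" for a
  proof (cases "x = a")
    case True
    then show ?thesis using xM by (intro exI[of _ 0]) simp
  next
    case False
    from algebraic_relation[OF x(1) _ False] a A(1) obtain N c where
      c: "\<exists>i\<le>N. \<exists>j\<le>N. c i j \<noteq> 0"
      and rel: "(\<Sum>i\<le>N. \<Sum>j\<le>N. \<iota> (c i j) * (x ^ i * a ^ j)) = 0" by blast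
    define p where "p i = (\<Sum>j\<le>N. \<iota> (c i j) * a ^ j)" for i
    have "(\<Sum>i\<le>N. p i * x ^ i) = 0"
      using rel by (simp add: p_def sum_distrib_left mult_ac)
    moreover have p: "p i \<in> A" for i
      unfolding p_def by (intro subalg_sum subalg_mult subalg_power subalg_const A a)
    moreover have "\<exists>i0\<le>N. \<exists>r\<in>A. (\<exists>j\<le>N. c i0 j \<noteq> 0) \<and> (\<Sum>i\<le>N. p i * x ^ i) = x ^ i0 * (p i0 + x * r)"
      by (rule lowest_term[OF A(2,3) p c]) (auto simp: p_def)
    ultimately obtain i0 r where i0: "r \<in> A" "\<exists>j\<le>N. c i0 j \<noteq> 0" "p i0 + x * r = 0"
      using x(3) by auto
    have "p i0 = - r * x" using i0(3) by (simp add: eq_neg_iff_add_eq_0 mult.commute)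
    also have "\<dots> \<in> M" by (intro ideal_of_mult[OF M] subalg_uminus A i0 xM)
    finally have pM: "(\<Sum>j\<le>N. \<iota> (c i0 j) * a ^ j) \<in> M" by (simp add: p_def)
    from i0(2) obtain j0 where "j0 \<le> N" "c i0 j0 \<noteq> 0" by blast
    from residue_if_algebraic[OF alg_closed_imp_poly_has_root A(2) M one prime a this pM]
    show ?thesis by blast
  qed
  \<comment> \<open>Divisibility with respect to a valuation ring is total, so among finitely many
    nonzero coordinates one divides all the others. Dividing by it puts all affine coordinates into
    \<open>A\<close>.\<close>
  have "\<exists>i\<in>S. \<forall>j\<in>S. \<xi> j / \<xi> i \<in> A" if "finite S" "S \<noteq> {}" "\<And>i. i \<in> S \<Longrightarrow> \<xi> i \<noteq> 0" for S
    using that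
  proof (induction S rule: finite_ne_induct)
    case (singleton i)
    then show ?case using subalg_one[OF A(2)] by auto
  next
    case (insert k S)
    then obtain i where i: "i \<in> S" "\<And>j. j \<in> S \<Longrightarrow> \<xi> j / \<xi> i \<in> A" by auto
    have nz: "\<xi> i \<noteq> 0" "\<xi> k \<noteq> 0" using insert.prems i by auto
    from val[OF coordinate_ratio_in_K[OF nz(1), of k]] show ?case
    proof
      assume "\<xi> k / \<xi> i \<in> A"
      with i show ?case by auto
    next
      assume "inverse (\<xi> k / \<xi> i) \<in> A"
      then have ik: "\<xi> i / \<xi> k \<in> A" by (simp add: nz)
      have "\<xi> j / \<xi> k \<in> A" if "j \<in> S" for j
        using subalg_mult[OF A(2) i(2)[OF that] ik] nz by simp
      moreover have "\<xi> k / \<xi> k \<in> A" using nz subalg_one[OF A(2)] by simp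
      ultimately show ?case by auto
    qed
  qed
  note min = this
  have "\<exists>i\<in>{i. \<xi> i \<noteq> 0}. \<forall>j\<in>{i. \<xi> i \<noteq> 0}. \<xi> j / \<xi> i \<in> A"
  proof (rule min)
    show "{i. \<xi> i \<noteq> 0} \<noteq> {}" using some_coordinate_nonzero by blast
  qed (rule finite, blast)
  then obtain i where i: "\<xi> i \<noteq> 0" "\<And>j. \<xi> j \<noteq> 0 \<Longrightarrow> \<xi> j / \<xi> i \<in> A" by blast
  define y where "y j = \<xi> j / \<xi> i" for j
  have y: "y j \<in> A" for j using i(2)[of j] subalg_zero[OF A(2)] by (cases "\<xi> j = 0") (auto simp: y_def)
  obtain c where c: "\<And>j. y j - \<iota> (c j) \<in> M" using res[OF y] by metis
  have "\<iota> (1 - c i) \<in> M" using c[of i] i(1) by (simp add: y_def hom_diff)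
  then have ci: "c i = 1" using const_in_nonunits[OF A(2)] unfolding M_def by fastforce
  have Fy: "mp_eval \<iota> y F - \<iota> (mp_eval (\<lambda>c. c) c F) \<in> M" for F
    by (rule residue_mp_eval[OF A(2) M y c])
  have EF: "E F = \<xi> i ^ e * mp_eval \<iota> y F" if "mp_homogeneous e F" for e F
    using E_dehomogenize[OF that i(1)] by (simp add: y_def[abs_def])
  \<comment> \<open>The center of \<open>A\<close>: its coordinates are the residues of the affine
    coordinates, and \<open>c i = 1\<close> ensures that they are not all zero.\<close>
  define Q where "Q = {(\<lambda>j. s * c j) | s. s \<noteq> 0}"
  have "proj_closed C" using variety by (simp add: projective_variety_def)
  then obtain T where "\<forall>F\<in>T. \<exists>e. mp_homogeneous e F"
    "C = {Q \<in> proj_space. \<forall>F\<in>T. vanishes_at F Q}"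
    unfolding proj_closed_def by (elim exE conjE)
  then have T: "\<And>F. F \<in> T \<Longrightarrow> \<exists>e. mp_homogeneous e F"
    "C = {Q \<in> proj_space. \<forall>F\<in>T. vanishes_at F Q}"
    by simp_all
  have "Q \<in> C"
    unfolding T(2)
  proof (intro CollectI conjI ballI)
    have "\<exists>j. c j \<noteq> 0" using ci by (metis zero_neq_one)
    then show "Q \<in> proj_space" unfolding proj_space_def Q_def by blast
    fix F assume F: "F \<in> T"
    then obtain e where e: "mp_homogeneous e F" using T(1) by blast
    have "\<forall>R\<in>C. vanishes_at F R" using F unfolding T(2) by simp
    then have "E F = 0" using generic e unfolding generic_point_def by simp
    then have "mp_eval \<iota> y F = 0" using EF[OF e] i(1) by simp
    with ideal_of_uminus[OF A(2) M Fy[of F]] have "\<iota> (mp_eval (\<lambda>c. c) c F) \<in> M" by simp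
    then have "mp_eval (\<lambda>c. c) c F = 0" using const_in_nonunits[OF A(2)] by (simp add: M_def)
    then show "vanishes_at F Q" using vanishes_at_multiples[OF Q_def e] by simp
  qed
  from f(2)[OF this] obtain F G e where FG: "f = E F / E G" "\<not> vanishes_at G Q"
    "mp_homogeneous e F" "mp_homogeneous e G" unfolding local_ring_def by blast
  have Gc: "mp_eval (\<lambda>c. c) c G \<noteq> 0" using FG(2) vanishes_at_multiples[OF Q_def FG(4)] by simp
  \<comment> \<open>The denominator does not vanish at the center, so it is a unit of
    \<open>A\<close>; this forces \<open>f\<close> into \<open>A\<close>.\<close>
  have "mp_eval \<iota> y G \<notin> M"
  proof
    assume "mp_eval \<iota> y G \<in> M"
    from ideal_of_diff[OF A(2) M this Fy[of G]] have "\<iota> (mp_eval (\<lambda>c. c) c G) \<in> M" by simp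
    with Gc show False using const_in_nonunits[OF A(2)] by (simp add: M_def)
  qed
  then have "mp_eval \<iota> y F * inverse (mp_eval \<iota> y G) \<in> A"
    by (intro subalg_mult[OF A(2)] unit subalg_mp_eval[OF A(2)] y)
  also have "mp_eval \<iota> y F * inverse (mp_eval \<iota> y G) = f"
    unfolding FG(1) EF[OF FG(3)] EF[OF FG(4)] using i(1) by (simp add: field_simps)
  finally show False using A(4) by simp
qed

end

section \<open>The number of gaps\<close>

lemma sum_fun_app: "(\<Sum>i\<in>I. h i) x = (\<Sum>i\<in>I. h i x)"
  for h :: "'i \<Rightarrow> 'b \<Rightarrow> 'c::comm_monoid_add"
  by (induction I rule: infinite_finite_induct) auto

context smooth_point
begin

abbreviation "RA \<equiv> regular_away_from \<iota> \<xi> C P"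
abbreviation "H \<equiv> weierstrass_semigroup \<iota> \<xi> C P"

lemma RA_subset_K: "f \<in> RA \<Longrightarrow> f \<in> K"
  by (simp add: regular_away_from_def)

lemma RA_Loc: "f \<in> RA \<Longrightarrow> Q \<in> C \<Longrightarrow> Q \<noteq> P \<Longrightarrow> f \<in> Loc Q"
  by (simp add: regular_away_from_def)

lemma RA_I: "f \<in> K \<Longrightarrow> (\<And>Q. Q \<in> C \<Longrightarrow> Q \<noteq> P \<Longrightarrow> f \<in> Loc Q) \<Longrightarrow> f \<in> RA"
  by (simp add: regular_away_from_def)

lemma subalg_RA: "subalg RA"
  unfolding subalg_def
proof (intro conjI ballI subsetI)
  fix x assume "x \<in> range \<iota>"
  then show "x \<in> RA"
    by (auto intro!: RA_I subalg_const[OF subalg_K] subalg_const[OF subalg_Loc])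
next
  fix x y assume xy: "x \<in> RA" "y \<in> RA"
  show "x + y \<in> RA"
    by (rule RA_I)
      (simp_all add: xy RA_subset_K RA_Loc subalg_add[OF subalg_K] subalg_add[OF subalg_Loc])
  show "x * y \<in> RA"
    by (rule RA_I)
      (simp_all add: xy RA_subset_K RA_Loc subalg_mult[OF subalg_K] subalg_mult[OF subalg_Loc])
qed

lemma RA_OP_constant:
  assumes "f \<in> RA" "f \<in> OP"
  shows "f \<in> range \<iota>"
  using assms RA_Loc[OF assms(1)] by (intro regular_everywhere_constant RA_subset_K) metis+

lemma v_uminus: "f \<in> K \<Longrightarrow> f \<noteq> 0 \<Longrightarrow> v (- f) = v f"
proof -
  assume f: "f \<in> K" "f \<noteq> 0"
  have "v (\<iota> (- 1) * f) = v (\<iota> (- 1)) + v f"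
    using f by (intro v_mult subalg_const[OF subalg_K]) (auto simp: hom_eq_0_iff)
  then show ?thesis using v_const[of "- 1"] by (simp add: hom_uminus)
qed

lemma v_const_mult: "f \<in> K \<Longrightarrow> f \<noteq> 0 \<Longrightarrow> c \<noteq> 0 \<Longrightarrow> v (\<iota> c * f) = v f"
  using v_mult[of "\<iota> c" f] by (simp add: v_const subalg_const[OF subalg_K] hom_eq_0_iff)

lemma v_add_eq_min:
  assumes f: "f \<in> K" "f \<noteq> 0" and h: "h \<in> K" "h \<noteq> 0" and ne: "v f \<noteq> v h"
  shows "f + h \<noteq> 0 \<and> v (f + h) = min (v f) (v h)"
proof -
  have *: "f + h \<noteq> 0 \<and> v (f + h) = v f"
    if f: "f \<in> K" "f \<noteq> 0" and h: "h \<in> K" "h \<noteq> 0" and less: "v f < v h" for f h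
  proof -
    have nz: "f + h \<noteq> 0"
    proof
      assume "f + h = 0"
      then have "f = - h" by (simp add: eq_neg_iff_add_eq_0)
      with v_uminus[OF h] less show False by simp
    qed
    have "v ((f + h) + - h) \<ge> min (v (f + h)) (v (- h))"
      using f h nz by (intro v_add subalg_add[OF subalg_K] subalg_uminus[OF subalg_K]) auto
    then have "v f \<ge> min (v (f + h)) (v h)" by (simp add: v_uminus[OF h])
    moreover have "v (f + h) \<ge> min (v f) (v h)" using v_add[OF f h nz] .
    ultimately show ?thesis using nz less by auto
  qed
  show ?thesis
    using *[OF f h] *[OF h f] ne by (cases "v f < v h") (auto simp: add.commute min_def)
qed

text \<open>Terms of different orders cannot cancel: the lowest order among those with nonzero
  coefficient survives.\<close>

lemma v_sum_distinct:
  assumes "finite I" "\<And>i. i \<in> I \<Longrightarrow> h i \<in> K \<and> h i \<noteq> 0" "inj_on (\<lambda>i. v (h i)) I" "\<exists>i\<in>I. c i \<noteq> 0"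
  shows "(\<Sum>i\<in>I. \<iota> (c i) * h i) \<noteq> 0 \<and> (\<exists>i\<in>I. v (\<Sum>i\<in>I. \<iota> (c i) * h i) = v (h i))"
  using assms
proof (induction I rule: finite_induct)
  case (insert k I)
  define s where "s = (\<Sum>i\<in>I. \<iota> (c i) * h i)"
  have sK: "s \<in> K"
    unfolding s_def using insert.prems(1)
    by (intro subalg_sum[OF subalg_K] subalg_mult[OF subalg_K] subalg_const[OF subalg_K]) auto
  have eq: "(\<Sum>i\<in>insert k I. \<iota> (c i) * h i) = \<iota> (c k) * h k + s"
    using insert.hyps by (simp add: s_def)
  have k: "h k \<in> K" "h k \<noteq> 0" using insert.prems(1) by auto
  have IH: "(\<exists>i\<in>I. c i \<noteq> 0) \<Longrightarrow> s \<noteq> 0 \<and> (\<exists>i\<in>I. v s = v (h i))"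
    using insert.IH insert.prems unfolding s_def by (auto simp: inj_on_def)
  show ?case
  proof (cases "\<exists>i\<in>I. c i \<noteq> 0")
    case False
    then have "s = 0" by (simp add: s_def)
    moreover from False have "c k \<noteq> 0" using insert.prems by auto
    ultimately show ?thesis using v_const_mult[OF k] k by (auto simp: eq hom_eq_0_iff)
  next
    case True
    then obtain i where i: "s \<noteq> 0" "i \<in> I" "v s = v (h i)" using IH by blast
    show ?thesis
    proof (cases "c k = 0")
      case True
      with i show ?thesis by (auto simp: eq)
    next
      case False
      have "v s \<noteq> v (\<iota> (c k) * h k)"
        using insert.prems(2) insert.hyps(2) i v_const_mult[OF k False] by (auto simp: inj_on_def)
      then have "\<iota> (c k) * h k + s \<noteq> 0 \<and> v (\<iota> (c k) * h k + s) = min (v (\<iota> (c k) * h k)) (v s)"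
        using False k i sK
        by (intro v_add_eq_min subalg_mult[OF subalg_K] subalg_const[OF subalg_K]) (auto simp: hom_eq_0_iff)
      then show ?thesis
        unfolding eq using i v_const_mult[OF k False] by (auto simp: min_def)
    qed
  qed
qed auto

section \<open>The Weierstrass semigroup\<close>

lemma H_iff: "h \<in> H \<longleftrightarrow> (\<exists>f\<in>RA. f \<noteq> 0 \<and> v f = - int h)"
proof -
  have "int h = - v f \<longleftrightarrow> v f = - int h" for f by linarith
  then show ?thesis by (simp add: weierstrass_semigroup_def)
qed

lemma zero_in_H: "0 \<in> H"
  unfolding H_iff by (rule bexI[of _ 1]) (simp_all add: v_one subalg_one[OF subalg_RA])

definition \<phi> :: "nat \<Rightarrow> 'K" where
  "\<phi> h = (SOME f. f \<in> RA \<and> f \<noteq> 0 \<and> v f = - int h)"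

lemma \<phi>:
  assumes "h \<in> H"
  shows "\<phi> h \<in> RA" "\<phi> h \<noteq> 0" "v (\<phi> h) = - int h"
proof -
  have "\<exists>f. f \<in> RA \<and> f \<noteq> 0 \<and> v f = - int h" using assms unfolding H_iff by blast
  from someI_ex[OF this] show "\<phi> h \<in> RA" "\<phi> h \<noteq> 0" "v (\<phi> h) = - int h"
    unfolding \<phi>_def by simp_all
qed

lemma H_add:
  assumes "h \<in> H" "h' \<in> H"
  shows "h + h' \<in> H"
  unfolding H_iff
proof (intro bexI conjI)
  show "v (\<phi> h * \<phi> h') = - int (h + h')"
    using \<phi>[OF assms(1)] \<phi>[OF assms(2)] by (subst v_mult) (auto intro: RA_subset_K)
qed (use \<phi>[OF assms(1)] \<phi>[OF assms(2)] in \<open>auto intro: subalg_mult[OF subalg_RA]\<close>)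

subsection \<open>Adeles\<close>

abbreviation "ad \<equiv> adeles \<iota> \<xi> C"
abbreviation (input) "scale_ad \<equiv> \<lambda>c a Q. \<iota> c * a Q"

definition adW :: "(('n, 'k) proj_point \<Rightarrow> 'K) set" where
  "adW = {a + p | a p. a \<in> integral_adeles \<iota> \<xi> C \<and> p \<in> principal_adeles \<iota> \<xi> C}"

lemma adW_iff:
  "w \<in> adW \<longleftrightarrow> (\<forall>Q. Q \<notin> C \<longrightarrow> w Q = 0) \<and> (\<exists>f\<in>K. \<forall>Q\<in>C. w Q - f \<in> Loc Q)" (is "_ \<longleftrightarrow> ?R")
proof
  assume "w \<in> adW"
  then obtain a f where a: "a \<in> integral_adeles \<iota> \<xi> C" and f: "f \<in> K"
    "w = a + (\<lambda>Q. if Q \<in> C then f else 0)"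
    unfolding adW_def principal_adeles_def by blast
  then show ?R by (auto simp: integral_adeles_def adeles_def intro!: bexI[of _ f])
next
  assume R: ?R
  then obtain f where f: "f \<in> K" "\<And>Q. Q \<in> C \<Longrightarrow> w Q - f \<in> Loc Q" by blast
  define a where "a Q = (if Q \<in> C then w Q - f else 0)" for Q
  have "{Q \<in> C. a Q \<notin> Loc Q} = {}" using f by (auto simp: a_def)
  then have "a \<in> integral_adeles \<iota> \<xi> C"
    using f Loc_subset_K unfolding integral_adeles_def adeles_def by (auto simp: a_def)
  moreover have "w = a + (\<lambda>Q. if Q \<in> C then f else 0)" using R by (auto simp: a_def fun_eq_iff)
  ultimately show "w \<in> adW" unfolding adW_def principal_adeles_def using f(1) by blast
qed

lemma subspace_adW: "module.subspace scale_ad adW"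
proof -
  interpret V: vector_space scale_ad by (rule vector_space_fun_mult)
  show ?thesis
  proof (rule V.subspaceI)
    show "0 \<in> adW"
      unfolding adW_iff by (auto intro!: bexI[of _ 0] subalg_zero[OF subalg_K] subalg_zero[OF subalg_Loc])
  next
    fix x y assume "x \<in> adW" "y \<in> adW"
    then obtain f f' where x: "\<forall>Q. Q \<notin> C \<longrightarrow> x Q = 0" "f \<in> K" "\<forall>Q\<in>C. x Q - f \<in> Loc Q"
      and y: "\<forall>Q. Q \<notin> C \<longrightarrow> y Q = 0" "f' \<in> K" "\<forall>Q\<in>C. y Q - f' \<in> Loc Q"
      unfolding adW_iff by blast
    have "(x + y) Q - (f + f') \<in> Loc Q" if "Q \<in> C" for Q
    proof -
      have "(x Q - f) + (y Q - f') \<in> Loc Q" using x y that by (intro subalg_add[OF subalg_Loc]) auto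
      then show ?thesis by (simp add: algebra_simps)
    qed
    then show "x + y \<in> adW"
      unfolding adW_iff using x y subalg_add[OF subalg_K x(2) y(2)] by auto
  next
    fix c x assume "x \<in> adW"
    then obtain f where x: "\<forall>Q. Q \<notin> C \<longrightarrow> x Q = 0" "f \<in> K" "\<forall>Q\<in>C. x Q - f \<in> Loc Q"
      unfolding adW_iff by blast
    have "\<iota> c * x Q - \<iota> c * f \<in> Loc Q" if "Q \<in> C" for Q
      unfolding right_diff_distrib[symmetric]
      using x that by (intro subalg_mult[OF subalg_Loc] subalg_const[OF subalg_Loc]) auto
    moreover have "\<iota> c * f \<in> K" by (intro subalg_mult[OF subalg_K] subalg_const[OF subalg_K] x)
    ultimately show "(\<lambda>Q. \<iota> c * x Q) \<in> adW"
      unfolding adW_iff using x(1) by (intro conjI bexI[of _ "\<iota> c * f"]) auto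
  qed
qed

definition tail :: "nat \<Rightarrow> ('n, 'k) proj_point \<Rightarrow> 'K" where
  "tail h = (\<lambda>Q. if Q = P then unif powi (- int h) else 0)"

lemma tail_in_ad: "tail h \<in> ad"
proof -
  have "finite {Q \<in> C. tail h Q \<notin> Loc Q}"
    by (rule finite_subset[of _ "{P}"]) (auto simp: tail_def subalg_zero[OF subalg_Loc])
  then show ?thesis
    unfolding adeles_def using P by (auto simp: tail_def K_powi[OF unif_in_K] subalg_zero[OF subalg_K])
qed

text \<open>If a combination were trivial, the function correcting it would be regular away from P
  and have the same pole at P as the combination, whose order is a gap.\<close>

lemma tails_independent:
  assumes J: "finite J" "J \<inter> H = {}" and W: "(\<Sum>h\<in>J. scale_ad (c h) (tail h)) \<in> adW"
  shows "\<forall>h\<in>J. c h = 0"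
proof (rule ccontr)
  assume "\<not> (\<forall>h\<in>J. c h = 0)"
  then have ex: "\<exists>h\<in>J. c h \<noteq> 0" by blast
  define s where "s = (\<Sum>h\<in>J. \<iota> (c h) * unif powi (- int h))"
  have uK: "unif powi e \<in> K \<and> unif powi e \<noteq> 0" for e using K_powi[OF unif_in_K] unif_neq_0 by simp
  have "s \<noteq> 0 \<and> (\<exists>h\<in>J. v s = v (unif powi (- int h)))"
    unfolding s_def by (rule v_sum_distinct[OF J(1) uK _ ex]) (auto simp: v_unif_powi inj_on_def)
  then obtain h where h: "h \<in> J" "s \<noteq> 0" "v s = - int h" by (auto simp: v_unif_powi)
  \<comment> \<open>Since \<open>0 \<in> H\<close>, the pole of \<open>s\<close> is genuine;
    subtracting something regular at P therefore does not change the order.\<close>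
  with J zero_in_H have "h \<notin> H" "h > 0" by (auto intro: gr0I)
  have sK: "s \<in> K"
    unfolding s_def by (intro subalg_sum[OF subalg_K] subalg_mult[OF subalg_K] subalg_const[OF subalg_K]) (simp add: uK)
  from W obtain f where f: "f \<in> K" "\<And>Q. Q \<in> C \<Longrightarrow> (\<Sum>h\<in>J. scale_ad (c h) (tail h)) Q - f \<in> Loc Q"
    unfolding adW_iff by blast
  have "- f \<in> Loc Q" if "Q \<in> C" "Q \<noteq> P" for Q
    using f(2)[OF that(1)] that by (simp add: sum_fun_app tail_def)
  then have "f \<in> Loc Q" if "Q \<in> C" "Q \<noteq> P" for Q
    using that subalg_uminus[OF subalg_Loc, of Q "- f"] by simp
  then have fRA: "f \<in> RA" by (intro RA_I f)
  have sf: "s - f \<in> OP"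
    using f(2)[OF P] by (simp add: sum_fun_app tail_def s_def)
  have "f \<noteq> 0 \<and> v f = - int h"
  proof (cases "s = f")
    case True
    with h show ?thesis by simp
  next
    case False
    define r where "r = - (s - f)"
    have r: "r \<in> K" "r \<noteq> 0" "r \<in> OP"
      using False subalg_uminus[OF subalg_K subalg_diff[OF subalg_K sK f(1)]]
        subalg_uminus[OF subalg_OP sf]
      by (auto simp: r_def)
    then have "v r \<ge> 0" using OP_iff_v by blast
    then have "v s \<noteq> v r" "min (v s) (v r) = - int h" using h \<open>h > 0\<close> by auto
    with v_add_eq_min[OF sK h(2) r(1,2)] show ?thesis by (simp add: r_def)
  qed
  with fRA have "h \<in> H" unfolding H_iff by blast
  with \<open>h \<notin> H\<close> show False ..
qed

end

section \<open>Genus, finiteness of gaps and strong approximation\<close>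

locale smooth_point_genus = smooth_point \<iota> \<xi> C P
  for \<iota> :: "'k::alg_closed_field \<Rightarrow> 'K::field" and \<xi> :: "'n::finite \<Rightarrow> 'K" and C P +
  fixes g :: nat
  assumes genus: "has_genus \<iota> \<xi> C g"
begin

sublocale adq: subspace_quotient scale_ad adW
  using vector_space_fun_mult subspace_adW by (simp add: subspace_quotient_def subspace_quotient_axioms_def)

lemma adele_basis:
  obtains e :: "nat \<Rightarrow> _" where "\<And>i. i < g \<Longrightarrow> e i \<in> ad"
    "\<And>a. a \<in> ad \<Longrightarrow> \<exists>c. a - (\<Sum>i<g. scale_ad (c i) (e i)) \<in> adW"
    "\<And>c. (\<Sum>i<g. scale_ad (c i) (e i)) \<in> adW \<Longrightarrow> \<forall>i\<in>{..<g}. c i = 0"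
proof -
  from genus obtain e where "basis_mod scale_ad ad adW {..<g} e"
    unfolding has_genus_def has_dim_mod_def adW_def[symmetric] by blast
  then show ?thesis
    unfolding basis_mod_def by (intro that[of e]) simp_all
qed

lemma card_gaps_subset_le:
  assumes "J \<subseteq> - H" "finite J"
  shows "card J \<le> g"
proof -
  obtain e where e: "\<And>a. a \<in> ad \<Longrightarrow> \<exists>c. a - (\<Sum>i<g. scale_ad (c i) (e i)) \<in> adW"
    by (rule adele_basis) blast
  have "card J \<le> card {..<g}"
    by (rule adq.card_le_if_independent_mod[where b = tail, OF assms(2) _ e[OF tail_in_ad]])
      (use assms tails_independent[of J] in auto)
  then show ?thesis by simp
qed

lemma finite_gaps: "finite (- H)" and card_gaps_le: "card (- H) \<le> g"
proof -
  have "\<And>J. J \<subseteq> - H \<Longrightarrow> finite J \<Longrightarrow> card J \<le> g" by (rule card_gaps_subset_le)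
  then have "finite (- H) \<and> card (- H) \<le> g" by (rule finite_if_finite_subsets_card_bdd) 
  then show "finite (- H)" "card (- H) \<le> g" by auto
qed

text \<open>Membership in \<open>adW\<close> with the condition at \<open>P\<close> dropped: a
  single function has to match the family modulo the local rings at all other points.\<close>

definition approx :: "(('n, 'k) proj_point \<Rightarrow> 'K) set" where
  "approx = {a. \<exists>p\<in>K. \<forall>Q\<in>C. Q \<noteq> P \<longrightarrow> a Q - p \<in> Loc Q}"

lemma adW_subset_approx: "a \<in> adW \<Longrightarrow> a \<in> approx"
  unfolding adW_iff approx_def by blast

lemma approx_add:
  assumes "a \<in> approx" "b \<in> approx"
  shows "(\<lambda>Q. a Q + b Q) \<in> approx"
proof -
  from assms obtain p q where p: "p \<in> K" "\<forall>Q\<in>C. Q \<noteq> P \<longrightarrow> a Q - p \<in> Loc Q"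
    and q: "q \<in> K" "\<forall>Q\<in>C. Q \<noteq> P \<longrightarrow> b Q - q \<in> Loc Q" unfolding approx_def by blast
  have "a Q + b Q - (p + q) \<in> Loc Q" if "Q \<in> C" "Q \<noteq> P" for Q
  proof -
    have "(a Q - p) + (b Q - q) \<in> Loc Q" using p q that by (intro subalg_add[OF subalg_Loc]) auto
    then show ?thesis by (simp add: algebra_simps)
  qed
  then show ?thesis unfolding approx_def using subalg_add[OF subalg_K p(1) q(1)] by blast
qed

lemma approx_mult:
  assumes "a \<in> approx" "b \<in> RA"
  shows "(\<lambda>Q. b * a Q) \<in> approx"
proof -
  from assms obtain p where p: "p \<in> K" "\<forall>Q\<in>C. Q \<noteq> P \<longrightarrow> a Q - p \<in> Loc Q"
    unfolding approx_def by blast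
  have "b * a Q - b * p \<in> Loc Q" if "Q \<in> C" "Q \<noteq> P" for Q
    unfolding right_diff_distrib[symmetric]
    using p that assms(2) by (simp add: subalg_mult[OF subalg_Loc] RA_Loc)
  then show ?thesis
    unfolding approx_def using subalg_mult[OF subalg_K RA_subset_K[OF assms(2)] p(1)] by blast
qed

lemma approx_zero: "(\<lambda>Q. 0) \<in> approx"
  unfolding approx_def by (auto intro!: bexI[of _ 0] subalg_zero[OF subalg_K] subalg_zero[OF subalg_Loc])

lemma approx_sum: "(\<And>i. i \<in> I \<Longrightarrow> a i \<in> approx) \<Longrightarrow> (\<lambda>Q. \<Sum>i\<in>I. a i Q) \<in> approx"
  by (induction I rule: infinite_finite_induct) (simp_all add: approx_zero approx_add)

lemma RA_mult_ad:
  assumes "b \<in> RA" "a \<in> ad"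
  shows "(\<lambda>Q. b * a Q) \<in> ad"
proof -
  have "{Q \<in> C. b * a Q \<notin> Loc Q} \<subseteq> insert P {Q \<in> C. a Q \<notin> Loc Q}"
    using assms by (auto intro: subalg_mult[OF subalg_Loc] RA_Loc)
  moreover have "finite (insert P {Q \<in> C. a Q \<notin> Loc Q})" using assms by (simp add: adeles_def)
  ultimately have "finite {Q \<in> C. b * a Q \<notin> Loc Q}" by (rule finite_subset)
  then show ?thesis
    using assms unfolding adeles_def by (auto intro: subalg_mult[OF subalg_K] RA_subset_K)
qed

text \<open>For \<open>f\<close> with a pole at P only, the multiples of \<open>a\<close> by the
  powers of \<open>f\<close> with exponents \<open>0\<close> to \<open>g\<close> are one more than
  the dimension of the adelic quotient. A linear relation between them is multiplication by a
  polynomial in \<open>f\<close>, nonzero because the powers have distinct orders.\<close>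

lemma annihilator:
  assumes a: "a \<in> ad"
  shows "\<exists>b\<in>RA. b \<noteq> 0 \<and> (\<lambda>Q. b * a Q) \<in> approx"
proof -
  obtain e where e: "\<And>a. a \<in> ad \<Longrightarrow> \<exists>c. a - (\<Sum>i<g. scale_ad (c i) (e i)) \<in> adW"
    by (rule adele_basis) blast
  \<comment> \<open>Otherwise all natural numbers except possibly \<open>0\<close> would be gaps,
    and there are only finitely many gaps.\<close>
  have "\<not> H \<subseteq> {0}"
  proof
    assume "H \<subseteq> {0}"
    then have "finite (H \<union> - H)" using finite_gaps finite_subset by blast
    then show False by simp
  qed
  then obtain h where h: "h \<in> H" "h > 0" by auto
  define f where "f = \<phi> h"
  have f: "f \<in> RA" "f \<noteq> 0" "v f = - int h" using \<phi>[OF h(1)] by (auto simp: f_def)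
  have fK: "f ^ j \<in> K \<and> f ^ j \<noteq> 0" for j using f by (auto intro: subalg_power[OF subalg_K] RA_subset_K)
  have vf: "v (f ^ j) = - int (j * h)" for j
  proof (induction j)
    case (Suc j)
    have "v (f * f ^ j) = v f + v (f ^ j)" using f fK by (intro v_mult) (auto intro: RA_subset_K)
    with Suc f(3) show ?case by simp
  qed (simp add: v_one)
  have "\<exists>c. (\<exists>j\<in>{..g}. c j \<noteq> 0) \<and> (\<Sum>j\<le>g. scale_ad (c j) (\<lambda>Q. f ^ j * a Q)) \<in> adW"
    by (rule adq.dependent_mod_if_card_less[where J = "{..<g}" and e = e])
      (auto intro!: e RA_mult_ad a subalg_power[OF subalg_RA] f)
  then obtain c where c: "\<exists>j\<in>{..g}. c j \<noteq> 0" "(\<Sum>j\<le>g. scale_ad (c j) (\<lambda>Q. f ^ j * a Q)) \<in> adW"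
    by blast
  define b where "b = (\<Sum>j\<le>g. \<iota> (c j) * f ^ j)"
  have "b \<noteq> 0"
    using v_sum_distinct[OF _ fK _ c(1)] h(2) unfolding b_def by (simp add: vf inj_on_def)
  moreover have "b \<in> RA"
    unfolding b_def using f(1)
    by (intro subalg_sum[OF subalg_RA] subalg_mult[OF subalg_RA] subalg_const[OF subalg_RA] subalg_power[OF subalg_RA])
  moreover have "(\<Sum>j\<le>g. scale_ad (c j) (\<lambda>Q. f ^ j * a Q)) = (\<lambda>Q. b * a Q)"
    by (auto simp: fun_eq_iff sum_fun_app b_def sum_distrib_right mult.assoc)
  ultimately show ?thesis using c(2) adW_subset_approx by force
qed

text \<open>
  Strong approximation. The finite-dimensional space of adeles modulo \<open>approx\<close> is annihilated by some
  \<open>b \<noteq> 0\<close> regular away from \<open>P\<close>; but multiplication by \<open>b\<close> is surjective on it.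
\<close>

lemma strong_approximation:
  assumes a: "a \<in> ad"
  shows "a \<in> approx"
proof -
  obtain e where e: "\<And>i. i < g \<Longrightarrow> e i \<in> ad"
    "\<And>a. a \<in> ad \<Longrightarrow> \<exists>c. a - (\<Sum>i<g. scale_ad (c i) (e i)) \<in> adW"
    by (rule adele_basis) blast
  have "\<forall>i. \<exists>b. i < g \<longrightarrow> b \<in> RA \<and> b \<noteq> 0 \<and> (\<lambda>Q. b * e i Q) \<in> approx"
    using annihilator e(1) by blast
  then obtain \<beta> where \<beta>: "\<And>i. i < g \<Longrightarrow> \<beta> i \<in> RA \<and> \<beta> i \<noteq> 0 \<and> (\<lambda>Q. \<beta> i * e i Q) \<in> approx"
    by metis
  \<comment> \<open>The product annihilates all basis elements simultaneously, hence every adele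
    modulo \<open>approx\<close>.\<close>
  define b where "b = (\<Prod>i<g. \<beta> i)"
  have b: "b \<in> RA" "b \<noteq> 0" using \<beta> by (auto simp: b_def intro!: subalg_prod[OF subalg_RA])
  have be: "(\<lambda>Q. b * e i Q) \<in> approx" if i: "i < g" for i
  proof -
    have "b = (\<Prod>j\<in>{..<g} - {i}. \<beta> j) * \<beta> i"
      using i by (simp add: b_def prod.remove[of _ i] mult.commute)
    moreover have "(\<lambda>Q. (\<Prod>j\<in>{..<g} - {i}. \<beta> j) * (\<beta> i * e i Q)) \<in> approx"
      by (rule approx_mult) (use \<beta> i in \<open>auto intro: subalg_prod[OF subalg_RA]\<close>)
    ultimately show ?thesis by (simp add: mult.assoc)
  qed
  have ann: "(\<lambda>Q. b * a Q) \<in> approx" if "a \<in> ad" for a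
  proof -
    from e(2)[OF that] obtain c where "a - (\<Sum>i<g. scale_ad (c i) (e i)) \<in> adW" by blast
    then have 1: "(\<lambda>Q. b * (a - (\<Sum>i<g. scale_ad (c i) (e i))) Q) \<in> approx"
      by (intro approx_mult b adW_subset_approx)
    have 2: "(\<lambda>Q. \<Sum>i<g. \<iota> (c i) * (b * e i Q)) \<in> approx"
      by (intro approx_sum approx_mult be subalg_const[OF subalg_RA]) auto
    have "(\<lambda>Q. b * a Q) = (\<lambda>Q. b * (a - (\<Sum>i<g. scale_ad (c i) (e i))) Q + (\<Sum>i<g. \<iota> (c i) * (b * e i Q)))"
      by (simp add: fun_eq_iff sum_fun_app algebra_simps sum_distrib_left)
    with approx_add[OF 1 2] show ?thesis by simp
  qed
  \<comment> \<open>Multiplication by \<open>b\<close> recovers \<open>a\<close> wherever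
    \<open>a\<close> is not integral. Where \<open>a\<close> is integral, \<open>a'\<close> is zero,
    so the approximating function \<open>p\<close> is integral there as well and approximates
    \<open>a\<close> too.\<close>
  define a' where "a' Q = (if Q \<in> C \<and> a Q \<notin> Loc Q then a Q / b else 0)" for Q
  have "{Q \<in> C. a' Q \<notin> Loc Q} \<subseteq> {Q \<in> C. a Q \<notin> Loc Q}"
    by (auto simp: a'_def subalg_zero[OF subalg_Loc])
  then have "finite {Q \<in> C. a' Q \<notin> Loc Q}"
    using a by (auto simp: adeles_def elim: finite_subset)
  then have "a' \<in> ad"
    using a b unfolding adeles_def
    by (auto simp: a'_def intro: K_divide RA_subset_K subalg_zero[OF subalg_K])
  from ann[OF this] obtain p where p: "p \<in> K" "\<And>Q. Q \<in> C \<Longrightarrow> Q \<noteq> P \<Longrightarrow> b * a' Q - p \<in> Loc Q"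
    unfolding approx_def by blast
  have "a Q - p \<in> Loc Q" if Q: "Q \<in> C" "Q \<noteq> P" for Q
  proof (cases "a Q \<in> Loc Q")
    case True
    then have "- p \<in> Loc Q" using p(2)[OF Q] by (simp add: a'_def)
    from subalg_add[OF subalg_Loc[OF Q(1)] True this] show ?thesis by simp
  next
    case False
    then show ?thesis using p(2)[OF Q] Q b(2) by (simp add: a'_def)
  qed
  with p(1) show ?thesis unfolding approx_def by blast
qed

text \<open>By induction on the pole order: the leading term is removed by \<open>\<phi> h\<close>
  when the pole order \<open>h\<close> lies in \<open>H\<close>, and by the power of
  \<open>unif\<close> with exponent \<open>- h\<close> when it is a gap.\<close>

lemma principal_part:
  assumes y: "y \<in> K"
  shows "\<exists>c. \<exists>f\<in>RA. y - f - (\<Sum>h\<in>- H. \<iota> (c h) * unif powi (- int h)) \<in> OP"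
proof -
  define X where "X = {y. \<exists>c. \<exists>f\<in>RA. y - f - (\<Sum>h\<in>- H. \<iota> (c h) * unif powi (- int h)) \<in> OP}"
  have X_add: "x + \<iota> r * y \<in> X" if xy: "x \<in> X" "y \<in> X" for x y r
  proof -
    from xy obtain c f c' f' where f: "f \<in> RA" "x - f - (\<Sum>h\<in>- H. \<iota> (c h) * unif powi (- int h)) \<in> OP"
      "f' \<in> RA" "y - f' - (\<Sum>h\<in>- H. \<iota> (c' h) * unif powi (- int h)) \<in> OP"
      unfolding X_def by blast
    have "(x - f - (\<Sum>h\<in>- H. \<iota> (c h) * unif powi (- int h))) +
        \<iota> r * (y - f' - (\<Sum>h\<in>- H. \<iota> (c' h) * unif powi (- int h))) \<in> OP"
      by (intro subalg_add[OF subalg_OP] subalg_mult[OF subalg_OP] subalg_const[OF subalg_OP] f)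
    also have "(x - f - (\<Sum>h\<in>- H. \<iota> (c h) * unif powi (- int h))) +
        \<iota> r * (y - f' - (\<Sum>h\<in>- H. \<iota> (c' h) * unif powi (- int h))) =
        (x + \<iota> r * y) - (f + \<iota> r * f') - (\<Sum>h\<in>- H. \<iota> (c h + r * c' h) * unif powi (- int h))"
      by (simp add: algebra_simps hom_add hom_mult sum.distrib sum_distrib_left)
    finally have *: "(x + \<iota> r * y) - (f + \<iota> r * f') - (\<Sum>h\<in>- H. \<iota> (c h + r * c' h) * unif powi (- int h)) \<in> OP" .
    have "f + \<iota> r * f' \<in> RA"
      by (intro subalg_add[OF subalg_RA] subalg_mult[OF subalg_RA] subalg_const[OF subalg_RA] f)
    with * show ?thesis
      unfolding X_def by (intro CollectI exI[of _ "\<lambda>h. c h + r * c' h"] bexI)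
  qed
  have X_OP: "x \<in> X" if "x \<in> OP" for x
    unfolding X_def using that
    by (auto intro!: exI[of _ "\<lambda>_. 0"] bexI[of _ 0] subalg_zero[OF subalg_RA])
  have X_RA: "x \<in> X" if "x \<in> RA" for x
    unfolding X_def using that
    by (auto intro!: exI[of _ "\<lambda>_. 0"] bexI[of _ x] subalg_zero[OF subalg_OP])
  have X_unif: "unif powi (- int h) \<in> X" if "h \<in> - H" for h
  proof -
    have "(\<Sum>j\<in>- H. \<iota> (if j = h then 1 else 0) * unif powi (- int j))
        = (\<Sum>j\<in>- H. if j = h then unif powi (- int j) else 0)"
      by (rule sum.cong) auto
    also have "\<dots> = unif powi (- int h)" using that finite_gaps by simp
    finally show ?thesis
      unfolding X_def
      by (auto intro!: exI[of _ "\<lambda>j. if j = h then 1 else 0"] bexI[of _ 0] subalg_zero[OF subalg_RA]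
          simp: subalg_zero[OF subalg_OP])
  qed
  have "y \<in> X" if "y \<in> K" "y = 0 \<or> v y \<ge> - int N" for N y
    using that
  proof (induction N arbitrary: y)
    case 0
    then show ?case using X_OP OP_iff_v[of y] subalg_zero[OF subalg_OP] by auto
  next
    case (Suc N)
    show ?case
    proof (cases "y = 0 \<or> v y \<ge> - int N")
      case True
      with Suc show ?thesis by blast
    next
      case False
      with Suc.prems have vy: "y \<noteq> 0" "v y = - int (Suc N)" by auto
      obtain u where u: "u \<in> X" "u \<in> K" "u \<noteq> 0" "v u = - int (Suc N)"
      proof (cases "Suc N \<in> H")
        case True
        from \<phi>[OF this] show ?thesis by (intro that[of "\<phi> (Suc N)"] X_RA RA_subset_K)
      next
        case False
        then show ?thesis
          by (intro that[of "unif powi (- int (Suc N))"] X_unif)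
            (auto simp: v_unif_powi unif_neq_0 K_powi[OF unif_in_K] simp del: of_nat_Suc)
      qed
      from v_residue[OF Suc.prems(1) vy(1) u(2,3)] vy u obtain c where
        c: "y - \<iota> c * u = 0 \<or> v (y - \<iota> c * u) > v u" by auto
      have "y - \<iota> c * u \<in> X"
        using c u Suc.prems(1)
        by (intro Suc.IH subalg_diff[OF subalg_K] subalg_mult[OF subalg_K] subalg_const[OF subalg_K]) auto
      from X_add[OF this u(1), of c] show ?thesis by simp
    qed
  qed
  from this[OF y, of "nat (- v y)"] have "y \<in> X" by auto
  then show ?thesis by (simp add: X_def)
qed

text \<open>Strong approximation supplies \<open>p\<close>, leaving only the component at P to
  treat; its principal part is split into \<open>f\<close>, regular away from P, and gap terms. The
  principal adele to subtract is therefore \<open>p + f\<close>.\<close>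

lemma ad_spanned_by_tails:
  assumes a: "a \<in> ad"
  shows "\<exists>c. a - (\<Sum>h\<in>- H. scale_ad (c h) (tail h)) \<in> adW"
proof -
  from strong_approximation[OF a] obtain p where p: "p \<in> K" "\<And>Q. Q \<in> C \<Longrightarrow> Q \<noteq> P \<Longrightarrow> a Q - p \<in> Loc Q"
    unfolding approx_def by blast
  have "a P - p \<in> K" using a P p by (auto simp: adeles_def intro: subalg_diff[OF subalg_K])
  from principal_part[OF this] obtain c f where
    f: "f \<in> RA" "a P - p - f - (\<Sum>h\<in>- H. \<iota> (c h) * unif powi (- int h)) \<in> OP" by blast
  have "(a - (\<Sum>h\<in>- H. scale_ad (c h) (tail h))) Q - (p + f) \<in> Loc Q" if Q: "Q \<in> C" for Q
  proof (cases "Q = P")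
    case True
    then show ?thesis using f(2) by (simp add: sum_fun_app tail_def algebra_simps)
  next
    case False
    have "(a Q - p) - f \<in> Loc Q" by (intro subalg_diff[OF subalg_Loc[OF Q]] p RA_Loc f Q False)
    with False show ?thesis by (simp add: sum_fun_app tail_def algebra_simps)
  qed
  moreover have "(a - (\<Sum>h\<in>- H. scale_ad (c h) (tail h))) Q = 0" if "Q \<notin> C" for Q
  proof -
    have "Q \<noteq> P" using that P by auto
    with that a show ?thesis by (simp add: adeles_def sum_fun_app tail_def)
  qed
  moreover have "p + f \<in> K" by (intro subalg_add[OF subalg_K] p RA_subset_K f)
  ultimately show ?thesis unfolding adW_iff by blast
qed

lemma card_gaps: "card (- H) = g"
proof (rule antisym[OF card_gaps_le])
  obtain e where e: "\<And>i. i < g \<Longrightarrow> e i \<in> ad"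
    "\<And>c. (\<Sum>i<g. scale_ad (c i) (e i)) \<in> adW \<Longrightarrow> \<forall>i\<in>{..<g}. c i = 0"
    by (rule adele_basis) blast
  have "card {..<g} \<le> card (- H)"
    by (rule adq.card_le_if_independent_mod[OF _ finite_gaps ad_spanned_by_tails e(2)]) (auto intro: e(1))
  then show "g \<le> card (- H)" by simp
qed

end

section \<open>Generators of the section ring\<close>

lemma product_span_zero: "0 \<in> product_span A B"
  unfolding product_span_def by (auto intro!: exI[of _ "0::nat"])

lemma product_span_mult: "a \<in> A \<Longrightarrow> b \<in> B \<Longrightarrow> a * b \<in> product_span A B"
  unfolding product_span_def
  by (intro CollectI exI[of _ "1::nat"] exI[of _ "\<lambda>_. a"] exI[of _ "\<lambda>_. b"]) simp

lemma product_span_add: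
  assumes "x \<in> product_span A B" "y \<in> product_span A B"
  shows "x + y \<in> product_span A B"
proof -
  from assms obtain l l' :: nat and a b a' b' where
    x: "x = (\<Sum>i<l. a i * b i)" "\<forall>i<l. a i \<in> A \<and> b i \<in> B" and
    y: "y = (\<Sum>i<l'. a' i * b' i)" "\<forall>i<l'. a' i \<in> A \<and> b' i \<in> B"
    unfolding product_span_def by blast
  define a'' where "a'' i = (if i < l then a i else a' (i - l))" for i
  define b'' where "b'' i = (if i < l then b i else b' (i - l))" for i
  have "(\<Sum>i<l + k. a'' i * b'' i) = x + (\<Sum>i<k. a' i * b' i)" for k
    by (induction k) (auto simp: x(1) a''_def b''_def add.assoc)
  then have "x + y = (\<Sum>i<l + l'. a'' i * b'' i)" by (simp add: y(1))
  moreover have "\<forall>i<l + l'. a'' i \<in> A \<and> b'' i \<in> B"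
    using x(2) y(2) by (auto simp: a''_def b''_def)
  ultimately show ?thesis unfolding product_span_def by blast
qed

lemma product_span_smult:
  assumes "\<And>a. a \<in> A \<Longrightarrow> smult r a \<in> A" "x \<in> product_span A B"
  shows "smult r x \<in> product_span A B"
proof -
  from assms(2) obtain l :: nat and a b where
    x: "x = (\<Sum>i<l. a i * b i)" "\<forall>i<l. a i \<in> A \<and> b i \<in> B"
    unfolding product_span_def by blast
  have "smult r x = (\<Sum>i<l. smult r (a i) * b i)"
    unfolding x(1) by (induction l) (auto simp: smult_add_right)
  moreover have "\<forall>i<l. smult r (a i) \<in> A \<and> b i \<in> B" using x(2) assms(1) by blast
  ultimately show ?thesis
    unfolding product_span_def by (intro CollectI exI[of _ l] exI[of _ "\<lambda>i. smult r (a i)"] exI[of _ b]) simp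
qed

section \<open>Sections of multiples of P\<close>

context smooth_point
begin

abbreviation "GS \<equiv> global_sections \<iota> \<xi> C P"

lemma GS_iff: "f \<in> GS e \<longleftrightarrow> f \<in> RA \<and> (f = 0 \<or> - int e \<le> v f)"
  by (simp add: global_sections_def)

lemma GS_zero: "0 \<in> GS e"
  by (simp add: GS_iff subalg_zero[OF subalg_RA])

lemma GS_add:
  assumes "f \<in> GS e" "h \<in> GS e"
  shows "f + h \<in> GS e"
proof -
  consider "f = 0" | "h = 0" | "f + h = 0" | "f \<noteq> 0" "h \<noteq> 0" "f + h \<noteq> 0" by blast
  then show ?thesis
  proof cases
    case 4
    with v_add[of f h] assms show ?thesis
      by (auto simp: GS_iff RA_subset_K intro: subalg_add[OF subalg_RA])
  qed (use assms GS_zero in auto)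
qed

lemma GS_mult:
  assumes "f \<in> GS a" "h \<in> GS b"
  shows "f * h \<in> GS (a + b)"
proof (cases "f = 0 \<or> h = 0")
  case False
  with v_mult[of f h] assms show ?thesis
    by (auto simp: GS_iff RA_subset_K intro: subalg_mult[OF subalg_RA])
qed (use GS_zero in auto)

lemma GS_const: "\<iota> c \<in> GS e"
  by (cases "c = 0") (simp_all add: GS_iff v_const subalg_const[OF subalg_RA] subalg_zero[OF subalg_RA])

lemma GS_const_mult: "f \<in> GS e \<Longrightarrow> \<iota> c * f \<in> GS e"
  using GS_mult[OF GS_const, of f e c 0] by simp

lemma GS_\<phi>: "h \<in> H \<Longrightarrow> h \<le> e \<Longrightarrow> \<phi> h \<in> GS e"
  using \<phi>[of h] by (simp add: GS_iff)

text \<open>A section of positive order at P would be regular everywhere, hence constant, and a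
  nonzero constant has order zero.\<close>

lemma GS_v_in_H: "f \<in> GS e \<Longrightarrow> f \<noteq> 0 \<Longrightarrow> \<exists>h\<in>H. h \<le> e \<and> v f = - int h"
proof -
  assume f: "f \<in> GS e" "f \<noteq> 0"
  have "v f \<le> 0"
  proof (rule ccontr)
    assume "\<not> v f \<le> 0"
    with f have "f \<in> OP" using OP_iff_v[of f] by (auto simp: GS_iff RA_subset_K)
    with f RA_OP_constant obtain c where "f = \<iota> c" by (auto simp: GS_iff)
    with f \<open>\<not> v f \<le> 0\<close> v_const[of c] show False by (auto simp: hom_eq_0_iff)
  qed
  then have "v f = - int (nat (- v f))" by simp
  moreover from this f have "nat (- v f) \<in> H" unfolding H_iff by (auto simp: GS_iff)
  ultimately show ?thesis using f by (intro bexI[of _ "nat (- v f)"]) (auto simp: GS_iff)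
qed

text \<open>Leading terms can be cancelled, since the residue field is \<open>k\<close>.\<close>

lemma GS_leading_term_induct:
  assumes zero: "0 \<in> X" and lin: "\<And>x u c. x \<in> X \<Longrightarrow> u \<in> X \<Longrightarrow> x + \<iota> c * u \<in> X"
    and lead: "\<And>f. f \<in> GS e \<Longrightarrow> f \<noteq> 0 \<Longrightarrow> \<exists>u\<in>X. u \<in> GS e \<and> u \<noteq> 0 \<and> v u = v f"
    and f: "f \<in> GS e"
  shows "f \<in> X"
proof -
  \<comment> \<open>Each cancellation raises the order. The descent ends at \<open>N = 0\<close>,
    since no nonzero section has positive order.\<close>
  have "f \<in> X" if "f \<in> GS e" "f = 0 \<or> v f > - int N" for N f
    using that
  proof (induction N arbitrary: f)
    case 0
    then show ?case using GS_v_in_H[OF 0(1)] zero by force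
  next
    case (Suc N)
    show ?case
    proof (cases "f = 0")
      case False
      from lead[OF Suc.prems(1) False] obtain u where u: "u \<in> X" "u \<in> GS e" "u \<noteq> 0" "v u = v f" by blast
      have fK: "f \<in> K" "u \<in> K" using Suc.prems u by (auto simp: GS_iff RA_subset_K)
      from v_residue[OF fK(1) False fK(2) u(3) u(4)[symmetric]] obtain c where
        c: "f - \<iota> c * u = 0 \<or> v (f - \<iota> c * u) > v u" by blast
      have "f + \<iota> (- c) * u \<in> GS e" by (intro GS_add GS_const_mult Suc.prems u)
      then have "f - \<iota> c * u \<in> GS e" by (simp add: hom_uminus)
      then have "f - \<iota> c * u \<in> X" using c Suc.prems(2) False u(4) by (intro Suc.IH) auto
      from lin[OF this u(1), of c] show ?thesis by simp
    qed (use zero in simp)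
  qed
  from this[OF f, of "nat (- v f) + 1"] show ?thesis by auto
qed

text \<open>With \<open>W = {0}\<close> the counting lemmas for quotients become ordinary linear
  algebra in the function field.\<close>

lemma subspace_quotient_zero: "subspace_quotient (\<lambda>c x. \<iota> c * x) {0}"
proof -
  interpret V: vector_space "\<lambda>c x. \<iota> c * x" by (rule vector_space_mult)
  show ?thesis by unfold_locales simp
qed

lemma \<phi>_spans_GS:
  assumes "f \<in> GS e"
  shows "\<exists>c. f - (\<Sum>h\<in>H \<inter> {..e}. \<iota> (c h) * \<phi> h) \<in> {0}"
proof -
  interpret V: subspace_quotient "\<lambda>c x. \<iota> c * x" "{0}" by (rule subspace_quotient_zero)
  have "f \<in> V.span_mod (H \<inter> {..e}) \<phi>"
  proof (rule GS_leading_term_induct[OF _ _ _ assms])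
    show "0 \<in> V.span_mod (H \<inter> {..e}) \<phi>" by (rule V.subspace_0[OF V.subspace_span_mod])
  next
    fix x u c assume "x \<in> V.span_mod (H \<inter> {..e}) \<phi>" "u \<in> V.span_mod (H \<inter> {..e}) \<phi>"
    then show "x + \<iota> c * u \<in> V.span_mod (H \<inter> {..e}) \<phi>"
      by (intro V.subspace_add[OF V.subspace_span_mod] V.subspace_scale[OF V.subspace_span_mod])
  next
    fix f assume "f \<in> GS e" "f \<noteq> 0"
    then obtain h where h: "h \<in> H" "h \<le> e" "v f = - int h" using GS_v_in_H by blast
    then show "\<exists>u\<in>V.span_mod (H \<inter> {..e}) \<phi>. u \<in> GS e \<and> u \<noteq> 0 \<and> v u = v f"
      using \<phi>[OF h(1)] GS_\<phi> by (intro bexI[of _ "\<phi> h"] V.span_mod_base) auto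
  qed
  then show ?thesis by (simp add: V.span_mod_def)
qed

lemma \<phi>_independent:
  assumes "finite S" "S \<subseteq> H" "(\<Sum>h\<in>S. \<iota> (c h) * \<phi> h) = 0"
  shows "\<forall>h\<in>S. c h = 0"
proof (rule ccontr)
  assume "\<not> (\<forall>h\<in>S. c h = 0)"
  then have ex: "\<exists>h\<in>S. c h \<noteq> 0" by blast
  have "(\<Sum>h\<in>S. \<iota> (c h) * \<phi> h) \<noteq> 0 \<and> (\<exists>h\<in>S. v (\<Sum>h\<in>S. \<iota> (c h) * \<phi> h) = v (\<phi> h))"
  proof (rule v_sum_distinct[OF assms(1) _ _ ex])
    show "\<phi> h \<in> K \<and> \<phi> h \<noteq> 0" if "h \<in> S" for h using \<phi>[of h] assms(2) that RA_subset_K by auto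
    show "inj_on (\<lambda>h. v (\<phi> h)) S" using \<phi>(3) assms(2) by (auto simp: inj_on_def subset_iff)
  qed
  with assms(3) show False by blast
qed

end

section \<open>The irrelevant ideal modulo its square\<close>

locale section_ring_of_point = smooth_point_genus \<iota> \<xi> C P g
  for \<iota> :: "'k::alg_closed_field \<Rightarrow> 'K::field" and \<xi> :: "'n::finite \<Rightarrow> 'K" and C P g +
  fixes d :: nat
  assumes d: "d \<ge> 1"
begin

abbreviation "Fr \<equiv> frobenius_number \<iota> \<xi> C P"
abbreviation "q \<equiv> q_number \<iota> \<xi> C P d"
abbreviation "RI \<equiv> irrelevant_ideal \<iota> \<xi> C P d"
abbreviation "RI2 \<equiv> product_span RI RI"

lemma gap_le_Fr: "h \<notin> H \<Longrightarrow> h \<le> Fr"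
  unfolding frobenius_number_def by (rule Max_ge[OF finite_gaps]) simp

lemma q: "q \<ge> 1" "q * d \<in> H"
proof -
  \<comment> \<open>The multiple \<open>(Fr + 1) * d\<close> exceeds every gap, so the minimum
    defining \<open>q\<close> is attained.\<close>
  have "\<not> Suc Fr * d \<le> Fr" using mult_le_mono2[OF d, of "Suc Fr"] by simp
  then have "1 \<le> Suc Fr \<and> Suc Fr * d \<in> H" using gap_le_Fr by auto
  from LeastI[of "\<lambda>q. 1 \<le> q \<and> q * d \<in> H", OF this] show "q \<ge> 1" "q * d \<in> H"
    unfolding q_number_def by auto
qed

lemma RI_iff: "p \<in> RI \<longleftrightarrow> coeff p 0 = 0 \<and> (\<forall>m. coeff p m \<in> GS (m * d))"
  by (auto simp: irrelevant_ideal_def section_ring_def)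

lemma monom_in_RI: "m \<ge> 1 \<Longrightarrow> f \<in> GS (m * d) \<Longrightarrow> monom f m \<in> RI"
  by (auto simp: RI_iff GS_zero)

text \<open>Products of two polynomials without constant term start in degree 2. So in degree 1
  nothing is lost in the quotient, which allows the generators of weight 1 to be counted
  exactly.\<close>

lemma RI2_coeff_1: "p \<in> RI2 \<Longrightarrow> coeff p 1 = 0"
  unfolding product_span_def
  by (auto simp: coeff_sum coeff_mult RI_iff numeral_eq_Suc intro!: sum.neutral)

abbreviation (input) "scale_poly \<equiv> \<lambda>c p. smult (\<iota> c) p"

sublocale RIq: subspace_quotient scale_poly RI2
proof -
  interpret V: vector_space scale_poly by (rule vector_space_smult)
  show "subspace_quotient scale_poly RI2"
  proof (unfold_locales, rule V.subspaceI)
    fix c x assume "x \<in> RI2"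
    then show "smult (\<iota> c) x \<in> RI2"
      by (rule product_span_smult[rotated]) (auto simp: RI_iff intro: GS_const_mult)
  qed (auto intro: product_span_zero product_span_add)
qed

text \<open>
  The pairs \<open>(gen_degree h, h)\<close> with \<open>h \<in> gens\<close> include all indecomposable elements of the
  semigroup \<open>{(m, h). m \<ge> 1, h \<in> H, h \<le> m d}\<close>; the set \<open>gens\<close> consists of \<open>q d\<close> and the Apery set
  of \<open>H\<close> with respect to \<open>q d\<close>.
\<close>

definition gens :: "nat set" where
  "gens = {h \<in> H. h \<le> q * d \<or> h - q * d \<notin> H}"

text \<open>For positive \<open>h\<close> this is the ceiling of \<open>h / d\<close>, the least
  degree in which \<open>\<phi> h\<close> is a section.\<close>

definition gen_degree :: "nat \<Rightarrow> nat" where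
  "gen_degree h = (if h = 0 then 1 else (h - 1) div d + 1)"

abbreviation "gens_of m \<equiv> {h \<in> gens. gen_degree h = m}"
abbreviation "gen h \<equiv> monom (\<phi> h) (gen_degree h)"

lemma finite_gens: "finite gens"
proof (rule finite_subset)
  show "gens \<subseteq> {..q * d + Fr}"
  proof
    fix h assume "h \<in> gens"
    then show "h \<in> {..q * d + Fr}" using gap_le_Fr[of "h - q * d"] by (auto simp: gens_def)
  qed
qed simp

lemma H_add_multiple: "h \<in> H \<Longrightarrow> h + k * (q * d) \<in> H"
proof (induction k)
  case (Suc k)
  from H_add[OF Suc.IH[OF Suc.prems] q(2)] show ?case by (simp add: algebra_simps)
qed simp

lemma card_gens_le: "card gens \<le> q * d + 1"
proof -
  let ?r = "q * d"
  have r: "?r > 0" using q d by simp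
  \<comment> \<open>Apart from \<open>q * d\<close>, a residue class contains at most one element of
    \<open>gens\<close>: from a smaller element one reaches the larger by adding
    \<open>q * d\<close>, and the last step but one already lies in \<open>H\<close>.\<close>
  have le: "x \<ge> y" if x: "x \<in> gens" "x \<noteq> ?r" and y: "y \<in> gens" "y \<noteq> ?r" and eq: "x mod ?r = y mod ?r" for x y
  proof (rule ccontr)
    assume "\<not> y \<le> x"
    then have "x < y" by simp
    with eq obtain k where k: "y = x + k * ?r"
      by (metis add.commute less_imp_le mod_eq_nat2E mult.commute)
    with \<open>x < y\<close> obtain j where j: "k = Suc j" by (cases k) auto
    have yr: "y - ?r = x + j * ?r" by (simp add: k j)
    have "x \<in> H" using x by (simp add: gens_def)
    then have "y - ?r \<in> H" unfolding yr by (rule H_add_multiple)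
    \<comment> \<open>Membership in \<open>gens\<close> now leaves only
      \<open>y \<le> q * d\<close>, but \<open>y\<close> arose from \<open>x\<close> by adding
      \<open>q * d\<close> at least once.\<close>
    with y have "y < ?r" by (simp add: gens_def)
    then show False by (simp add: k j)
  qed
  have "inj_on (\<lambda>x. x mod ?r) (gens - {?r})"
    by (rule inj_onI) (use le in \<open>auto intro!: antisym\<close>)
  then have "card (gens - {?r}) \<le> card {..<?r}"
    by (rule card_inj_on_le) (use r in auto)
  moreover have "card gens \<le> card (gens - {?r}) + 1"
    using finite_gens by (cases "?r \<in> gens"; simp add: card_Diff_singleton_if; linarith)
  ultimately show ?thesis by simp
qed

text \<open>The last hypothesis is the failure of the first case in
  \<open>monom_in_span_gens\<close>. The bound \<open>m \<ge> 2\<close> inside it keeps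
  \<open>h = 0\<close> in degree 1, where \<open>(m - 1) * d\<close> is zero as well.\<close>

lemma gen_degree_eqI:
  assumes "m \<ge> 1" "h \<le> m * d" "\<not> (m \<ge> 2 \<and> h \<le> (m - 1) * d)"
  shows "gen_degree h = m"
proof (cases "h = 0")
  case True
  with assms show ?thesis by (simp add: gen_degree_def)
next
  case False
  have "(m - 1) * d \<le> h - 1"
    using assms False by (cases "m = 1") auto
  moreover have "h - 1 < m * d" using assms False by simp
  ultimately have "(h - 1) div d = m - 1"
    using assms(1) by (intro div_nat_eqI) (simp_all add: mult.commute)
  then show ?thesis using False assms(1) by (simp add: gen_degree_def)
qed

text \<open>The degree is recorded for the weight bound: when \<open>gens_of m\<close> is empty, the
  conclusion says that the monomial lies in \<open>RI2\<close>.\<close>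

lemma monom_in_span_gens:
  assumes m: "m \<ge> 1" and f: "f \<in> GS (m * d)"
  shows "monom f m \<in> RIq.span_mod (gens_of m) gen"
proof -
  define X where "X = {f. monom f m \<in> RIq.span_mod (gens_of m) gen}"
  note sub = RIq.subspace_span_mod[of "gens_of m" gen]
  have "f \<in> X"
  proof (rule GS_leading_term_induct[OF _ _ _ f])
    show "0 \<in> X" using RIq.subspace_0[OF sub] by (simp add: X_def)
  next
    fix x u c assume "x \<in> X" "u \<in> X"
    then have "monom x m + smult (\<iota> c) (monom u m) \<in> RIq.span_mod (gens_of m) gen"
      unfolding X_def by (intro RIq.subspace_add[OF sub] RIq.subspace_scale[OF sub]) simp_all
    then show "x + \<iota> c * u \<in> X" by (simp add: X_def add_monom smult_monom)
  next
    fix f assume f: "f \<in> GS (m * d)" "f \<noteq> 0"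
    then obtain h where h: "h \<in> H" "h \<le> m * d" "v f = - int h" using GS_v_in_H by blast
    \<comment> \<open>A product of sections from two positive degrees is zero modulo
      \<open>RI2\<close>, so it belongs to \<open>X\<close> and may serve to cancel a leading
      term.\<close>
    have prod: "u * u' \<in> X \<and> u * u' \<in> GS (m * d)"
      if "u \<in> GS (a * d)" "u' \<in> GS (b * d)" "a \<ge> 1" "b \<ge> 1" "a + b = m" for u u' a b
    proof
      have "monom u a * monom u' b \<in> RI2"
        using that by (intro product_span_mult monom_in_RI)
      then show "u * u' \<in> X"
        using that(5) by (auto simp: X_def mult_monom intro: RIq.span_mod_superset)
      have "u * u' \<in> GS (a * d + b * d)" by (intro GS_mult that)
      then show "u * u' \<in> GS (m * d)" by (simp flip: that(5) add: add_mult_distrib)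
    qed
    consider "m \<ge> 2 \<and> h \<le> (m - 1) * d" | "\<not> (m \<ge> 2 \<and> h \<le> (m - 1) * d)" "h \<in> gens"
      | "\<not> (m \<ge> 2 \<and> h \<le> (m - 1) * d)" "h \<notin> gens" by blast
    then show "\<exists>u\<in>X. u \<in> GS (m * d) \<and> u \<noteq> 0 \<and> v u = v f"
    proof cases
      case 1
      \<comment> \<open>The pole of \<open>f\<close> is small enough for degree
        \<open>m - 1\<close>, so \<open>f\<close> in degree \<open>m\<close> is the product of
        \<open>1\<close> in degree 1 with \<open>f\<close> in degree \<open>m - 1\<close>.\<close>
      then have "int h \<le> int ((m - 1) * d)" by (simp only: of_nat_le_iff)
      moreover have "f \<in> RA" using f by (simp add: GS_iff)
      ultimately have "f \<in> GS ((m - 1) * d)" unfolding GS_iff h(3) neg_le_iff_le by blast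
      moreover have "1 \<in> GS (1 * d)" using GS_const[of 1] by simp
      ultimately have "1 * f \<in> X" using 1 prod[of 1 1 f "m - 1"] by linarith
      then have "f \<in> X" by simp
      with f show ?thesis by blast
    next
      case 2
      have deg: "gen_degree h = m" by (rule gen_degree_eqI[OF m h(2) 2(1)])
      have "gen h \<in> RIq.span_mod (gens_of m) gen"
        by (rule RIq.span_mod_base) (use finite_gens 2 deg in auto)
      then have "\<phi> h \<in> X" by (simp add: X_def deg)
      with \<phi>[OF h(1)] GS_\<phi>[OF h(1,2)] h(3) show ?thesis by auto
    next
      case 3
      \<comment> \<open>Not being in \<open>gens\<close> splits the pole order as
        \<open>q * d\<close> plus an element of \<open>H\<close>. The degrees \<open>q\<close> and
        \<open>m - q\<close> of the factors are both positive, because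
        \<open>q * d < h \<le> m * d\<close>.\<close>
      with h(1) have h2: "h > q * d" "h - q * d \<in> H" by (auto simp: gens_def)
      from h2(1) h(2) have "q * d < m * d" by (rule less_le_trans)
      then have qm: "q < m" by simp
      let ?u = "\<phi> (q * d) * \<phi> (h - q * d)"
      have "h - q * d \<le> (m - q) * d" using h(2) by (simp add: diff_mult_distrib)
      then have "?u \<in> X \<and> ?u \<in> GS (m * d)"
        using q h2 qm by (intro prod[of _ q _ "m - q"] GS_\<phi>) auto
      moreover have "?u \<noteq> 0 \<and> v ?u = v f"
        using \<phi>[OF q(2)] \<phi>[OF h2(2)] h2(1) h(3) by (subst v_mult) (auto simp: RA_subset_K)
      ultimately show ?thesis by blast
    qed
  qed
  then show ?thesis by (simp add: X_def)
qed

lemma RI_spanned_by_gens: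
  assumes p: "p \<in> RI"
  shows "p \<in> RIq.span_mod gens gen"
proof -
  have "monom (coeff p m) m \<in> RIq.span_mod gens gen" for m
  proof (cases "m = 0")
    case True
    with p show ?thesis
      using RIq.subspace_0[OF RIq.subspace_span_mod] by (simp add: RI_iff)
  next
    case False
    then have "monom (coeff p m) m \<in> RIq.span_mod (gens_of m) gen"
      using p by (intro monom_in_span_gens) (auto simp: RI_iff)
    also have "\<dots> \<subseteq> RIq.span_mod gens gen"
      by (rule RIq.span_mod_mono[OF finite_gens]) auto
    finally show ?thesis .
  qed
  then have "(\<Sum>m\<le>degree p. monom (coeff p m) m) \<in> RIq.span_mod gens gen"
    by (intro RIq.subspace_sum[OF RIq.subspace_span_mod])
  then show ?thesis by (simp add: poly_as_sum_of_monoms)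
qed

text \<open>An element \<open>h\<close> of degree \<open>m > q\<close> exceeds
  \<open>(m - 1) * d\<close>, which is at least \<open>q * d\<close>. Hence \<open>h - q * d\<close>
  is a gap, at most \<open>Fr\<close>, and this bounds \<open>m\<close>.\<close>

lemma gens_of_empty:
  assumes "int m > int q + \<lceil>real Fr / real d\<rceil>"
  shows "gens_of m = {}"
proof (rule ccontr)
  assume "gens_of m \<noteq> {}"
  then obtain h where h: "h \<in> gens" "gen_degree h = m" by blast
  have "0 \<le> \<lceil>real Fr / real d\<rceil>" by (simp add: less_le_trans[of "-1" 0])
  with assms have mq: "m > q" by linarith
  have h0: "h \<noteq> 0"
  proof
    assume "h = 0"
    with h(2) have "m = 1" by (simp add: gen_degree_def)
    with mq q(1) show False by simp
  qed
  with h(2) have "(h - 1) div d = m - 1" by (simp add: gen_degree_def)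
  then have "(m - 1) * d \<le> h - 1" by (metis div_times_less_eq_dividend)
  with h0 have hm: "(m - 1) * d < h" by simp
  have "q * d \<le> (m - 1) * d" using mq by (intro mult_le_mono1) linarith
  with hm have "q * d < h" by (rule le_less_trans[rotated])
  with h(1) have "h - q * d \<notin> H" by (auto simp: gens_def)
  with gap_le_Fr have "h \<le> q * d + Fr" by fastforce
  with hm have "(m - 1) * d < q * d + Fr" by simp
  then have "real ((m - 1) * d) < real (q * d + Fr)" by (simp only: of_nat_less_iff)
  then have "real (m - 1) * real d < real q * real d + real Fr" by simp
  moreover have "real d > 0" using d by simp
  ultimately have "real (m - 1) < real q + real Fr / real d" by (simp add: field_simps)
  then have "real_of_int (int (m - 1) - int q) < real Fr / real d" by simp
  \<comment> \<open>An integer strictly below a real number is strictly below its ceiling. This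
    strictness compensates the \<open>- 1\<close> and gives the bound without an additional
    1.\<close>
  then have "int (m - 1) - int q < \<lceil>real Fr / real d\<rceil>" by (simp only: less_ceiling_iff)
  with assms mq show False by simp
qed

section \<open>Dimension and weights of the embedding\<close>

context
  fixes n f w
  assumes emb: "minimal_weighted_embedding \<iota> \<xi> C P d n f w"
begin

lemma emb_weight: "i \<le> n \<Longrightarrow> w i \<ge> 1"
  and emb_section: "i \<le> n \<Longrightarrow> f i \<in> GS (w i * d)"
  and emb_span: "p \<in> RI \<Longrightarrow> \<exists>c. p - (\<Sum>i\<le>n. smult (\<iota> (c i)) (monom (f i) (w i))) \<in> RI2"
  and emb_indep: "(\<Sum>i\<le>n. smult (\<iota> (c i)) (monom (f i) (w i))) \<in> RI2 \<Longrightarrow> \<forall>i\<in>{..n}. c i = 0"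
  using emb unfolding minimal_weighted_embedding_def basis_mod_def by blast+

text \<open>The \<open>n + 1\<close> generators are independent in a space spanned by at most
  \<open>q * d + 1\<close> elements; the two extra units cancel.\<close>

lemma dim_le: "n \<le> d * q"
proof -
  have "card {..n} \<le> card gens"
  proof (rule RIq.card_le_if_independent_mod[OF _ finite_gens _ emb_indep])
    fix i assume "i \<in> {..n}"
    then have "monom (f i) (w i) \<in> RI" using emb_weight emb_section by (intro monom_in_RI) auto
    from RI_spanned_by_gens[OF this]
    show "\<exists>c. monom (f i) (w i) - (\<Sum>h\<in>gens. smult (\<iota> (c h)) (gen h)) \<in> RI2"
      by (simp add: RIq.span_mod_def)
  qed simp_all
  with card_gens_le show ?thesis by (simp add: mult.commute)
qed

lemma weight_le:
  assumes i: "i \<le> n"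
  shows "int (w i) \<le> int q + \<lceil>real Fr / real d\<rceil>"
proof (rule ccontr)
  assume "\<not> ?thesis"
  then have "gens_of (w i) = {}" by (intro gens_of_empty) simp
  with monom_in_span_gens[OF emb_weight[OF i] emb_section[OF i]]
  have "monom (f i) (w i) \<in> RI2" by (simp add: RIq.span_mod_def)
  \<comment> \<open>Coefficients concentrated at \<open>i\<close> show that a basis element inside
    \<open>RI2\<close> would contradict independence.\<close>
  moreover have "(\<Sum>j\<le>n. smult (\<iota> (if j = i then 1 else 0)) (monom (f j) (w j)))
      = (\<Sum>j\<le>n. if j = i then monom (f j) (w j) else 0)"
    by (rule sum.cong) auto
  ultimately have "(\<Sum>j\<le>n. smult (\<iota> (if j = i then 1 else 0)) (monom (f j) (w j))) \<in> RI2"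
    using i by simp
  from emb_indep[OF this] i show False by (auto dest!: bspec[of _ _ i])
qed

text \<open>The sections \<open>f i\<close> of weight 1 and the functions \<open>\<phi> h\<close>
  with \<open>h \<le> d\<close> are both bases of H^0(dP), the degree 1 part of the quotient. Each
  family is independent and spanned by the other, which gives the two inequalities.\<close>

lemma card_weight_one: "card {i. i \<le> n \<and> w i = 1} = card (H \<inter> {..d})"
proof -
  interpret V: subspace_quotient "\<lambda>c x. \<iota> c * x" "{0}" by (rule subspace_quotient_zero)
  define I where "I = {i. i \<le> n \<and> w i = 1}"
  have I: "finite I" "I \<subseteq> {..n}" by (auto simp: I_def)
  have sum_I: "(\<Sum>i\<le>n. if w i = 1 then h i else 0) = (\<Sum>i\<in>I. h i)" for h :: "nat \<Rightarrow> 'K"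
  proof -
    have "{i \<in> {..n}. w i = 1} = I" by (auto simp: I_def)
    then show ?thesis by (simp add: sum.inter_filter[symmetric])
  qed
  have "card I \<le> card (H \<inter> {..d})"
  proof (rule V.card_le_if_independent_mod[of I "H \<inter> {..d}" f \<phi>])
    fix i assume "i \<in> I"
    then have "f i \<in> GS d" using emb_section[of i] by (simp add: I_def)
    then show "\<exists>c. f i - (\<Sum>h\<in>H \<inter> {..d}. \<iota> (c h) * \<phi> h) \<in> {0}" by (rule \<phi>_spans_GS)
  next
    fix c assume c: "(\<Sum>i\<in>I. \<iota> (c i) * f i) \<in> {0}"
    \<comment> \<open>A relation among the weight 1 sections is extended by zero to all generators,
      where independence is known.\<close>
    define c' where "c' i = (if w i = 1 then c i else 0)" for i
    have "(\<Sum>i\<le>n. smult (\<iota> (c' i)) (monom (f i) (w i)))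
        = (\<Sum>i\<le>n. monom (if w i = 1 then \<iota> (c i) * f i else 0) 1)"
      by (rule sum.cong) (auto simp: c'_def smult_monom)
    also have "\<dots> = monom (\<Sum>i\<le>n. if w i = 1 then \<iota> (c i) * f i else 0) 1"
      by (simp add: poly_eq_iff coeff_sum)
    also have "\<dots> = 0" unfolding sum_I using c by simp
    finally have "(\<Sum>i\<le>n. smult (\<iota> (c' i)) (monom (f i) (w i))) \<in> RI2"
      by (simp add: product_span_zero)
    from emb_indep[OF this] I(2) have "\<forall>i\<in>I. c' i = 0" by blast
    then show "\<forall>i\<in>I. c i = 0" by (simp add: I_def c'_def)
  qed (use I in auto)
  moreover have "card (H \<inter> {..d}) \<le> card I"
  proof (rule V.card_le_if_independent_mod[of "H \<inter> {..d}" I \<phi> f])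
    fix h assume "h \<in> H \<inter> {..d}"
    then have "\<phi> h \<in> GS (1 * d)" by (simp add: GS_\<phi>)
    then have "monom (\<phi> h) 1 \<in> RI" by (intro monom_in_RI) auto
    from emb_span[OF this] obtain c where
      "monom (\<phi> h) 1 - (\<Sum>i\<le>n. smult (\<iota> (c i)) (monom (f i) (w i))) \<in> RI2" by blast
    from RI2_coeff_1[OF this] have "\<phi> h - (\<Sum>i\<le>n. if w i = 1 then \<iota> (c i) * f i else 0) = 0"
      by (simp add: coeff_sum if_distrib cong: if_cong)
    then show "\<exists>c. \<phi> h - (\<Sum>i\<in>I. \<iota> (c i) * f i) \<in> {0}" unfolding sum_I by blast
  next
    fix c assume "(\<Sum>h\<in>H \<inter> {..d}. \<iota> (c h) * \<phi> h) \<in> {0}"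
    then show "\<forall>h\<in>H \<inter> {..d}. c h = 0" by (intro \<phi>_independent) auto
  qed (use I in auto)
  ultimately show ?thesis by (simp add: I_def)
qed

text \<open>All gaps are at most \<open>d\<close>, so removing them from the \<open>d + 1\<close>
  numbers up to \<open>d\<close> leaves \<open>d + 1 - g\<close>. Since \<open>d\<close> is itself
  in \<open>H\<close>, both \<open>q\<close> and the rounded quotient are at most 1.\<close>

lemma large_degree:
  assumes dF: "d > Fr"
  shows "int (card {i. i \<le> n \<and> w i = 1}) = int d + 1 - int g" "i \<le> n \<Longrightarrow> w i = 1 \<or> w i = 2"
proof -
  have gaps: "- H \<subseteq> {..d}" using gap_le_Fr dF by fastforce
  have "card {..d} = card (H \<inter> {..d}) + card (- H)"
  proof -
    have "{..d} = (H \<inter> {..d}) \<union> - H" using gaps by auto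
    then have "card {..d} = card ((H \<inter> {..d}) \<union> - H)" by (rule arg_cong)
    also have "\<dots> = card (H \<inter> {..d}) + card (- H)"
      using finite_gaps by (intro card_Un_disjoint) auto
    finally show ?thesis .
  qed
  then show "int (card {i. i \<le> n \<and> w i = 1}) = int d + 1 - int g"
    unfolding card_weight_one card_gaps by simp
  assume i: "i \<le> n"
  have "1 \<le> (1::nat) \<and> 1 * d \<in> H" using gap_le_Fr[of d] dF by auto
  then have "q \<le> 1" unfolding q_number_def by (rule Least_le)
  moreover have "\<lceil>real Fr / real d\<rceil> \<le> 1" using dF by (simp add: ceiling_le_iff)
  ultimately have "int (w i) \<le> 2" using weight_le[OF i] by linarith
  with emb_weight[OF i] show "w i = 1 \<or> w i = 2" by linarith
qed

end

end

theorem theorem1: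
  fixes \<iota> :: "'k::alg_closed_field \<Rightarrow> 'K::field"
    and \<xi> :: "'n::finite \<Rightarrow> 'K"
    and C :: "('n, 'k) proj_point set"
    and P :: "('n, 'k) proj_point"
    and g d n :: nat
    and f :: "nat \<Rightarrow> 'K"
    and w :: "nat \<Rightarrow> nat"
  assumes "smooth_projective_curve \<iota> \<xi> C"
    and "has_genus \<iota> \<xi> C g"
    and "g \<ge> 1"
    and "P \<in> C"
    and "d \<ge> 1"
    and "minimal_weighted_embedding \<iota> \<xi> C P d n f w"
  shows "n \<le> d * q_number \<iota> \<xi> C P d \<and>
    (\<forall>i\<le>n. int (w i) \<le> int (q_number \<iota> \<xi> C P d) +
        \<lceil>real (frobenius_number \<iota> \<xi> C P) / real d\<rceil>) \<and>
    (d > frobenius_number \<iota> \<xi> C P \<longrightarrow>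
        int (card {i. i \<le> n \<and> w i = 1}) = int d + 1 - int g \<and>
        (\<forall>i\<le>n. w i = 1 \<or> w i = 2))"
proof -
  interpret section_ring_of_point \<iota> \<xi> C P g d
    using assms(1,2,4,5) unfolding smooth_projective_curve_def by unfold_locales auto
  show ?thesis
    using dim_le[OF assms(6)] weight_le[OF assms(6)] large_degree[OF assms(6)] by blast
qed

end
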